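(* Let $\Omega\subset\mathbb{R}^n$ be a domain, and let $A\in L^\infty(\Omega,\mathcal{L}(\mathbb{R}^n))$ be normal, i.e. $A^*(x)A(x)=A(x)A^*(x)$ for a.e. $x\in\Omega$, and satisfy the ellipticity bounds $$\lambda|v|^2\le\langle A(x)v,v\rangle\ \text{ for all } v\in\mathbb{R}^n,\qquad \Vert A(x)\Vert<\Lambda,$$ for a.e. $x\in\Omega$ and some constants $0<\lambda\le\Lambda<\infty$. Let $\{u_j\}_j\subset W^{1,2}_{loc}(\Omega)$ be locally uniformly bounded in $L^2$ and suppose that for every $j$ $$\operatorname{div}\bigl(A(x)\nabla u_j(x)\bigr)=0\quad\text{on }\Omega .$$ Then on any smooth simply connected open set $U\Subset\Omega$ there exist a subsequence $\{u_{j_k}\}_k$ and some $u\in W^{1,2}(U)$ such that $u_{j_k}\to u$ in $W^{1,2}(U)$ as $k\to\infty$ and $$\operatorname{div}\bigl(A(x)\nabla u(x)\bigr)=0\quad\text{on }U .$$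
   Context: Functions are real-valued. $\mathcal{L}(\mathbb{R}^n)$ is the space of linear maps $\mathbb{R}^n\to\mathbb{R}^n$ with operator norm $\Vert\cdot\Vert$, and $A^*(x)$ is the adjoint (transpose) of $A(x)$. The divergence-form equations are understood in the weak (distributional) sense. A domain is a connected open set. $U\Subset\Omega$ means that $\overline U$ is a compact subset of $\Omega$; $U$ smooth means that $U$ has smooth boundary. "Locally uniformly bounded in $L^2$" means $\sup_j\Vert u_j\Vert_{L^2(K)}<\infty$ for every compact $K\subset\Omega$. *)

theory Defs
  imports "HOL-Analysis.Analysis"
begin

definition grad :: "(real ^ 'n \<Rightarrow> real) \<Rightarrow> real ^ 'n \<Rightarrow> real ^ 'n" where
  "grad f x = (\<chi> i. frechet_derivative f (at x) (axis i 1))"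

(* Only meant for open S; no condition is imposed on f outside S. *)
primrec Ck_on :: "nat \<Rightarrow> (real ^ 'n) set \<Rightarrow> (real ^ 'n \<Rightarrow> real) \<Rightarrow> bool" where
  "Ck_on 0 S f \<longleftrightarrow> continuous_on S f"
| "Ck_on (Suc k) S f \<longleftrightarrow>
     (\<forall>x\<in>S. f differentiable (at x)) \<and> (\<forall>i. Ck_on k S (\<lambda>x. grad f x $ i))"

definition smooth_on :: "(real ^ 'n) set \<Rightarrow> (real ^ 'n \<Rightarrow> real) \<Rightarrow> bool" where
  "smooth_on S f \<longleftrightarrow> (\<forall>k. Ck_on k S f)"

definition test_functions :: "(real ^ 'n) set \<Rightarrow> (real ^ 'n \<Rightarrow> real) set" where
  "test_functions S =
     {\<phi>. smooth_on UNIV \<phi> \<and> compact (closure {x. \<phi> x \<noteq> 0}) \<and> closure {x. \<phi> x \<noteq> 0} \<subseteq> S}"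

(* Near every boundary point the open set U is a strict sublevel set of a smooth function
   without critical points, i.e. U lies locally on one side of a smooth hypersurface. *)
definition smooth_boundary :: "(real ^ 'n) set \<Rightarrow> bool" where
  "smooth_boundary U \<longleftrightarrow>
     (\<forall>p\<in>frontier U. \<exists>V \<rho>. open V \<and> p \<in> V \<and> smooth_on V \<rho> \<and>
        (\<forall>x\<in>V. grad \<rho> x \<noteq> 0) \<and> U \<inter> V = {x\<in>V. \<rho> x < 0})"

definition compactly_contained :: "'a::topological_space set \<Rightarrow> 'a set \<Rightarrow> bool" where
  "compactly_contained U S \<longleftrightarrow> compact (closure U) \<and> closure U \<subseteq> S"

(* Function spaces consist of functions defined on all of the Euclidean space, of which only the
   values on the indicated set matter; functions equal a.e. on that set are not identified. *)

definition L1_loc :: "(real ^ 'n) set \<Rightarrow> (real ^ 'n \<Rightarrow> 'b::euclidean_space) \<Rightarrow> bool" where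
  "L1_loc S f \<longleftrightarrow> (\<forall>K. compact K \<and> K \<subseteq> S \<longrightarrow> integrable (lebesgue_on K) f)"

definition L2 :: "(real ^ 'n) set \<Rightarrow> (real ^ 'n \<Rightarrow> 'b::euclidean_space) \<Rightarrow> bool" where
  "L2 S f \<longleftrightarrow>
     f \<in> borel_measurable (lebesgue_on S) \<and> integrable (lebesgue_on S) (\<lambda>x. (norm (f x))\<^sup>2)"

definition L2_norm :: "(real ^ 'n) set \<Rightarrow> (real ^ 'n \<Rightarrow> 'b::euclidean_space) \<Rightarrow> real" where
  "L2_norm S f = sqrt (LINT x|lebesgue_on S. (norm (f x))\<^sup>2)"

definition L2_loc :: "(real ^ 'n) set \<Rightarrow> (real ^ 'n \<Rightarrow> 'b::euclidean_space) \<Rightarrow> bool" where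
  "L2_loc S f \<longleftrightarrow> (\<forall>K. compact K \<and> K \<subseteq> S \<longrightarrow> L2 K f)"

definition Linfty :: "(real ^ 'n) set \<Rightarrow> (real ^ 'n \<Rightarrow> 'b::real_normed_vector) \<Rightarrow> bool" where
  "Linfty S f \<longleftrightarrow>
     f \<in> borel_measurable (lebesgue_on S) \<and> (\<exists>C. AE x in lebesgue_on S. norm (f x) \<le> C)"

definition has_weak_grad ::
    "(real ^ 'n) set \<Rightarrow> (real ^ 'n \<Rightarrow> real) \<Rightarrow> (real ^ 'n \<Rightarrow> real ^ 'n) \<Rightarrow> bool" where
  "has_weak_grad S u g \<longleftrightarrow> L1_loc S u \<and> L1_loc S g \<and>
     (\<forall>\<phi>\<in>test_functions S.
        (LINT x|lebesgue_on S. u x *\<^sub>R grad \<phi> x) = - (LINT x|lebesgue_on S. \<phi> x *\<^sub>R g x))"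

(* For open S the weak gradient is unique up to a null set, so the choice does not matter. *)
definition weak_grad :: "(real ^ 'n) set \<Rightarrow> (real ^ 'n \<Rightarrow> real) \<Rightarrow> real ^ 'n \<Rightarrow> real ^ 'n" where
  "weak_grad S u = (SOME g. has_weak_grad S u g)"

definition W12 :: "(real ^ 'n) set \<Rightarrow> (real ^ 'n \<Rightarrow> real) \<Rightarrow> bool" where
  "W12 S u \<longleftrightarrow> L2 S u \<and> (\<exists>g. has_weak_grad S u g \<and> L2 S g)"

definition W12_loc :: "(real ^ 'n) set \<Rightarrow> (real ^ 'n \<Rightarrow> real) \<Rightarrow> bool" where
  "W12_loc S u \<longleftrightarrow> L2_loc S u \<and> (\<exists>g. has_weak_grad S u g \<and> L2_loc S g)"

definition W12_norm :: "(real ^ 'n) set \<Rightarrow> (real ^ 'n \<Rightarrow> real) \<Rightarrow> real" where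
  "W12_norm S u = sqrt ((L2_norm S u)\<^sup>2 + (L2_norm S (weak_grad S u))\<^sup>2)"

definition W12_converges ::
    "(real ^ 'n) set \<Rightarrow> (nat \<Rightarrow> real ^ 'n \<Rightarrow> real) \<Rightarrow> (real ^ 'n \<Rightarrow> real) \<Rightarrow> bool" where
  "W12_converges S f u \<longleftrightarrow> (\<forall>k. W12 S (f k)) \<and> W12 S u \<and>
     (\<lambda>k. W12_norm S (\<lambda>x. f k x - u x)) \<longlonglongrightarrow> 0"

definition weak_div_zero :: "(real ^ 'n) set \<Rightarrow> (real ^ 'n \<Rightarrow> real ^ 'n) \<Rightarrow> bool" where
  "weak_div_zero S F \<longleftrightarrow> L1_loc S F \<and>
     (\<forall>\<phi>\<in>test_functions S. (LINT x|lebesgue_on S. F x \<bullet> grad \<phi> x) = 0)"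

definition normal_map :: "('a::euclidean_space \<Rightarrow>\<^sub>L 'a) \<Rightarrow> bool" where
  "normal_map T \<longleftrightarrow>
     adjoint (blinfun_apply T) \<circ> blinfun_apply T = blinfun_apply T \<circ> adjoint (blinfun_apply T)"

end

theory Submission
  imports Defs "HOL-Complex_Analysis.Great_Picard" "HOL-Library.Diagonal_Subsequence"
begin

text \<open>
  The equation is linear, and for solutions of an elliptic equation in divergence form the gradient
  on a compact set is controlled by the function itself on a slightly larger compact set. Local
  bounds in mean square thus improve themselves to precompactness in the Sobolev norm on every
  relatively compact subset.

  The control is the Caccioppoli inequality (\<open>Caccioppoli_inequality\<close>): for a solution \<open>v\<close> and a
  cutoff \<open>\<zeta>\<close> the integral of \<open>\<zeta>\<^sup>2 |grad v|\<^sup>2\<close> is at most \<open>4 (Lam / lam)\<^sup>2\<close> times the integral of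
  \<open>|grad \<zeta>|\<^sup>2 v\<^sup>2\<close>. It comes from testing the equation with \<open>\<zeta>\<^sup>2 v\<close>, which is only weakly
  differentiable and therefore has to be approximated by smooth test functions
  (\<open>weak_div_zero_weakly_differentiable\<close>, resting on \<open>weak_grad_approx\<close>).

  Applied to the single solutions \<open>u j\<close>, the inequality bounds the products \<open>\<zeta> u j\<close> in the Sobolev
  space, where \<open>\<zeta>\<close> is one near the closure of \<open>U\<close>. By Rellich's theorem (\<open>Rellich_compactness\<close>) a
  subsequence of the products is Cauchy in mean square. Applied to the differences of solutions,
  which are solutions again, the inequality shows that along this subsequence the gradients are
  Cauchy in mean square on \<open>U\<close> as well (\<open>solutions_Cauchy_subsequence\<close>). The space of square
  integrable functions is complete (\<open>L2_complete\<close>), so the functions and their gradients converge;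
  the limit of the gradients is the weak gradient of the limit (\<open>has_weak_grad_limit\<close>), and since the
  coefficients are bounded, the fluxes converge and the equation persists
  (\<open>weak_div_zero_limit\<close>).

  All smoothing is done by convolution with a mollifier. Its error in mean square is that of the
  translates of the function (\<open>conv_approx\<close>). For a fixed square integrable function this tends to
  zero, which gives approximation by test functions; for a family with bounded gradients it does so
  uniformly (\<open>translation_estimate\<close>), which together with the theorem of Arzela and Ascoli for the
  mollified functions gives Rellich's theorem. Cutoff functions are mollified indicators; letting
  them shrink to compact sets gives the fundamental lemma of the calculus of variations
  (\<open>fundamental_lemma_of_variations\<close>) and with it the uniqueness of weak gradients
  (\<open>weak_grad_unique\<close>), by which the gradients chosen by \<open>weak_grad\<close> on different open sets are
  compared.
\<close>

section \<open>Smooth functions and bump functions\<close>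

lemma has_derivative_grad:
  fixes f :: "real ^ 'n \<Rightarrow> real"
  assumes "f differentiable (at x)"
  shows "(f has_derivative (\<lambda>h. grad f x \<bullet> h)) (at x)"
proof -
  let ?D = "frechet_derivative f (at x)"
  have D: "(f has_derivative ?D) (at x)"
    using assms frechet_derivative_works by blast
  interpret linear ?D using D by (rule has_derivative_linear)
  have "?D h = grad f x \<bullet> h" for h
  proof -
    have "?D h = ?D (\<Sum>i\<in>UNIV. h $ i *\<^sub>R axis i 1)"
      using basis_expansion[of h] by (simp add: scalar_mult_eq_scaleR)
    also have "\<dots> = grad f x \<bullet> h"
      by (simp add: sum scale grad_def inner_vec_def mult.commute)
    finally show ?thesis .
  qed
  with D show ?thesis by (metis ext)
qed

lemma grad_eqI:
  fixes f :: "real ^ 'n \<Rightarrow> real"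
  assumes "(f has_derivative (\<lambda>h. g \<bullet> h)) (at x)"
  shows "grad f x = g"
proof -
  have "frechet_derivative f (at x) = (\<lambda>h. g \<bullet> h)"
    using assms frechet_derivative_at by metis
  then show ?thesis by (simp add: grad_def vec_eq_iff inner_axis)
qed

lemma Ck_continuous: "Ck_on k UNIV f \<Longrightarrow> continuous_on UNIV f"
  by (cases k) (auto simp: continuous_on_eq_continuous_at intro: differentiable_imp_continuous_within)

text \<open>The recursion mentions continuity only at order zero, so lowering the order needs the fact
  that differentiable functions are continuous.\<close>
lemma Ck_Suc_imp: "Ck_on (Suc k) UNIV f \<Longrightarrow> Ck_on k UNIV f"
proof (induction k arbitrary: f)
  case 0 then show ?case using Ck_continuous[of "Suc 0"] by simp
next
  case (Suc k)
  show ?case unfolding Ck_on.simps(2)[of k]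
    using Suc.prems Suc.IH unfolding Ck_on.simps(2)[of "Suc k"] by blast
qed

lemma Ck_SucI:
  fixes f :: "real ^ 'n \<Rightarrow> real"
  assumes "\<And>x. (f has_derivative (\<lambda>h. g x \<bullet> h)) (at x)" "\<And>i. Ck_on k UNIV (\<lambda>x. g x $ i)"
  shows "Ck_on (Suc k) UNIV f"
proof -
  have "grad f = g" using grad_eqI[OF assms(1)] by auto
  then show ?thesis using assms by (auto simp: differentiable_def)
qed

lemma Ck_const [simp]: "Ck_on k UNIV (\<lambda>x::real^'n. c)"
proof (induction k arbitrary: c)
  case (Suc k)
  show ?case by (rule Ck_SucI[where g="\<lambda>_. 0"]) (use Suc in auto)
qed simp

lemma Ck_add: "Ck_on k UNIV f \<Longrightarrow> Ck_on k UNIV g \<Longrightarrow> Ck_on k UNIV (\<lambda>x. f x + g x)"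
proof (induction k arbitrary: f g)
  case (Suc k)
  show ?case
    by (rule Ck_SucI[where g="\<lambda>x. grad f x + grad g x"])
      (use Suc in \<open>auto simp: inner_add_left intro!: has_derivative_add has_derivative_grad\<close>)
qed (simp add: continuous_on_add)

lemma Ck_mult: "Ck_on k UNIV f \<Longrightarrow> Ck_on k UNIV g \<Longrightarrow> Ck_on k UNIV (\<lambda>x. f x * g x)"
proof (induction k arbitrary: f g)
  case (Suc k)
  show ?case
  proof (rule Ck_SucI[where g="\<lambda>x. f x *\<^sub>R grad g x + g x *\<^sub>R grad f x"])
    show "((\<lambda>x. f x * g x) has_derivative (\<bullet>) (f x *\<^sub>R grad g x + g x *\<^sub>R grad f x)) (at x)" for x
      by (rule has_derivative_eq_rhs[OF has_derivative_mult[OF has_derivative_grad has_derivative_grad]])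
        (use Suc.prems in \<open>auto simp: inner_add_left algebra_simps\<close>)
    show "Ck_on k UNIV (\<lambda>x. (f x *\<^sub>R grad g x + g x *\<^sub>R grad f x) $ i)" for i
      using Suc.prems Ck_Suc_imp[OF Suc.prems(1)] Ck_Suc_imp[OF Suc.prems(2)]
      by (auto intro!: Ck_add Suc.IH)
  qed
qed (simp add: continuous_on_mult)

lemma Ck_component: "Ck_on k UNIV (\<lambda>x::real^'n. x $ i)"
proof (cases k)
  case (Suc m)
  show ?thesis unfolding Suc
    by (rule Ck_SucI[where g="\<lambda>_. axis i 1"])
      (auto simp: inner_axis' bounded_linear_vec_nth bounded_linear_imp_has_derivative)
qed (auto intro: continuous_intros)

lemma Ck_sum: "finite I \<Longrightarrow> (\<And>i. i \<in> I \<Longrightarrow> Ck_on k UNIV (f i)) \<Longrightarrow> Ck_on k UNIV (\<lambda>x. \<Sum>i\<in>I. f i x)"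
  by (induction I rule: finite_induct) (auto intro: Ck_add)

lemma Ck_reflect:
  fixes f :: "real^'n \<Rightarrow> real"
  shows "Ck_on k UNIV f \<Longrightarrow> Ck_on k UNIV (\<lambda>y. f (a - y))"
proof (induction k arbitrary: f)
  case 0 then show ?case by (auto intro!: continuous_intros elim: continuous_on_compose2)
next
  case (Suc k)
  show ?case
  proof (rule Ck_SucI[where g="\<lambda>y. - grad f (a - y)"])
    show "((\<lambda>y. f (a - y)) has_derivative (\<bullet>) (- grad f (a - x))) (at x)" for x
    proof -
      have "(f has_derivative (\<bullet>) (grad f (a - x))) (at (a - x))"
        using Suc.prems by (intro has_derivative_grad) simp
      moreover have "((\<lambda>y. a - y) has_derivative (\<lambda>h. - h)) (at x)"
        by (auto intro!: derivative_eq_intros)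
      ultimately have "((\<lambda>y. f (a - y)) has_derivative (\<lambda>h. grad f (a - x) \<bullet> (- h))) (at x)"
        by (rule has_derivative_compose[rotated])
      then show ?thesis by (rule has_derivative_eq_rhs) auto
    qed
    show "Ck_on k UNIV (\<lambda>x. (- grad f (a - x)) $ i)" for i
      using Ck_mult[OF Ck_const[of k "-1"] Suc.IH[of "\<lambda>x. grad f x $ i"]] Suc.prems by simp
  qed
qed

text \<open>The smooth function that is flat at the origin, together with its quotients by powers of
  \<open>t\<close>: the derivative of a member is a linear combination of members, so smoothness of all of
  them follows from one derivative formula.\<close>
definition flat_exp :: "nat \<Rightarrow> real \<Rightarrow> real" where
  "flat_exp n t = (if t \<le> 0 then 0 else exp (- (1 / t)) / t ^ n)"

lemma flat_exp_tendsto_0: "(flat_exp n \<longlongrightarrow> 0) (at 0)"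
proof -
  have "((\<lambda>t::real. (inverse t) ^ n / exp (inverse t)) \<longlongrightarrow> 0) (at_right 0)"
    by (rule filterlim_compose[OF tendsto_power_div_exp_0 filterlim_inverse_at_top_right])
  then have "(flat_exp n \<longlongrightarrow> 0) (at_right 0)"
    by (rule Lim_transform_eventually)
      (auto simp: eventually_at_filter flat_exp_def exp_minus field_simps power_inverse
         intro!: always_eventually)
  moreover have "(flat_exp n \<longlongrightarrow> 0) (at_left 0)"
    by (rule tendsto_eventually) (auto simp: eventually_at_filter flat_exp_def)
  ultimately show ?thesis by (simp add: filterlim_split_at)
qed

lemma flat_exp_deriv:
  "(flat_exp n has_real_derivative (flat_exp (n+2) t - real n * flat_exp (n+1) t)) (at t)"
proof -
  consider "t < 0" | "t = 0" | "t > 0" by linarith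
  then show ?thesis
  proof cases
    case 1
    have "((\<lambda>_. 0) has_real_derivative 0) (at t)" by simp
    then have "(flat_exp n has_real_derivative 0) (at t)"
      by (rule has_field_derivative_transform_within_open[of _ _ _ "{..<0}"])
        (use 1 in \<open>auto simp: flat_exp_def\<close>)
    then show ?thesis using 1 by (simp add: flat_exp_def)
  next
    case 2
    \<comment> \<open>The difference quotient at the origin is the next member of the family.\<close>
    have "((\<lambda>h. (flat_exp n (0 + h) - flat_exp n 0) / h) \<longlongrightarrow> 0) (at 0)"
      by (rule Lim_transform_eventually[OF flat_exp_tendsto_0[of "n+1"]])
        (auto simp: flat_exp_def)
    then show ?thesis using 2 by (simp add: DERIV_def flat_exp_def)
  next
    case 3
    have "((\<lambda>t. exp (- (1 / t)) / t ^ n) has_real_derivative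
        (exp (- (1 / t)) / t ^ (n+2) - real n * (exp (- (1 / t)) / t ^ (n+1)))) (at t)"
      by (rule derivative_eq_intros refl | use 3 in \<open>simp; fail\<close>)+
        (use 3 in \<open>cases n; simp add: field_simps power2_eq_square\<close>)
    then have "(flat_exp n has_real_derivative
        (exp (- (1 / t)) / t ^ (n+2) - real n * (exp (- (1 / t)) / t ^ (n+1)))) (at t)"
      by (rule has_field_derivative_transform_within_open[of _ _ _ "{0<..}"])
        (use 3 in \<open>auto simp: flat_exp_def\<close>)
    then show ?thesis using 3 by (simp add: flat_exp_def)
  qed
qed

lemma Ck_flat_exp_compose:
  fixes f :: "real^'n \<Rightarrow> real"
  shows "Ck_on k UNIV f \<Longrightarrow> Ck_on k UNIV (\<lambda>x. flat_exp n (f x))"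
proof (induction k arbitrary: f n)
  case 0
  have "continuous_on UNIV (flat_exp n)"
    using flat_exp_deriv DERIV_isCont continuous_at_imp_continuous_on by blast
  with 0 show ?case by (auto elim: continuous_on_compose2)
next
  case (Suc k)
  let ?d = "\<lambda>x. flat_exp (n+2) (f x) - real n * flat_exp (n+1) (f x)"
  show ?case
  proof (rule Ck_SucI[where g="\<lambda>x. ?d x *\<^sub>R grad f x"])
    show "((\<lambda>x. flat_exp n (f x)) has_derivative (\<bullet>) (?d x *\<^sub>R grad f x)) (at x)" for x
    proof -
      have "(f has_derivative (\<bullet>) (grad f x)) (at x)"
        using Suc.prems by (intro has_derivative_grad) simp
      from has_derivative_compose[OF this has_field_derivative_imp_has_derivative[OF flat_exp_deriv]]
      show ?thesis by (rule has_derivative_eq_rhs) auto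
    qed
    have f: "Ck_on k UNIV f" using Suc.prems by (rule Ck_Suc_imp)
    have "Ck_on k UNIV ?d"
      using Ck_add[OF Suc.IH[OF f, of "n+2"] Ck_mult[OF Ck_const[of k "- real n"] Suc.IH[OF f, of "n+1"]]]
      by simp
    then show "Ck_on k UNIV (\<lambda>x. (?d x *\<^sub>R grad f x) $ i)" for i
      using Suc.prems by (auto intro!: Ck_mult)
  qed
qed

lemma smooth_on_iff:
  "smooth_on UNIV f \<longleftrightarrow> (\<forall>x. f differentiable (at x)) \<and> (\<forall>i. smooth_on UNIV (\<lambda>x. grad f x $ i))"
  (is "_ \<longleftrightarrow> ?r")
proof
  assume "smooth_on UNIV f"
  then have *: "Ck_on (Suc k) UNIV f" for k unfolding smooth_on_def by blast
  show ?r using * unfolding smooth_on_def Ck_on.simps(2) by blast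
next
  assume r: ?r
  then have *: "Ck_on (Suc k) UNIV f" for k unfolding smooth_on_def Ck_on.simps(2) by blast
  show "smooth_on UNIV f"
    unfolding smooth_on_def
  proof
    fix k show "Ck_on k UNIV f" using * Ck_Suc_imp by blast
  qed
qed

lemma smooth_on_differentiable: "smooth_on UNIV f \<Longrightarrow> f differentiable (at x)"
  by (drule smooth_on_iff[THEN iffD1]) simp

lemma smooth_on_grad: "smooth_on UNIV f \<Longrightarrow> smooth_on UNIV (\<lambda>x. grad f x $ i)"
  by (drule smooth_on_iff[THEN iffD1]) simp

lemma smooth_on_continuous: "smooth_on UNIV f \<Longrightarrow> continuous_on UNIV f"
  unfolding smooth_on_def by (drule spec[of _ 0]) simp

section \<open>Test functions and mollifiers\<close>

lemma test_functionsI: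
  fixes \<phi> :: "real^'n \<Rightarrow> real"
  assumes "smooth_on UNIV \<phi>" "compact K" "K \<subseteq> S" "\<And>x. x \<notin> K \<Longrightarrow> \<phi> x = 0"
  shows "\<phi> \<in> test_functions S"
proof -
  have "closure {x. \<phi> x \<noteq> 0} \<subseteq> K"
    using assms(2,4) by (intro closure_minimal) (auto intro: compact_imp_closed)
  then show ?thesis using assms unfolding test_functions_def
    by (auto simp: compact_eq_bounded_closed intro: bounded_subset)
qed

lemma test_functions_smooth: "\<phi> \<in> test_functions S \<Longrightarrow> smooth_on UNIV \<phi>"
  by (simp add: test_functions_def)

lemma test_functions_mono: "S \<subseteq> T \<Longrightarrow> test_functions S \<subseteq> test_functions T"
  by (auto simp: test_functions_def)

lemma grad_eq_0_of_locally_0: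
  fixes f :: "real^'n \<Rightarrow> real"
  assumes "open V" "x \<in> V" "\<And>y. y \<in> V \<Longrightarrow> f y = 0"
  shows "grad f x = 0"
proof (rule grad_eqI)
  have "((\<lambda>_. 0) has_derivative (\<lambda>h. 0::real)) (at x)" by simp
  then have "(f has_derivative (\<lambda>h. 0)) (at x)"
    by (rule has_derivative_transform_within_open[of _ _ _ _ V]) (use assms in auto)
  then show "(f has_derivative (\<bullet>) 0) (at x)"
    by (rule has_derivative_eq_rhs) auto
qed

lemma test_functions_support:
  fixes \<phi> :: "real^'n \<Rightarrow> real"
  assumes "\<phi> \<in> test_functions S"
  obtains K where "compact K" "K \<subseteq> S" "\<And>x. x \<notin> K \<Longrightarrow> \<phi> x = 0" "\<And>x. x \<notin> K \<Longrightarrow> grad \<phi> x = 0"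
proof
  let ?K = "closure {x. \<phi> x \<noteq> 0}"
  show "compact ?K" "?K \<subseteq> S" using assms by (auto simp: test_functions_def)
  show z: "\<phi> x = 0" if "x \<notin> ?K" for x using that closure_subset[of "{x. \<phi> x \<noteq> 0}"] by auto
  show "grad \<phi> x = 0" if "x \<notin> ?K" for x
    by (rule grad_eq_0_of_locally_0[of "- ?K"]; (rule z)?; use that in \<open>simp add: open_Compl\<close>)
qed

lemma test_functions_mult:
  fixes \<phi> :: "real^'n \<Rightarrow> real"
  assumes "\<phi> \<in> test_functions S" "smooth_on UNIV \<psi>"
  shows "(\<lambda>x. \<phi> x * \<psi> x) \<in> test_functions S"
proof -
  obtain K where K: "compact K" "K \<subseteq> S" "\<And>x. x \<notin> K \<Longrightarrow> \<phi> x = 0"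
    using test_functions_support[OF assms(1)] by metis
  have "smooth_on UNIV (\<lambda>x. \<phi> x * \<psi> x)"
    using assms(2) test_functions_smooth[OF assms(1)] by (auto simp: smooth_on_def Ck_mult)
  then show ?thesis by (rule test_functionsI[OF _ K(1,2)]) (use K in auto)
qed

lemma grad_mult:
  fixes f g :: "real^'n \<Rightarrow> real"
  assumes "f differentiable (at x)" "g differentiable (at x)"
  shows "grad (\<lambda>x. f x * g x) x = f x *\<^sub>R grad g x + g x *\<^sub>R grad f x"
  by (rule grad_eqI, rule has_derivative_eq_rhs[OF has_derivative_mult[OF has_derivative_grad has_derivative_grad]])
    (use assms in \<open>auto simp: inner_add_left algebra_simps\<close>)

lemma smooth_on_continuous_grad:
  assumes "smooth_on UNIV f" shows "continuous_on UNIV (grad f)"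
proof -
  have "continuous_on UNIV (\<lambda>x. grad f x $ i)" for i
    by (intro smooth_on_continuous smooth_on_grad assms)
  then have "continuous_on UNIV (\<lambda>x. \<chi> i. grad f x $ i)" by (rule continuous_on_vec_lambda)
  then show ?thesis by simp
qed

lemma test_functions_grad:
  fixes \<phi> :: "real^'n \<Rightarrow> real"
  assumes "\<phi> \<in> test_functions S"
  shows "(\<lambda>x. grad \<phi> x $ i) \<in> test_functions S"
proof -
  obtain K where K: "compact K" "K \<subseteq> S" "\<And>x. x \<notin> K \<Longrightarrow> grad \<phi> x = 0"
    using test_functions_support[OF assms(1)] by metis
  have "smooth_on UNIV (\<lambda>x. grad \<phi> x $ i)"
    by (intro smooth_on_grad test_functions_smooth[OF assms])
  then show ?thesis by (rule test_functionsI[OF _ K(1,2)]) (use K in auto)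
qed

lemma continuous_compact_support_bounded:
  fixes f :: "'a::topological_space \<Rightarrow> 'b::real_normed_vector"
  assumes "continuous_on UNIV f" "compact K" "\<And>x. x \<notin> K \<Longrightarrow> f x = 0"
  obtains B where "B > 0" "\<And>x. norm (f x) \<le> B"
proof -
  have "compact (f ` K)" using assms by (intro compact_continuous_image continuous_on_subset[OF assms(1)]) auto
  then obtain B where B: "B > 0" "\<forall>y\<in>f ` K. norm y \<le> B"
    using compact_imp_bounded bounded_pos by metis
  have "norm (f x) \<le> B" for x using B assms(3)[of x] by (cases "x \<in> K") auto
  with B show ?thesis using that by blast
qed

lemma test_functions_bounded:
  fixes \<phi> :: "real^'n \<Rightarrow> real"
  assumes "\<phi> \<in> test_functions S"
  obtains B where "B > 0" "\<And>x. \<bar>\<phi> x\<bar> \<le> B" "\<And>x. norm (grad \<phi> x) \<le> B"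
proof -
  obtain K where K: "compact K" "\<And>x. x \<notin> K \<Longrightarrow> \<phi> x = 0" "\<And>x. x \<notin> K \<Longrightarrow> grad \<phi> x = 0"
    using test_functions_support[OF assms(1)] by metis
  note s = test_functions_smooth[OF assms]
  obtain B where B: "B > 0" "\<And>x. norm (\<phi> x) \<le> B"
    using continuous_compact_support_bounded[OF smooth_on_continuous[OF s] K(1,2)] by blast
  obtain C where C: "C > 0" "\<And>x. norm (grad \<phi> x) \<le> C"
    using continuous_compact_support_bounded[OF smooth_on_continuous_grad[OF s] K(1,3)] by blast
  show ?thesis
    by (rule that[of "max B C"]) (use B C in \<open>auto simp: le_max_iff_disj\<close>)
qed

lemma test_functions_Lipschitz:
  fixes \<phi> :: "real^'n \<Rightarrow> real"
  assumes "\<phi> \<in> test_functions S"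
  obtains B where "B > 0" "\<And>x y. \<bar>\<phi> x - \<phi> y\<bar> \<le> B * norm (x - y)"
proof -
  obtain B where B: "B > 0" "\<And>x. norm (grad \<phi> x) \<le> B"
    using test_functions_bounded[OF assms] by metis
  have "norm (\<phi> x - \<phi> y) \<le> B * norm (x - y)" for x y
  proof (rule differentiable_bound[of UNIV _ "\<lambda>x. (\<bullet>) (grad \<phi> x)"])
    show "(\<phi> has_derivative (\<bullet>) (grad \<phi> x)) (at x within UNIV)" for x
      using has_derivative_grad[OF smooth_on_differentiable[OF test_functions_smooth[OF assms]]] by simp
    show "onorm ((\<bullet>) (grad \<phi> x)) \<le> B" for x
    proof (rule onorm_le)
      fix h show "norm (grad \<phi> x \<bullet> h) \<le> B * norm h"
        using Cauchy_Schwarz_ineq2[of "grad \<phi> x" h] mult_right_mono[OF B(2)[of x] norm_ge_zero[of h]]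
        by simp
    qed
  qed auto
  with B show ?thesis using that by auto
qed

text \<open>Makes the kernel of a convolution, as a function of the integration variable, available as
  a test function in the definition of a weak gradient.\<close>
lemma test_functions_reflect:
  fixes \<phi> :: "real^'n \<Rightarrow> real"
  assumes "\<phi> \<in> test_functions UNIV"
  shows "(\<lambda>y. \<phi> (a - y)) \<in> test_functions UNIV" "grad (\<lambda>y. \<phi> (a - y)) x = - grad \<phi> (a - x)"
proof -
  obtain K where K: "compact K" "\<And>x. x \<notin> K \<Longrightarrow> \<phi> x = 0"
    using test_functions_support[OF assms(1)] by metis
  note s = test_functions_smooth[OF assms]
  have "smooth_on UNIV (\<lambda>y. \<phi> (a - y))" using s by (auto simp: smooth_on_def Ck_reflect)
  moreover have "compact ((\<lambda>x. a - x) ` K)"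
    by (intro compact_continuous_image K continuous_intros)
  moreover have "\<phi> (a - x) = 0" if "x \<notin> (\<lambda>x. a - x) ` K" for x
    using that by (intro K(2)) force
  ultimately show "(\<lambda>y. \<phi> (a - y)) \<in> test_functions UNIV"
    by (intro test_functionsI) auto
  have "(\<phi> has_derivative (\<bullet>) (grad \<phi> (a - x))) (at (a - x))"
    using s by (intro has_derivative_grad smooth_on_differentiable)
  moreover have "((\<lambda>y. a - y) has_derivative (\<lambda>h. - h)) (at x)"
    by (auto intro!: derivative_eq_intros)
  ultimately have "((\<lambda>y. \<phi> (a - y)) has_derivative (\<lambda>h. grad \<phi> (a - x) \<bullet> (- h))) (at x)"
    by (rule has_derivative_compose[rotated])
  then have "((\<lambda>y. \<phi> (a - y)) has_derivative (\<bullet>) (- grad \<phi> (a - x))) (at x)"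
    by (rule has_derivative_eq_rhs) auto
  then show "grad (\<lambda>y. \<phi> (a - y)) x = - grad \<phi> (a - x)" by (rule grad_eqI)
qed

definition mollifier :: "real \<Rightarrow> (real^'n \<Rightarrow> real) \<Rightarrow> bool" where
  "mollifier \<epsilon> \<eta> \<longleftrightarrow> \<eta> \<in> test_functions UNIV \<and> (\<forall>x. 0 \<le> \<eta> x) \<and> (\<forall>x. \<epsilon> \<le> norm x \<longrightarrow> \<eta> x = 0)
     \<and> integrable lborel \<eta> \<and> integral\<^sup>L lborel \<eta> = 1"

lemma continuous_compact_support_integrable:
  fixes f :: "real^'n \<Rightarrow> 'b::euclidean_space"
  assumes "continuous_on UNIV f" "compact K" "\<And>x. x \<notin> K \<Longrightarrow> f x = 0"
  shows "integrable lborel f"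
proof -
  have "integrable lborel (\<lambda>x. indicator K x *\<^sub>R f x)"
    using borel_integrable_compact[OF assms(2), of f] continuous_on_subset[OF assms(1)]
    by (simp add: set_integrable_def)
  also have "(\<lambda>x. indicator K x *\<^sub>R f x) = f" using assms(3) by (auto simp: indicator_def)
  finally show ?thesis .
qed

text \<open>Compose the flat exponential with \<open>\<epsilon>\<^sup>2 - |x|\<^sup>2\<close> and normalise.\<close>
lemma ex_mollifier:
  assumes "\<epsilon> > 0"
  obtains \<eta> :: "real^'n \<Rightarrow> real" where "mollifier \<epsilon> \<eta>"
proof -
  define q where "q x = \<epsilon>\<^sup>2 + (\<Sum>i\<in>UNIV. (- 1) * (x $ i * x $ i))" for x :: "real^'n"
  have q: "q x = \<epsilon>\<^sup>2 - (norm x)\<^sup>2" for x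
    unfolding power2_norm_eq_inner inner_vec_def q_def by (simp add: sum_negf)
  have q_smooth: "Ck_on k UNIV q" for k
    unfolding q_def by (intro Ck_add Ck_const Ck_sum Ck_mult Ck_component) auto
  define b where "b x = flat_exp 0 (q x)" for x
  have b_pos: "b x > 0" if "norm x < \<epsilon>" for x
    using that power_strict_mono[OF that norm_ge_zero, of 2] by (simp add: b_def q flat_exp_def)
  have b_0: "b x = 0" if "norm x \<ge> \<epsilon>" for x
    using power_mono[OF that, of 2] assms by (simp add: b_def q flat_exp_def)
  have b_nonneg: "b x \<ge> 0" for x by (simp add: b_def flat_exp_def)
  have b_smooth: "Ck_on k UNIV b" for k
    unfolding b_def by (intro Ck_flat_exp_compose q_smooth)
  have b0': "x \<notin> cball 0 \<epsilon> \<Longrightarrow> b x = 0" for x using b_0[of x] by auto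
  have int: "integrable lborel b"
    by (rule continuous_compact_support_integrable[of _ "cball 0 \<epsilon>"])
      (use b_smooth[of 0] b0' in auto)
  define c where "c = integral\<^sup>L lborel b"
  have "c \<noteq> 0"
  proof
    assume "c = 0"
    then have "AE x in lborel. b x = 0"
      using integral_nonneg_eq_0_iff_AE[OF int] b_nonneg by (auto simp: c_def)
    then have "AE x in lborel. x \<notin> ball (0::real^'n) \<epsilon>"
      by eventually_elim (use b_pos in force)
    then have "ball (0::real^'n) \<epsilon> \<in> null_sets (lborel :: (real^'n) measure)"
      using AE_iff_null_sets[of "ball (0::real^'n) \<epsilon>" lborel] by simp
    then show False using open_not_negligible[of "ball (0::real^'n) \<epsilon>"] assms
      by (auto simp: negligible_iff_null_sets null_sets_completionI)
  qed
  moreover have "c \<ge> 0" unfolding c_def by (rule Bochner_Integration.integral_nonneg) (use b_nonneg in auto)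
  ultimately have c: "c > 0" by simp
  have "mollifier \<epsilon> (\<lambda>x. (1 / c) * b x)"
    unfolding mollifier_def
  proof (intro conjI allI impI)
    show "(\<lambda>x. (1 / c) * b x) \<in> test_functions UNIV"
    proof (rule test_functionsI[of _ "cball 0 \<epsilon>"])
      show "smooth_on UNIV (\<lambda>x. (1 / c) * b x)"
        unfolding smooth_on_def by (intro allI Ck_mult Ck_const b_smooth)
    qed (use b0' in auto)
    show "integral\<^sup>L lborel (\<lambda>x. 1 / c * b x) = 1" using c by (simp add: c_def)
  qed (use c b_nonneg b_0 int in auto)
  then show ?thesis by (rule that)
qed

section \<open>Convolution with a mollifier\<close>

lemma distr_reflect:
  fixes a :: "'a::euclidean_space"
  shows "distr lborel borel (\<lambda>x. a - x) = lborel"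
proof -
  have "lborel = density (distr lborel borel (\<lambda>x. a + (- 1) *\<^sub>R x)) (\<lambda>_. \<bar>- 1 :: real\<bar>^DIM('a))"
    by (rule lborel_affine) simp
  then show ?thesis by (simp add: density_1)
qed

lemma nn_integral_reflect:
  fixes a :: "'a::euclidean_space"
  assumes [measurable]: "f \<in> borel_measurable borel"
  shows "(\<integral>\<^sup>+ x. f (a - x) \<partial>lborel) = (\<integral>\<^sup>+ x. f x \<partial>lborel)"
proof -
  have "(\<integral>\<^sup>+ x. f x \<partial>lborel) = (\<integral>\<^sup>+ x. f x \<partial>distr lborel borel (\<lambda>x. a - x))"
    by (simp add: distr_reflect)
  also have "\<dots> = (\<integral>\<^sup>+ x. f (a - x) \<partial>lborel)"
    by (subst nn_integral_distr) auto
  finally show ?thesis ..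
qed

lemma nn_integral_translate:
  fixes a :: "'a::euclidean_space"
  assumes [measurable]: "f \<in> borel_measurable borel"
  shows "(\<integral>\<^sup>+ x. f (x - a) \<partial>lborel) = (\<integral>\<^sup>+ x. f x \<partial>lborel)"
  using nn_integral_reflect[of f 0] nn_integral_reflect[of "\<lambda>x. f (- x)" a] by simp

lemma integral_reflect_lborel:
  fixes a :: "'a::euclidean_space" and f :: "'a \<Rightarrow> 'b::{banach, second_countable_topology}"
  assumes [measurable]: "f \<in> borel_measurable borel"
  shows "integral\<^sup>L lborel (\<lambda>x. f (a - x)) = integral\<^sup>L lborel f"
proof -
  have "integral\<^sup>L lborel f = integral\<^sup>L (distr lborel borel (\<lambda>x. a - x)) f"
    by (simp add: distr_reflect)
  also have "\<dots> = integral\<^sup>L lborel (\<lambda>x. f (a - x))"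
    by (subst integral_distr) auto
  finally show ?thesis ..
qed

definition conv :: "('a::euclidean_space \<Rightarrow> real) \<Rightarrow> ('a \<Rightarrow> real) \<Rightarrow> 'a \<Rightarrow> real" where
  "conv \<eta> f x = (\<integral>y. \<eta> (x - y) * f y \<partial>lborel)"

lemma conv_commute:
  assumes [measurable]: "\<eta> \<in> borel_measurable borel" "f \<in> borel_measurable borel"
  shows "conv \<eta> f x = (\<integral>y. \<eta> y * f (x - y) \<partial>lborel)"
  using integral_reflect_lborel[of "\<lambda>y. \<eta> y * f (x - y)" x] by (simp add: conv_def)

lemma test_functions_borel [measurable_dest]:
  "\<phi> \<in> test_functions S \<Longrightarrow> \<phi> \<in> borel_measurable borel"
  by (intro borel_measurable_continuous_onI smooth_on_continuous test_functions_smooth)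

lemma conv_integrable:
  fixes f :: "real^'n \<Rightarrow> real"
  assumes \<eta>: "\<eta> \<in> test_functions UNIV" and f: "integrable lborel f"
  shows "integrable lborel (\<lambda>y. \<eta> (x - y) * f y)"
proof -
  obtain B where B: "B > 0" "\<And>x. \<bar>\<eta> x\<bar> \<le> B" using test_functions_bounded[OF \<eta>] by metis
  note [measurable] = test_functions_borel[OF \<eta>]
  show ?thesis
  proof (rule Bochner_Integration.integrable_bound)
    show "integrable lborel (\<lambda>y. B * f y)" using f by simp
    show "(\<lambda>y. \<eta> (x - y) * f y) \<in> borel_measurable lborel" using f by measurable
    show "AE y in lborel. norm (\<eta> (x - y) * f y) \<le> norm (B * f y)"
      using B by (auto simp: abs_mult intro!: mult_right_mono)
  qed
qed

lemma conv_bounded: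
  fixes f :: "real^'n \<Rightarrow> real"
  assumes \<eta>: "\<eta> \<in> test_functions UNIV" and f: "integrable lborel f" and B: "\<And>x. \<bar>\<eta> x\<bar> \<le> B"
  shows "\<bar>conv \<eta> f x\<bar> \<le> B * (\<integral>y. \<bar>f y\<bar> \<partial>lborel)"
proof -
  have "\<bar>conv \<eta> f x\<bar> \<le> (\<integral>y. \<bar>\<eta> (x - y) * f y\<bar> \<partial>lborel)"
    unfolding conv_def by (rule integral_abs_bound)
  also have "\<dots> \<le> (\<integral>y. B * \<bar>f y\<bar> \<partial>lborel)"
  proof (rule Bochner_Integration.integral_mono)
    show "integrable lborel (\<lambda>y. \<bar>\<eta> (x - y) * f y\<bar>)"
      using conv_integrable[OF \<eta> f] by (rule integrable_abs)
  qed (use f B in \<open>auto simp: abs_mult intro: mult_right_mono\<close>)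
  finally show ?thesis by simp
qed

lemma conv_Lipschitz:
  fixes f :: "real^'n \<Rightarrow> real"
  assumes \<eta>: "\<eta> \<in> test_functions UNIV" and f: "integrable lborel f"
    and L: "\<And>x y. \<bar>\<eta> x - \<eta> y\<bar> \<le> L * norm (x - y)"
  shows "\<bar>conv \<eta> f x - conv \<eta> f x'\<bar> \<le> L * norm (x - x') * (\<integral>y. \<bar>f y\<bar> \<partial>lborel)"
proof -
  have "conv \<eta> f x - conv \<eta> f x' = (\<integral>y. \<eta> (x - y) * f y - \<eta> (x' - y) * f y \<partial>lborel)"
    unfolding conv_def by (rule Bochner_Integration.integral_diff[symmetric]) (intro conv_integrable[OF \<eta> f])+
  also have "\<bar>\<dots>\<bar> \<le> (\<integral>y. \<bar>\<eta> (x - y) * f y - \<eta> (x' - y) * f y\<bar> \<partial>lborel)"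
    by (rule integral_abs_bound)
  also have "\<dots> \<le> (\<integral>y. (L * norm (x - x')) * \<bar>f y\<bar> \<partial>lborel)"
  proof (rule Bochner_Integration.integral_mono)
    show "integrable lborel (\<lambda>y. \<bar>\<eta> (x - y) * f y - \<eta> (x' - y) * f y\<bar>)"
      using conv_integrable[OF \<eta> f] by auto
    show "\<bar>\<eta> (x - y) * f y - \<eta> (x' - y) * f y\<bar> \<le> (L * norm (x - x')) * \<bar>f y\<bar>" for y
      using L[of "x - y" "x' - y"] by (auto simp: abs_mult left_diff_distrib[symmetric] intro!: mult_right_mono)
  qed (use f in auto)
  finally show ?thesis by simp
qed

text \<open>The function \<open>f\<close> is merely integrable, so the derivative falls on the kernel: its
  difference quotients are bounded by its Lipschitz constant, and dominated convergence applies
  with a multiple of \<open>|f|\<close> as majorant.\<close>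
lemma conv_has_derivative:
  fixes f :: "real^'n \<Rightarrow> real"
  assumes \<eta>: "\<eta> \<in> test_functions UNIV" and f: "integrable lborel f"
  shows "(conv \<eta> f has_derivative (\<lambda>h. (\<chi> i. conv (\<lambda>x. grad \<eta> x $ i) f x) \<bullet> h)) (at x)"
proof -
  let ?D = "\<lambda>h. (\<chi> i. conv (\<lambda>x. grad \<eta> x $ i) f x) \<bullet> h"
  obtain B where B: "B > 0" "\<And>x. norm (grad \<eta> x) \<le> B" using test_functions_bounded[OF \<eta>] by metis
  obtain L where L: "L > 0" "\<And>x y. \<bar>\<eta> x - \<eta> y\<bar> \<le> L * norm (x - y)"
    using test_functions_Lipschitz[OF \<eta>] by metis
  note i\<eta> = conv_integrable[OF \<eta> f]
  note ig = conv_integrable[OF test_functions_grad[OF \<eta>] f]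
  have D_eq: "?D h = (\<integral>y. (grad \<eta> (x - y) \<bullet> h) * f y \<partial>lborel)"
    and D_int: "integrable lborel (\<lambda>y. (grad \<eta> (x - y) \<bullet> h) * f y)" for h
  proof -
    have e: "(grad \<eta> (x - y) \<bullet> h) * f y = (\<Sum>i\<in>UNIV. h $ i * (grad \<eta> (x - y) $ i * f y))" for y
      by (simp add: inner_vec_def sum_distrib_right sum_distrib_left algebra_simps)
    show "integrable lborel (\<lambda>y. (grad \<eta> (x - y) \<bullet> h) * f y)"
      unfolding e using ig by simp
    have "(\<integral>y. (grad \<eta> (x - y) \<bullet> h) * f y \<partial>lborel)
        = (\<Sum>i\<in>UNIV. \<integral>y. h $ i * (grad \<eta> (x - y) $ i * f y) \<partial>lborel)"
      unfolding e by (rule Bochner_Integration.integral_sum) (use ig in simp)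
    then show "?D h = (\<integral>y. (grad \<eta> (x - y) \<bullet> h) * f y \<partial>lborel)"
      by (simp add: inner_vec_def conv_def mult.commute)
  qed
  show ?thesis
    unfolding has_derivative_at
  proof
    show "bounded_linear ?D" by (rule bounded_linear_inner_right)
    show "(\<lambda>h. norm (conv \<eta> f (x + h) - conv \<eta> f x - ?D h) / norm h) \<midarrow>0\<rightarrow> 0"
      unfolding LIMSEQ_SEQ_conv[symmetric]
    proof (intro allI impI, elim conjE)
      fix S :: "nat \<Rightarrow> real^'n" assume S0: "\<forall>n. S n \<noteq> 0" and S: "S \<longlonglongrightarrow> 0"
      define r where "r k y = (\<eta> (x + S k - y) - \<eta> (x - y) - grad \<eta> (x - y) \<bullet> S k) / norm (S k) * f y" for k y
      have r_eq: "r k y = (1 / norm (S k)) * (\<eta> (x + S k - y) * f y - \<eta> (x - y) * f y - (grad \<eta> (x - y) \<bullet> S k) * f y)" for k y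
        by (simp add: r_def algebra_simps diff_divide_distrib add_divide_distrib)
      have r_int: "integrable lborel (r k)" for k
        unfolding r_eq[abs_def] using i\<eta> D_int by simp
      have r_integral: "integral\<^sup>L lborel (r k) = (conv \<eta> f (x + S k) - conv \<eta> f x - ?D (S k)) / norm (S k)" for k
        unfolding r_eq[abs_def] D_eq using i\<eta> D_int by (simp add: conv_def)
      have "(\<lambda>k. integral\<^sup>L lborel (r k)) \<longlonglongrightarrow> (\<integral>y. 0 \<partial>(lborel :: (real^'n) measure))"
      proof (rule integral_dominated_convergence[where w="\<lambda>y. (L + B) * \<bar>f y\<bar>"])
        show "AE y in lborel. (\<lambda>k. r k y) \<longlonglongrightarrow> 0"
        proof (rule AE_I2)
          fix y
          have "(\<eta> has_derivative (\<bullet>) (grad \<eta> (x - y))) (at (x - y))"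
            by (intro has_derivative_grad smooth_on_differentiable test_functions_smooth[OF \<eta>])
          then have "(\<lambda>h. norm (\<eta> (x - y + h) - \<eta> (x - y) - grad \<eta> (x - y) \<bullet> h) / norm h) \<midarrow>0\<rightarrow> 0"
            unfolding has_derivative_at by blast
          then have "(\<lambda>k. norm (\<eta> (x - y + S k) - \<eta> (x - y) - grad \<eta> (x - y) \<bullet> S k) / norm (S k)) \<longlonglongrightarrow> 0"
            unfolding LIMSEQ_SEQ_conv[symmetric] using S0 S by blast
          then have "(\<lambda>k. norm (\<eta> (x - y + S k) - \<eta> (x - y) - grad \<eta> (x - y) \<bullet> S k) / norm (S k) * \<bar>f y\<bar>) \<longlonglongrightarrow> 0"
            by (rule tendsto_mult_left_zero)
          then have "(\<lambda>k. norm (r k y)) \<longlonglongrightarrow> 0"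
            by (simp add: r_def abs_mult diff_add_eq)
          then show "(\<lambda>k. r k y) \<longlonglongrightarrow> 0" by (rule tendsto_norm_zero_cancel)
        qed
        show "AE y in lborel. norm (r k y) \<le> (L + B) * \<bar>f y\<bar>" for k
        proof (rule AE_I2)
          fix y
          have "\<bar>\<eta> (x + S k - y) - \<eta> (x - y)\<bar> \<le> L * norm (S k)"
            using L(2)[of "x + S k - y" "x - y"] by simp
          moreover have "\<bar>grad \<eta> (x - y) \<bullet> S k\<bar> \<le> B * norm (S k)"
            using Cauchy_Schwarz_ineq2[of "grad \<eta> (x - y)" "S k"]
              mult_right_mono[OF B(2)[of "x - y"] norm_ge_zero[of "S k"]] by linarith
          ultimately have "\<bar>\<eta> (x + S k - y) - \<eta> (x - y) - grad \<eta> (x - y) \<bullet> S k\<bar> \<le> (L + B) * norm (S k)"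
            by (simp add: distrib_right)
          then have "\<bar>\<eta> (x + S k - y) - \<eta> (x - y) - grad \<eta> (x - y) \<bullet> S k\<bar> / norm (S k) \<le> L + B"
            using S0 by (simp add: divide_le_eq)
          from mult_right_mono[OF this abs_ge_zero[of "f y"]]
          show "norm (r k y) \<le> (L + B) * \<bar>f y\<bar>" by (simp add: r_def abs_mult)
        qed
        show "integrable lborel (\<lambda>y. (L + B) * \<bar>f y\<bar>)" using f by simp
      qed (use r_int in auto)
      then have "(\<lambda>k. norm (integral\<^sup>L lborel (r k))) \<longlonglongrightarrow> 0"
        by (simp add: tendsto_rabs_zero)
      then show "(\<lambda>k. norm (conv \<eta> f (x + S k) - conv \<eta> f x - ?D (S k)) / norm (S k)) \<longlonglongrightarrow> 0"
        by (simp add: r_integral)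
    qed
  qed
qed

lemma grad_conv:
  fixes f :: "real^'n \<Rightarrow> real"
  assumes "\<eta> \<in> test_functions UNIV" "integrable lborel f"
  shows "grad (conv \<eta> f) x = (\<chi> i. conv (\<lambda>x. grad \<eta> x $ i) f x)"
  by (rule grad_eqI[OF conv_has_derivative[OF assms]])

text \<open>The partial derivatives of a kernel are kernels again, so the induction runs over all
  kernels at once.\<close>
lemma smooth_on_conv:
  fixes f :: "real^'n \<Rightarrow> real"
  assumes \<eta>: "\<eta> \<in> test_functions UNIV" and f: "integrable lborel f"
  shows "smooth_on UNIV (conv \<eta> f)"
proof -
  have "Ck_on k UNIV (conv \<eta> f)" for k
    using \<eta>
  proof (induction k arbitrary: \<eta>)
    case 0
    have "isCont (conv \<eta> f) x" for x
      using conv_has_derivative[OF 0 f] has_derivative_continuous by blast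
    then show ?case by (simp add: continuous_at_imp_continuous_on)
  next
    case (Suc k)
    show ?case
      by (rule Ck_SucI[OF conv_has_derivative[OF Suc.prems f]])
        (use Suc.IH[OF test_functions_grad[OF Suc.prems]] in simp)
  qed
  then show ?thesis by (simp add: smooth_on_def)
qed

lemma conv_eq_0:
  assumes "\<And>y. y \<in> K \<Longrightarrow> \<eta> (x - y) = 0" "\<And>y. y \<notin> K \<Longrightarrow> f y = 0"
  shows "conv \<eta> f x = 0"
proof -
  have "(\<lambda>y. \<eta> (x - y) * f y) = (\<lambda>y. 0)" using assms by (metis mult_eq_0_iff)
  then show ?thesis by (simp add: conv_def)
qed

lemma conv_outside:
  fixes f :: "real^'n \<Rightarrow> real"
  assumes \<eta>: "mollifier \<epsilon> \<eta>" and K: "\<And>y. y \<notin> K \<Longrightarrow> f y = 0" and x: "x \<notin> {y + z |y z. y \<in> K \<and> z \<in> cball 0 \<epsilon>}"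
  shows "conv \<eta> f x = 0"
proof (rule conv_eq_0[OF _ K])
  fix y assume "y \<in> K"
  have "norm (x - y) > \<epsilon>"
  proof (rule ccontr)
    assume "\<not> ?thesis"
    then have "x = y + (x - y)" "x - y \<in> cball 0 \<epsilon>" by auto
    then show False using x \<open>y \<in> K\<close> by blast
  qed
  then show "\<eta> (x - y) = 0" using \<eta> unfolding mollifier_def by simp
qed auto

lemma conv_test_function:
  fixes f :: "real^'n \<Rightarrow> real"
  assumes \<eta>: "mollifier \<epsilon> \<eta>" and f: "integrable lborel f"
    and K: "compact K" "\<And>y. y \<notin> K \<Longrightarrow> f y = 0" and sub: "{y + z |y z. y \<in> K \<and> z \<in> cball 0 \<epsilon>} \<subseteq> S"
  shows "conv \<eta> f \<in> test_functions S"
proof (rule test_functionsI[OF _ _ sub])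
  show "smooth_on UNIV (conv \<eta> f)"
    using \<eta> f by (intro smooth_on_conv) (auto simp: mollifier_def)
  show "compact {y + z |y z. y \<in> K \<and> z \<in> cball 0 \<epsilon>}"
    using K(1) by (intro compact_sums) auto
  show "conv \<eta> f x = 0" if "x \<notin> {y + z |y z. y \<in> K \<and> z \<in> cball 0 \<epsilon>}" for x
    by (rule conv_outside[OF \<eta> K(2) that])
qed

lemma compact_thickening_subset:
  fixes K :: "'a::euclidean_space set"
  assumes K: "compact K" and S: "open S" "K \<subseteq> S"
  obtains d where "d > 0" "{y + z |y z. y \<in> K \<and> z \<in> cball 0 d} \<subseteq> S"
proof (cases "K = {}")
  case True then show ?thesis by (intro that[of 1]) auto
next
  case False
  obtain d where "d > 0" "(\<Union>y\<in>K. cball y d) \<subseteq> S"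
    using compact_subset_open_imp_cball_epsilon_subset[OF K S] by metis
  then show ?thesis by (intro that[of d]) (force simp: dist_norm)+
qed

text \<open>Mollify, at half of a distance \<open>d\<close> that keeps the thickening of \<open>K\<close> inside \<open>S\<close>, the
  indicator of the \<open>d/2\<close>-thickening of \<open>K\<close>: seen from a point of \<open>K\<close> the indicator is constantly
  one on the support of the kernel.\<close>
lemma ex_cutoff:
  fixes K :: "(real^'n) set"
  assumes K: "compact K" and S: "open S" "K \<subseteq> S"
  obtains \<zeta> where "\<zeta> \<in> test_functions S" "\<And>x. 0 \<le> \<zeta> x" "\<And>x. \<zeta> x \<le> 1" "\<And>x. x \<in> K \<Longrightarrow> \<zeta> x = 1"
proof -
  obtain d where d: "d > 0" "{y + z |y z. y \<in> K \<and> z \<in> cball 0 d} \<subseteq> S"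
    using compact_thickening_subset[OF K S] by blast
  define \<epsilon> where "\<epsilon> = d / 2"
  have \<epsilon>: "\<epsilon> > 0" using d by (simp add: \<epsilon>_def)
  obtain \<eta> :: "real^'n \<Rightarrow> real" where \<eta>: "mollifier \<epsilon> \<eta>" using ex_mollifier[OF \<epsilon>] .
  define K' where "K' = {y + z |y z. y \<in> K \<and> z \<in> cball 0 \<epsilon>}"
  have K': "compact K'" unfolding K'_def using K by (intro compact_sums) auto
  have [measurable]: "K' \<in> sets borel" using K' by (simp add: borel_compact)
  let ?f = "indicator K' :: real^'n \<Rightarrow> real"
  have f: "integrable lborel ?f"
    using emeasure_bounded_finite[OF compact_imp_bounded[OF K']] by (simp add: integrable_indicator_iff)
  have T: "\<eta> \<in> test_functions UNIV" and \<eta>0: "\<And>x. 0 \<le> \<eta> x" and \<eta>1: "integral\<^sup>L lborel \<eta> = 1"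
    and \<eta>s: "\<And>x. \<epsilon> \<le> norm x \<Longrightarrow> \<eta> x = 0" and \<eta>i: "integrable lborel \<eta>"
    using \<eta> by (auto simp: mollifier_def)
  note [measurable] = test_functions_borel[OF T]
  have c: "conv \<eta> ?f x = (\<integral>y. \<eta> y * ?f (x - y) \<partial>lborel)" for x
    by (rule conv_commute) measurable
  have ci: "integrable lborel (\<lambda>y. \<eta> y * ?f (x - y))" for x
    by (rule Bochner_Integration.integrable_bound[OF \<eta>i]) (auto simp: indicator_def)
  have sub: "{y + z |y z. y \<in> K' \<and> z \<in> cball 0 \<epsilon>} \<subseteq> S"
  proof
    fix x assume "x \<in> {y + z |y z. y \<in> K' \<and> z \<in> cball 0 \<epsilon>}"
    then obtain y z z' where x: "x = y + z' + z" "y \<in> K" "norm z' \<le> \<epsilon>" "norm z \<le> \<epsilon>"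
      unfolding K'_def by auto
    have "norm (z' + z) \<le> d" using norm_triangle_ineq[of z' z] x by (simp add: \<epsilon>_def)
    then have "y + (z' + z) \<in> {y + z |y z. y \<in> K \<and> z \<in> cball 0 d}"
      using x(2) by (intro CollectI exI[of _ y] exI[of _ "z' + z"]) auto
    then show "x \<in> S" using d(2) x(1) by (auto simp: add.assoc)
  qed
  show ?thesis
  proof (rule that)
    show "conv \<eta> ?f \<in> test_functions S"
      by (rule conv_test_function[OF \<eta> f K' _ sub]) auto
    show "0 \<le> conv \<eta> ?f x" for x unfolding conv_def using \<eta>0 by (intro Bochner_Integration.integral_nonneg) auto
    have "conv \<eta> ?f x \<le> integral\<^sup>L lborel \<eta>" for x
      unfolding c by (rule Bochner_Integration.integral_mono[OF ci \<eta>i]) (use \<eta>0 in \<open>auto simp: indicator_def\<close>)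
    then show "conv \<eta> ?f x \<le> 1" for x using \<eta>1 by simp
    show "conv \<eta> ?f x = 1" if "x \<in> K" for x
    proof -
      have "\<eta> y * ?f (x - y) = \<eta> y" for y
      proof (cases "norm y < \<epsilon>")
        case True
        have "x - y = x + (- y)" "- y \<in> cball 0 \<epsilon>" using True by auto
        then have "x - y \<in> K'" unfolding K'_def using that by blast
        then show ?thesis by simp
      qed (use \<eta>s in auto)
      then have "(\<lambda>y. \<eta> y * ?f (x - y)) = \<eta>" by (rule ext)
      then show ?thesis using \<eta>1 by (simp only: c)
    qed
  qed
qed

section \<open>Approximation in the mean square\<close>

text \<open>The squared mean square norm as an extended nonnegative number: bounds on it can be stated and
  combined before integrability is known.\<close>
abbreviation sq_integral :: "'a measure \<Rightarrow> ('a \<Rightarrow> real) \<Rightarrow> ennreal" where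
  "sq_integral M f \<equiv> (\<integral>\<^sup>+x. ennreal ((f x)\<^sup>2) \<partial>M)"

text \<open>Jensen's inequality for the square and the probability density \<open>\<rho>\<close>, obtained from the
  Cauchy-Schwarz inequality for \<open>sqrt \<rho>\<close> and \<open>sqrt \<rho> |g|\<close>. If \<open>\<rho> g\<close> is not integrable, then the
  integral on the left is zero by convention.\<close>
lemma power2_integral_le_weighted:
  fixes g \<rho> :: "'a \<Rightarrow> real"
  assumes [measurable]: "g \<in> borel_measurable M" and \<rho>: "integrable M \<rho>" "\<And>x. 0 \<le> \<rho> x" "integral\<^sup>L M \<rho> = 1"
  shows "ennreal ((\<integral>y. \<rho> y * g y \<partial>M)\<^sup>2) \<le> (\<integral>\<^sup>+y. ennreal (\<rho> y * (g y)\<^sup>2) \<partial>M)"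
proof (cases "integrable M (\<lambda>y. \<rho> y * g y)")
  case True
  have [measurable]: "\<rho> \<in> borel_measurable M" using \<rho>(1) by simp
  have "ennreal \<bar>\<integral>y. \<rho> y * g y \<partial>M\<bar> \<le> (\<integral>\<^sup>+y. ennreal \<bar>\<rho> y * g y\<bar> \<partial>M)"
    using integral_norm_bound_ennreal[OF True] by simp
  also have "\<dots> = (\<integral>\<^sup>+y. ennreal (sqrt (\<rho> y)) * ennreal (sqrt (\<rho> y) * \<bar>g y\<bar>) \<partial>M)"
    using \<rho>(2) by (simp add: abs_mult ennreal_mult'[symmetric] mult.assoc[symmetric])
  finally have "(ennreal \<bar>\<integral>y. \<rho> y * g y \<partial>M\<bar>)\<^sup>2
      \<le> (\<integral>\<^sup>+y. ennreal (sqrt (\<rho> y)) * ennreal (sqrt (\<rho> y) * \<bar>g y\<bar>) \<partial>M)\<^sup>2"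
    by (intro power_mono) auto
  also have "\<dots> \<le> (\<integral>\<^sup>+y. (ennreal (sqrt (\<rho> y)))\<^sup>2 \<partial>M) * (\<integral>\<^sup>+y. (ennreal (sqrt (\<rho> y) * \<bar>g y\<bar>))\<^sup>2 \<partial>M)"
    by (rule Cauchy_Schwarz_nn_integral) measurable
  also have "(\<integral>\<^sup>+y. (ennreal (sqrt (\<rho> y)))\<^sup>2 \<partial>M) = (\<integral>\<^sup>+y. ennreal (\<rho> y) \<partial>M)"
    using \<rho>(2) by (simp add: ennreal_power)
  also have "\<dots> = 1" using \<rho> by (subst nn_integral_eq_integral) auto
  finally show ?thesis using \<rho>(2) by (simp add: ennreal_power power_mult_distrib)
qed (simp add: not_integrable_integral_eq)

lemma integrable_reflect_lborel:
  fixes a :: "'a::euclidean_space" and f :: "'a \<Rightarrow> 'b::{banach, second_countable_topology}"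
  assumes "integrable lborel f"
  shows "integrable lborel (\<lambda>x. f (a - x))"
proof -
  have "integrable (distr lborel borel (\<lambda>x. a - x)) f" using assms by (simp add: distr_reflect)
  then show ?thesis by (subst (asm) integrable_distr_eq) (use assms in auto)
qed

text \<open>A mollification is a weighted mean of translates. By Jensen's inequality and Tonelli's
  theorem it is as close to \<open>f\<close> as the translates by vectors shorter than \<open>\<epsilon>\<close> are. The lemma is
  used twice: with continuity of translations for a single function, and with the gradient bound
  below for a whole family.\<close>
lemma conv_approx:
  fixes f :: "real^'n \<Rightarrow> real"
  assumes \<eta>: "mollifier \<epsilon> \<eta>" and f: "integrable lborel f"
    and B: "\<And>y. norm y < \<epsilon> \<Longrightarrow> sq_integral lborel (\<lambda>x. f (x - y) - f x) \<le> B"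
  shows "sq_integral lborel (\<lambda>x. conv \<eta> f x - f x) \<le> B"
proof -
  have T: "\<eta> \<in> test_functions UNIV" and \<eta>0: "\<And>x. 0 \<le> \<eta> x" and \<eta>1: "integral\<^sup>L lborel \<eta> = 1"
    and \<eta>s: "\<And>x. \<epsilon> \<le> norm x \<Longrightarrow> \<eta> x = 0" and \<eta>i: "integrable lborel \<eta>"
    using \<eta> by (auto simp: mollifier_def)
  have [measurable]: "\<eta> \<in> borel_measurable borel" "f \<in> borel_measurable borel"
    using T f test_functions_borel by auto
  have e: "conv \<eta> f x - f x = (\<integral>y. \<eta> y * (f (x - y) - f x) \<partial>lborel)" for x
  proof -
    have "integrable lborel (\<lambda>y. \<eta> y * f (x - y))"
      using integrable_reflect_lborel[OF conv_integrable[OF T f, of x], of x] by simp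
    then have "(\<integral>y. \<eta> y * (f (x - y) - f x) \<partial>lborel) = (\<integral>y. \<eta> y * f (x - y) \<partial>lborel) - (\<integral>y. \<eta> y * f x \<partial>lborel)"
      unfolding right_diff_distrib using \<eta>i by (intro Bochner_Integration.integral_diff) auto
    then show ?thesis using \<eta>1 by (simp add: conv_commute)
  qed
  have "sq_integral lborel (\<lambda>x. conv \<eta> f x - f x)
      \<le> (\<integral>\<^sup>+x. (\<integral>\<^sup>+y. ennreal (\<eta> y * (f (x - y) - f x)\<^sup>2) \<partial>lborel) \<partial>lborel)"
    unfolding e by (intro nn_integral_mono power2_integral_le_weighted \<eta>i \<eta>0 \<eta>1) measurable
  also have "\<dots> = (\<integral>\<^sup>+y. (\<integral>\<^sup>+x. ennreal (\<eta> y * (f (x - y) - f x)\<^sup>2) \<partial>lborel) \<partial>lborel)"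
    by (rule lborel_pair.Fubini') measurable
  also have "\<dots> = (\<integral>\<^sup>+y. ennreal (\<eta> y) * sq_integral lborel (\<lambda>x. f (x - y) - f x) \<partial>lborel)"
    using \<eta>0 by (simp add: ennreal_mult nn_integral_cmult)
  also have "\<dots> \<le> (\<integral>\<^sup>+y. ennreal (\<eta> y) * B \<partial>lborel)"
  proof (rule nn_integral_mono)
    fix y show "ennreal (\<eta> y) * sq_integral lborel (\<lambda>x. f (x - y) - f x) \<le> ennreal (\<eta> y) * B"
      using B[of y] \<eta>s[of y] by (cases "norm y < \<epsilon>") (auto intro: mult_left_mono)
  qed
  also have "\<dots> = (\<integral>\<^sup>+y. ennreal (\<eta> y) \<partial>lborel) * B" by (rule nn_integral_multc) measurable
  also have "(\<integral>\<^sup>+y. ennreal (\<eta> y) \<partial>lborel) = 1"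
    using \<eta>0 \<eta>1 \<eta>i by (subst nn_integral_eq_integral) auto
  finally show ?thesis by simp
qed

text \<open>The increment is the integral of the directional derivative over the segment from \<open>x\<close> to
  \<open>x - y\<close>; squaring it by Jensen's inequality and integrating in \<open>x\<close> first leaves the gradient
  integral at every point of the segment, because Lebesgue measure is translation invariant.\<close>
lemma translation_estimate:
  fixes \<phi> :: "real^'n \<Rightarrow> real"
  assumes \<phi>: "\<phi> \<in> test_functions UNIV"
  shows "sq_integral lborel (\<lambda>x. \<phi> (x - y) - \<phi> x)
    \<le> ennreal ((norm y)\<^sup>2) * sq_integral lborel (\<lambda>x. norm (grad \<phi> x))"
proof -
  note s = test_functions_smooth[OF \<phi>]
  note cg = smooth_on_continuous_grad[OF s]
  have [measurable]: "grad \<phi> \<in> borel_measurable borel"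
    by (rule borel_measurable_continuous_onI[OF cg])
  let ?\<rho> = "indicator {0..1} :: real \<Rightarrow> real"
  have p: "ennreal ((\<phi> (x - y) - \<phi> x)\<^sup>2)
      \<le> (\<integral>\<^sup>+t. ennreal (?\<rho> t * ((norm y)\<^sup>2 * (norm (grad \<phi> (x - t *\<^sub>R y)))\<^sup>2)) \<partial>lborel)" for x
  proof -
    let ?f = "\<lambda>t. - (grad \<phi> (x - t *\<^sub>R y) \<bullet> y)"
    have "(\<integral>t. ?\<rho> t *\<^sub>R ?f t \<partial>lborel) = \<phi> (x - 1 *\<^sub>R y) - \<phi> (x - 0 *\<^sub>R y)"
    proof (rule integral_FTC_atLeastAtMost)
      fix t :: real
      have "(\<phi> has_derivative (\<bullet>) (grad \<phi> (x - t *\<^sub>R y))) (at (x - t *\<^sub>R y))"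
        using s by (intro has_derivative_grad smooth_on_differentiable)
      moreover have "((\<lambda>t. x - t *\<^sub>R y) has_derivative (\<lambda>h. - (h *\<^sub>R y))) (at t)"
        by (auto intro!: derivative_eq_intros)
      ultimately have "((\<lambda>t. \<phi> (x - t *\<^sub>R y)) has_derivative (\<lambda>h. grad \<phi> (x - t *\<^sub>R y) \<bullet> (- (h *\<^sub>R y)))) (at t)"
        by (rule has_derivative_compose[rotated])
      then have "((\<lambda>t. \<phi> (x - t *\<^sub>R y)) has_vector_derivative ?f t) (at t)"
        unfolding has_vector_derivative_def by (rule has_derivative_eq_rhs) auto
      then show "((\<lambda>t. \<phi> (x - t *\<^sub>R y)) has_vector_derivative ?f t) (at t within {0..1})"
        by (rule has_vector_derivative_at_within)
    next
      show "continuous_on {0..1} ?f"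
        by (intro continuous_intros continuous_on_compose2[OF cg]) auto
    qed auto
    then have "ennreal ((\<phi> (x - y) - \<phi> x)\<^sup>2) = ennreal ((\<integral>t. ?\<rho> t * ?f t \<partial>lborel)\<^sup>2)" by simp
    also have "\<dots> \<le> (\<integral>\<^sup>+t. ennreal (?\<rho> t * (?f t)\<^sup>2) \<partial>lborel)"
      by (rule power2_integral_le_weighted) (auto simp: integrable_indicator_iff)
    also have "\<dots> \<le> (\<integral>\<^sup>+t. ennreal (?\<rho> t * ((norm y)\<^sup>2 * (norm (grad \<phi> (x - t *\<^sub>R y)))\<^sup>2)) \<partial>lborel)"
    proof (intro nn_integral_mono ennreal_leI mult_left_mono)
      fix t
      have "\<bar>grad \<phi> (x - t *\<^sub>R y) \<bullet> y\<bar> \<le> norm (grad \<phi> (x - t *\<^sub>R y)) * norm y"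
        by (rule Cauchy_Schwarz_ineq2)
      then have "\<bar>grad \<phi> (x - t *\<^sub>R y) \<bullet> y\<bar>\<^sup>2 \<le> (norm (grad \<phi> (x - t *\<^sub>R y)) * norm y)\<^sup>2"
        by (rule power_mono) simp
      then show "(?f t)\<^sup>2 \<le> (norm y)\<^sup>2 * (norm (grad \<phi> (x - t *\<^sub>R y)))\<^sup>2"
        by (simp add: power_mult_distrib mult.commute)
    qed auto
    finally show ?thesis .
  qed
  have "sq_integral lborel (\<lambda>x. \<phi> (x - y) - \<phi> x)
      \<le> (\<integral>\<^sup>+x. (\<integral>\<^sup>+t. ennreal (?\<rho> t * ((norm y)\<^sup>2 * (norm (grad \<phi> (x - t *\<^sub>R y)))\<^sup>2)) \<partial>lborel) \<partial>lborel)"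
    by (intro nn_integral_mono p)
  also have "\<dots> = (\<integral>\<^sup>+t. (\<integral>\<^sup>+x. ennreal (?\<rho> t * ((norm y)\<^sup>2 * (norm (grad \<phi> (x - t *\<^sub>R y)))\<^sup>2)) \<partial>lborel) \<partial>lborel)"
    by (rule lborel_pair.Fubini') measurable
  also have "\<dots> = (\<integral>\<^sup>+t. indicator {0..1} t * (ennreal ((norm y)\<^sup>2) * sq_integral lborel (\<lambda>x. norm (grad \<phi> (x - t *\<^sub>R y)))) \<partial>lborel)"
    by (simp add: ennreal_mult nn_integral_cmult ennreal_indicator)
  also have "\<dots> = (\<integral>\<^sup>+t. indicator {0..1::real} t * (ennreal ((norm y)\<^sup>2) * sq_integral lborel (\<lambda>x. norm (grad \<phi> x))) \<partial>lborel)"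
    using nn_integral_translate[of "\<lambda>x. ennreal ((norm (grad \<phi> x))\<^sup>2)"] by simp
  also have "\<dots> = (\<integral>\<^sup>+t. indicator {0..1::real} t \<partial>lborel) * (ennreal ((norm y)\<^sup>2) * sq_integral lborel (\<lambda>x. norm (grad \<phi> x)))"
    by (rule nn_integral_multc) measurable
  finally show ?thesis by simp
qed

text \<open>A measurable function is almost everywhere the limit of continuous functions. Clamping
  these to \<open>[- M, M]\<close> and multiplying them with the cutoff \<open>\<tau>\<close> does not disturb the limit and
  makes the convergence dominated.\<close>
lemma L2_dense_bounded:
  fixes f :: "'a::euclidean_space \<Rightarrow> real"
  assumes [measurable]: "f \<in> borel_measurable borel" and M: "\<And>x. \<bar>f x\<bar> \<le> M" and R: "\<And>x. R < norm x \<Longrightarrow> f x = 0"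
    and e: "e > 0"
  obtains g where "continuous_on UNIV g" "\<And>x. R + 1 < norm x \<Longrightarrow> g x = 0"
    "sq_integral lborel (\<lambda>x. f x - g x) \<le> ennreal e"
proof -
  have "f \<in> borel_measurable lebesgue" by (simp add: measurable_completion)
  then have "f measurable_on UNIV" by (intro lebesgue_measurable_imp_measurable_on) auto
  then obtain N g where N: "negligible N" and g: "\<And>n. continuous_on UNIV (g n)"
    and lim: "\<And>x. x \<notin> N \<Longrightarrow> (\<lambda>n. g n x) \<longlonglongrightarrow> f x"
    unfolding measurable_on_def by auto
  have M0: "M \<ge> 0" using M[of 0] by linarith
  define \<tau> where "\<tau> x = max 0 (min 1 (R + 1 - norm x))" for x :: 'a
  define h where "h n x = \<tau> x * max (- M) (min M (g n x))" for n x
  have \<tau>01: "0 \<le> \<tau> x" "\<tau> x \<le> 1" for x by (auto simp: \<tau>_def)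
  have \<tau>c: "continuous_on UNIV \<tau>" unfolding \<tau>_def by (intro continuous_intros)
  have hc: "continuous_on UNIV (h n)" for n
    unfolding h_def by (intro continuous_intros \<tau>c g)
  have [measurable]: "h n \<in> borel_measurable borel" for n
    by (rule borel_measurable_continuous_onI[OF hc])
  have h0: "h n x = 0" if "R + 1 < norm x" for n x
    using that by (simp add: h_def \<tau>_def)
  have hb: "\<bar>h n x\<bar> \<le> M" for n x
  proof -
    have "\<bar>max (- M) (min M (g n x))\<bar> \<le> M" using M0 by auto
    then have "\<bar>h n x\<bar> \<le> 1 * M"
      unfolding h_def abs_mult using \<tau>01[of x] M0 by (intro mult_mono) auto
    then show ?thesis by simp
  qed
  have hl: "(\<lambda>n. h n x) \<longlonglongrightarrow> f x" if "x \<notin> N" for x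
  proof -
    have "(\<lambda>n. h n x) \<longlonglongrightarrow> \<tau> x * max (- M) (min M (f x))"
      unfolding h_def by (intro tendsto_intros lim that)
    moreover have "\<tau> x * max (- M) (min M (f x)) = f x"
    proof (cases "R < norm x")
      case True
      then show ?thesis using R M0 by simp
    next
      case False
      then have "\<tau> x = 1" by (simp add: \<tau>_def)
      moreover have "max (- M) (min M (f x)) = f x" using M[of x] by (simp add: abs_le_iff)
      ultimately show ?thesis by simp
    qed
    ultimately show ?thesis by simp
  qed
  have AEN: "AE x in lborel. x \<notin> N"
    using AE_not_in[of N lebesgue] N by (simp add: negligible_iff_null_sets AE_completion_iff)
  let ?w = "\<lambda>x. (2 * M)\<^sup>2 * indicator (cball (0::'a) (R + 1)) x :: real"
  have "(\<lambda>n. \<integral>x. (f x - h n x)\<^sup>2 \<partial>lborel) \<longlonglongrightarrow> (\<integral>x. 0 \<partial>(lborel :: 'a measure))"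
   and int: "integrable lborel (\<lambda>x. (f x - h n x)\<^sup>2)" for n
  proof -
    have wi: "integrable lborel ?w"
      using emeasure_bounded_finite[of "cball (0::'a) (R + 1)"]
      by (intro integrable_mult_right) (simp add: integrable_indicator_iff)
    have bd: "AE x in lborel. norm ((f x - h n x)\<^sup>2) \<le> ?w x" for n
    proof (rule AE_I2)
      fix x
      have "\<bar>f x - h n x\<bar> \<le> 2 * M" using M[of x] hb[of n x] by linarith
      then have "\<bar>f x - h n x\<bar>\<^sup>2 \<le> (2 * M)\<^sup>2" by (rule power_mono) simp
      then show "norm ((f x - h n x)\<^sup>2) \<le> ?w x"
        using R[of x] h0[of x n] by (auto simp: indicator_def)
    qed
    show "integrable lborel (\<lambda>x. (f x - h n x)\<^sup>2)"
    proof (rule Bochner_Integration.integrable_bound[OF wi])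
      show "AE x in lborel. norm ((f x - h n x)\<^sup>2) \<le> norm (?w x)"
        using bd[of n] by (simp add: indicator_def)
    qed measurable
    show "(\<lambda>n. \<integral>x. (f x - h n x)\<^sup>2 \<partial>lborel) \<longlonglongrightarrow> (\<integral>x. 0 \<partial>(lborel :: 'a measure))"
    proof (rule integral_dominated_convergence[OF _ _ wi _ bd])
      show "AE x in lborel. (\<lambda>n. (f x - h n x)\<^sup>2) \<longlonglongrightarrow> 0"
        using AEN
      proof eventually_elim
        fix x assume "x \<notin> N"
        have "(\<lambda>n. (f x - h n x)\<^sup>2) \<longlonglongrightarrow> (f x - f x)\<^sup>2"
          by (intro tendsto_intros hl \<open>x \<notin> N\<close>)
        then show "(\<lambda>n. (f x - h n x)\<^sup>2) \<longlonglongrightarrow> 0" by simp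
      qed
    qed measurable
  qed
  then have "\<forall>\<^sub>F n in sequentially. (\<integral>x. (f x - h n x)\<^sup>2 \<partial>lborel) < e"
    using e by (intro order_tendstoD(2)[of _ 0]) auto
  then obtain n where n: "(\<integral>x. (f x - h n x)\<^sup>2 \<partial>lborel) < e" by (auto simp: eventually_sequentially)
  show ?thesis
  proof (rule that[OF hc h0])
    show "sq_integral lborel (\<lambda>x. f x - h n x) \<le> ennreal e"
      using n by (subst nn_integral_eq_integral[OF int]) (auto intro: ennreal_leI)
  qed
qed

lemma nn_integral_power2_triangle:
  assumes [measurable]: "f \<in> borel_measurable M" "g \<in> borel_measurable M" "h \<in> borel_measurable M" "k \<in> borel_measurable M"
  shows "sq_integral M (\<lambda>x. f x - k x) \<le> 3 * (sq_integral M (\<lambda>x. f x - g x)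
    + sq_integral M (\<lambda>x. g x - h x) + sq_integral M (\<lambda>x. h x - k x))"
proof -
  have "sq_integral M (\<lambda>x. f x - k x)
     \<le> (\<integral>\<^sup>+x. 3 * (ennreal ((f x - g x)\<^sup>2) + ennreal ((g x - h x)\<^sup>2) + ennreal ((h x - k x)\<^sup>2)) \<partial>M)"
  proof (rule nn_integral_mono)
    fix x
    have *: "(a + b + c)\<^sup>2 \<le> 3 * (a\<^sup>2 + b\<^sup>2 + c\<^sup>2)" for a b c :: real
      using zero_le_power2[of "a - b"] zero_le_power2[of "b - c"] zero_le_power2[of "a - c"]
      by (simp add: power2_eq_square algebra_simps)
    have "(f x - k x)\<^sup>2 \<le> 3 * ((f x - g x)\<^sup>2 + (g x - h x)\<^sup>2 + (h x - k x)\<^sup>2)"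
      using *[of "f x - g x" "g x - h x" "h x - k x"] by simp
    then have "ennreal ((f x - k x)\<^sup>2) \<le> ennreal (3 * ((f x - g x)\<^sup>2 + (g x - h x)\<^sup>2 + (h x - k x)\<^sup>2))"
      by (rule ennreal_leI)
    then show "ennreal ((f x - k x)\<^sup>2) \<le> 3 * (ennreal ((f x - g x)\<^sup>2) + ennreal ((g x - h x)\<^sup>2) + ennreal ((h x - k x)\<^sup>2))"
      by (simp add: ennreal_mult ennreal_plus)
  qed
  also have "\<dots> = 3 * (sq_integral M (\<lambda>x. f x - g x)
    + sq_integral M (\<lambda>x. g x - h x) + sq_integral M (\<lambda>x. h x - k x))"
    by (simp add: nn_integral_cmult nn_integral_add)
  finally show ?thesis .
qed

lemma L2_dense:
  fixes f :: "'a::euclidean_space \<Rightarrow> real"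
  assumes f: "f \<in> borel_measurable borel" "integrable lborel (\<lambda>x. (f x)\<^sup>2)" and R: "\<And>x. R < norm x \<Longrightarrow> f x = 0"
    and e: "e > 0"
  obtains g where "continuous_on UNIV g" "\<And>x. R + 1 < norm x \<Longrightarrow> g x = 0"
    "sq_integral lborel (\<lambda>x. f x - g x) \<le> ennreal e"
proof -
  note [measurable] = f(1)
  define T where "T m x = max (- real m) (min (real m) (f x))" for m x
  have [measurable]: "T m \<in> borel_measurable borel" for m unfolding T_def by measurable
  have b: "norm ((f x - T m x)\<^sup>2) \<le> (f x)\<^sup>2" for m x
  proof -
    have "\<bar>f x - T m x\<bar> \<le> \<bar>f x\<bar>" unfolding T_def by (auto simp: max_def min_def)
    then have "\<bar>f x - T m x\<bar>\<^sup>2 \<le> \<bar>f x\<bar>\<^sup>2" by (rule power_mono) simp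
    then show ?thesis by simp
  qed
  have int: "integrable lborel (\<lambda>x. (f x - T m x)\<^sup>2)" for m
    by (rule Bochner_Integration.integrable_bound[OF f(2)]) (use b in auto)
  have "(\<lambda>m. \<integral>x. (f x - T m x)\<^sup>2 \<partial>lborel) \<longlonglongrightarrow> (\<integral>x. 0 \<partial>(lborel :: 'a measure))"
  proof (rule integral_dominated_convergence[OF _ _ f(2)])
    show "AE x in lborel. (\<lambda>m. (f x - T m x)\<^sup>2) \<longlonglongrightarrow> 0"
    proof (intro AE_I2 tendsto_eventually)
      fix x
      obtain m0 :: nat where "\<bar>f x\<bar> \<le> real m0" using real_arch_simple by blast
      then show "\<forall>\<^sub>F m in sequentially. (f x - T m x)\<^sup>2 = 0"
        unfolding eventually_sequentially T_def
        by (intro exI[of _ m0]) (auto simp: max_def min_def)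
    qed
    show "AE x in lborel. norm ((f x - T m x)\<^sup>2) \<le> (f x)\<^sup>2" for m using b by auto
  qed measurable
  then have "\<forall>\<^sub>F n in sequentially. (\<integral>x. (f x - T n x)\<^sup>2 \<partial>lborel) < e/6"
    using e by (intro order_tendstoD(2)[of _ 0]) auto
  then obtain m where m: "(\<integral>x. (f x - T m x)\<^sup>2 \<partial>lborel) < e/6" by (auto simp: eventually_sequentially)
  then have m': "sq_integral lborel (\<lambda>x. f x - T m x) \<le> ennreal (e/6)"
    by (subst nn_integral_eq_integral[OF int]) (auto intro: ennreal_leI)
  obtain g where g: "continuous_on UNIV g" "\<And>x. R + 1 < norm x \<Longrightarrow> g x = 0"
    "sq_integral lborel (\<lambda>x. T m x - g x) \<le> ennreal (e/6)"
  proof (rule L2_dense_bounded[of "T m" "real m" R "e/6"])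
    show "\<bar>T m x\<bar> \<le> real m" for x by (auto simp: T_def)
    show "R < norm x \<Longrightarrow> T m x = 0" for x using R[of x] by (simp add: T_def)
  qed (use e in auto)
  have [measurable]: "g \<in> borel_measurable borel" by (rule borel_measurable_continuous_onI[OF g(1)])
  show ?thesis
  proof (rule that[OF g(1,2)])
    have "sq_integral lborel (\<lambda>x. f x - g x) \<le> 3 * (sq_integral lborel (\<lambda>x. f x - T m x)
      + sq_integral lborel (\<lambda>x. T m x - g x) + sq_integral lborel (\<lambda>x. g x - g x))"
      by (rule nn_integral_power2_triangle) measurable
    also have "\<dots> \<le> 3 * (ennreal (e/6) + ennreal (e/6) + 0)"
      using m' g(3) by (intro mult_left_mono add_mono) auto
    also have "\<dots> = ennreal e" using e by (simp add: ennreal_plus[symmetric] ennreal_mult'[symmetric] flip: ennreal_numeral)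
    finally show "sq_integral lborel (\<lambda>x. f x - g x) \<le> ennreal e" .
  qed
qed

lemma ex_sup_bound_imp_L2_bound:
  fixes R e :: real
  assumes e: "e > 0"
  obtains c where "c > 0"
    "\<And>h :: 'a::euclidean_space \<Rightarrow> real. (\<And>x. \<bar>h x\<bar> \<le> c) \<Longrightarrow> (\<And>x. R < norm x \<Longrightarrow> h x = 0)
       \<Longrightarrow> sq_integral lborel h \<le> ennreal e"
proof -
  define V where "V = measure lborel (cball (0::'a) R)"
  define c where "c = sqrt (e / (V + 1))"
  have V: "V \<ge> 0" by (simp add: V_def)
  have c: "c > 0" using e V by (simp add: c_def)
  have "c\<^sup>2 * V = e * (V / (V + 1))" using e V by (simp add: c_def)
  also have "\<dots> \<le> e * 1" using e V by (intro mult_left_mono) auto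
  finally have cV: "c\<^sup>2 * V \<le> e" by simp
  show ?thesis
  proof (rule that[OF c])
    fix h :: "'a \<Rightarrow> real" assume h: "\<And>x. \<bar>h x\<bar> \<le> c" "\<And>x. R < norm x \<Longrightarrow> h x = 0"
    have "sq_integral lborel h \<le> (\<integral>\<^sup>+x. ennreal (c\<^sup>2) * indicator (cball (0::'a) R) x \<partial>lborel)"
    proof (rule nn_integral_mono)
      fix x
      have "\<bar>h x\<bar>\<^sup>2 \<le> c\<^sup>2" using h(1) by (intro power_mono) auto
      then show "ennreal ((h x)\<^sup>2) \<le> ennreal (c\<^sup>2) * indicator (cball 0 R) x"
        using h(2)[of x] by (cases "norm x \<le> R") (auto intro: ennreal_leI)
    qed
    also have "\<dots> = ennreal (c\<^sup>2) * emeasure lborel (cball (0::'a) R)"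
      by (rule nn_integral_cmult_indicator) simp
    also have "emeasure lborel (cball (0::'a) R) = ennreal V"
      unfolding V_def by (rule emeasure_eq_ennreal_measure) (use emeasure_bounded_finite[of "cball (0::'a) R"] in auto)
    also have "ennreal (c\<^sup>2) * ennreal V = ennreal (c\<^sup>2 * V)" using V by (simp add: ennreal_mult)
    also have "\<dots> \<le> ennreal e" using cV by (rule ennreal_leI)
    finally show "sq_integral lborel h \<le> ennreal e" .
  qed
qed

lemma translation_continuous_continuous:
  fixes g :: "'a::euclidean_space \<Rightarrow> real"
  assumes g: "continuous_on UNIV g" "\<And>x. R < norm x \<Longrightarrow> g x = 0" and e: "e > 0"
  obtains \<delta> where "\<delta> > 0" "\<And>y. norm y < \<delta> \<Longrightarrow> sq_integral lborel (\<lambda>x. g (x - y) - g x) \<le> ennreal e"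
proof -
  obtain c where c: "c > 0"
    "\<And>h :: 'a \<Rightarrow> real. (\<And>x. \<bar>h x\<bar> \<le> c) \<Longrightarrow> (\<And>x. R + 1 < norm x \<Longrightarrow> h x = 0)
       \<Longrightarrow> sq_integral lborel h \<le> ennreal e"
    using ex_sup_bound_imp_L2_bound[OF e, of "R + 1"] by blast
  have "uniformly_continuous_on (cball 0 (R + 2)) g"
    by (intro compact_uniformly_continuous continuous_on_subset[OF g(1)]) auto
  then obtain d where d: "d > 0"
    "\<And>x x'. x \<in> cball 0 (R + 2) \<Longrightarrow> x' \<in> cball 0 (R + 2) \<Longrightarrow> dist x' x < d \<Longrightarrow> dist (g x') (g x) < c"
    unfolding uniformly_continuous_on_def using c(1) by metis
  show ?thesis
  proof (rule that[of "min d 1"])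
    show "min d 1 > 0" using d by simp
    fix y :: 'a assume y: "norm y < min d 1"
    have 0: "g (x - y) - g x = 0" if "R + 1 < norm x" for x
    proof -
      have "norm x \<le> norm (x - y) + norm y" using norm_triangle_ineq[of "x - y" y] by simp
      then have "R < norm (x - y)" "R < norm x" using that y by auto
      then show ?thesis using g(2) by simp
    qed
    have "\<bar>g (x - y) - g x\<bar> \<le> c" for x
    proof (cases "norm x \<le> R + 1")
      case True
      have "norm (x - y) \<le> R + 2" using norm_triangle_ineq4[of x y] True y by simp
      then have "dist (g (x - y)) (g x) < c"
        using True y by (intro d) (auto simp: dist_norm norm_minus_commute)
      then show ?thesis by (simp add: dist_real_def)
    next
      case False then show ?thesis using 0[of x] c(1) by simp
    qed
    then show "sq_integral lborel (\<lambda>x. g (x - y) - g x) \<le> ennreal e" by (rule c(2)) (rule 0)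
  qed
qed

text \<open>Translations are isometries, so their continuity passes from the dense class of continuous
  functions of compact support to square integrable functions of bounded support.\<close>
lemma translation_continuous_L2:
  fixes f :: "'a::euclidean_space \<Rightarrow> real"
  assumes f: "f \<in> borel_measurable borel" "integrable lborel (\<lambda>x. (f x)\<^sup>2)" and R: "\<And>x. R < norm x \<Longrightarrow> f x = 0"
    and e: "e > 0"
  obtains \<delta> where "\<delta> > 0" "\<And>y. norm y < \<delta> \<Longrightarrow> sq_integral lborel (\<lambda>x. f (x - y) - f x) \<le> ennreal e"
proof -
  note [measurable] = f(1)
  have e9: "e / 9 > 0" using e by simp
  obtain g where g: "continuous_on UNIV g" "\<And>x. R + 1 < norm x \<Longrightarrow> g x = 0"
    "sq_integral lborel (\<lambda>x. f x - g x) \<le> ennreal (e/9)"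
    using L2_dense[OF f R e9] by blast
  have [measurable]: "g \<in> borel_measurable borel" by (rule borel_measurable_continuous_onI[OF g(1)])
  obtain \<delta> where \<delta>: "\<delta> > 0" "\<And>y. norm y < \<delta> \<Longrightarrow> sq_integral lborel (\<lambda>x. g (x - y) - g x) \<le> ennreal (e/9)"
    using translation_continuous_continuous[OF g(1,2) e9] by blast
  show ?thesis
  proof (rule that[OF \<delta>(1)])
    fix y :: 'a assume y: "norm y < \<delta>"
    have "sq_integral lborel (\<lambda>x. f (x - y) - f x) \<le> 3 * (sq_integral lborel (\<lambda>x. f (x - y) - g (x - y))
      + sq_integral lborel (\<lambda>x. g (x - y) - g x) + sq_integral lborel (\<lambda>x. g x - f x))"
      by (rule nn_integral_power2_triangle) measurable
    also have "sq_integral lborel (\<lambda>x. f (x - y) - g (x - y)) = sq_integral lborel (\<lambda>x. f x - g x)"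
      by (rule nn_integral_translate[of "\<lambda>x. ennreal ((f x - g x)\<^sup>2)"]) measurable
    also have "sq_integral lborel (\<lambda>x. g x - f x) = sq_integral lborel (\<lambda>x. f x - g x)"
      by (simp add: power2_commute)
    also have "3 * (sq_integral lborel (\<lambda>x. f x - g x) + sq_integral lborel (\<lambda>x. g (x - y) - g x)
        + sq_integral lborel (\<lambda>x. f x - g x)) \<le> 3 * (ennreal (e/9) + ennreal (e/9) + ennreal (e/9))"
      using g(3) \<delta>(2)[OF y] by (intro mult_left_mono add_mono) auto
    also have "\<dots> = ennreal e" using e by (simp add: ennreal_plus[symmetric] ennreal_mult'[symmetric] flip: ennreal_numeral)
    finally show "sq_integral lborel (\<lambda>x. f (x - y) - f x) \<le> ennreal e" .
  qed
qed

lemma conv_tendsto_L2: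
  fixes f :: "real^'n \<Rightarrow> real"
  assumes f: "integrable lborel f" "integrable lborel (\<lambda>x. (f x)\<^sup>2)" and R: "\<And>x. R < norm x \<Longrightarrow> f x = 0"
    and e: "e > 0"
  obtains \<delta> where "\<delta> > 0"
    "\<And>\<epsilon> \<eta>. \<epsilon> \<le> \<delta> \<Longrightarrow> mollifier \<epsilon> \<eta> \<Longrightarrow> sq_integral lborel (\<lambda>x. conv \<eta> f x - f x) \<le> ennreal e"
proof -
  have "f \<in> borel_measurable borel" using f(1) by simp
  then obtain \<delta> where \<delta>: "\<delta> > 0" "\<And>y. norm y < \<delta> \<Longrightarrow> sq_integral lborel (\<lambda>x. f (x - y) - f x) \<le> ennreal e"
    using translation_continuous_L2[OF _ f(2) R e] by blast
  show ?thesis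
  proof (rule that[OF \<delta>(1)])
    fix \<epsilon> and \<eta> :: "real^'n \<Rightarrow> real" assume \<epsilon>: "\<epsilon> \<le> \<delta>" and \<eta>: "mollifier \<epsilon> \<eta>"
    show "sq_integral lborel (\<lambda>x. conv \<eta> f x - f x) \<le> ennreal e"
      by (rule conv_approx[OF \<eta> f(1)]) (rule \<delta>(2), use \<epsilon> in simp)
  qed
qed

section \<open>Compactness of bounded sequences of test functions\<close>

text \<open>Total boundedness in sequential form, for a family of distances \<open>d i j\<close> between the
  members of one sequence: extract successively for the tolerances \<open>1 / (n + 1)\<close> and take the
  diagonal.\<close>
lemma diagonal_Cauchy_subsequence:
  fixes d :: "nat \<Rightarrow> nat \<Rightarrow> ennreal"
  assumes "\<And>e (s::nat \<Rightarrow> nat). (e::real) > 0 \<Longrightarrow> strict_mono s \<Longrightarrow>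
      \<exists>t::nat \<Rightarrow> nat. strict_mono t \<and> (\<forall>i j. d (s (t i)) (s (t j)) \<le> ennreal e)"
  obtains r :: "nat \<Rightarrow> nat" where "strict_mono r"
    "\<And>e::real. e > 0 \<Longrightarrow> \<exists>N. \<forall>i\<ge>N. \<forall>j\<ge>N. d (r i) (r j) \<le> ennreal e"
proof -
  let ?P = "\<lambda>n s. \<forall>i j. d (s i) (s j) \<le> ennreal (1 / Suc n)"
  interpret subseqs ?P
    by unfold_locales (use assms[of "1 / Suc _"] in auto)
  have h: "?P k (diagseq \<circ> ((+) (Suc k)))" for k
    by (rule diagseq_holds) auto
  show ?thesis
  proof (rule that[OF subseq_diagseq])
    fix e :: real assume "e > 0"
    then obtain k where k: "1 / real (Suc k) < e"
      using reals_Archimedean[of e] by (auto simp: inverse_eq_divide)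
    have "d (diagseq i) (diagseq j) \<le> ennreal e" if "i \<ge> Suc k" "j \<ge> Suc k" for i j
    proof -
      have "d (diagseq i) (diagseq j) \<le> ennreal (1 / Suc k)"
        using h[of k, rule_format, of "i - Suc k" "j - Suc k"] that by simp
      also have "\<dots> \<le> ennreal e" using k by (intro ennreal_leI) simp
      finally show ?thesis .
    qed
    then show "\<exists>N. \<forall>i\<ge>N. \<forall>j\<ge>N. d (diagseq i) (diagseq j) \<le> ennreal e" by blast
  qed
qed

text \<open>Mollifying at scale \<open>\<epsilon>\<close> displaces every member of the sequence by at most \<open>\<epsilon> sqrt M\<close> in
  mean square, uniformly in \<open>j\<close>. At a fixed scale the mollified functions are uniformly bounded
  and uniformly Lipschitz on a common ball, so the theorem of Arzela and Ascoli gives a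
  uniformly convergent subsequence. Letting the scale decrease along a diagonal sequence gives
  the result.\<close>
lemma Rellich_test_functions:
  fixes \<phi> :: "nat \<Rightarrow> real^'n \<Rightarrow> real"
  assumes \<phi>: "\<And>j. \<phi> j \<in> test_functions UNIV" and R: "\<And>j x. R < norm x \<Longrightarrow> \<phi> j x = 0"
    and M: "\<And>j. sq_integral lborel (\<lambda>x. \<phi> j x) \<le> ennreal M"
      "\<And>j. sq_integral lborel (\<lambda>x. norm (grad (\<phi> j) x)) \<le> ennreal M"
  obtains r :: "nat \<Rightarrow> nat" where "strict_mono r"
    "\<And>e. e > 0 \<Longrightarrow> \<exists>N. \<forall>i\<ge>N. \<forall>j\<ge>N. sq_integral lborel (\<lambda>x. \<phi> (r i) x - \<phi> (r j) x) \<le> ennreal e"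
proof -
  note [measurable] = test_functions_borel[OF \<phi>]
  define M' where "M' = max M 0 + 1"
  have M': "M' > 0" "M \<le> M'" by (auto simp: M'_def)
  have \<phi>i: "integrable lborel (\<phi> j)" for j
    by (rule continuous_compact_support_integrable[of _ "cball 0 R"])
      (use R in \<open>auto intro: smooth_on_continuous test_functions_smooth[OF \<phi>]\<close>)
  define V where "V = measure lborel (cball (0::real^'n) R)"
  define C where "C = V + M'"
  \<comment> \<open>The uniform and Lipschitz bounds of a convolution involve the integral of the modulus,
    which a common bounded support controls by the mean square.\<close>
  have L1: "(\<integral>x. \<bar>\<phi> j x\<bar> \<partial>lborel) \<le> C" for j
  proof -
    have "ennreal (\<integral>x. \<bar>\<phi> j x\<bar> \<partial>lborel) = (\<integral>\<^sup>+x. ennreal \<bar>\<phi> j x\<bar> \<partial>lborel)"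
      by (rule nn_integral_eq_integral[symmetric]) (use \<phi>i in auto)
    also have "\<dots> \<le> (\<integral>\<^sup>+x. indicator (cball 0 R) x + ennreal ((\<phi> j x)\<^sup>2) \<partial>lborel)"
    proof (rule nn_integral_mono)
      fix x
      have "\<bar>\<phi> j x\<bar> \<le> 1 + (\<phi> j x)\<^sup>2"
        using zero_le_power2[of "\<bar>\<phi> j x\<bar> - 1"] by (simp add: power2_diff)
      then have "ennreal \<bar>\<phi> j x\<bar> \<le> 1 + ennreal ((\<phi> j x)\<^sup>2)"
        by (metis ennreal_1 ennreal_leI ennreal_plus zero_le_one zero_le_power2)
      then show "ennreal \<bar>\<phi> j x\<bar> \<le> indicator (cball 0 R) x + ennreal ((\<phi> j x)\<^sup>2)"
        using R[of x j] by (cases "norm x \<le> R") auto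
    qed
    also have "\<dots> = emeasure lborel (cball (0::real^'n) R) + sq_integral lborel (\<lambda>x. \<phi> j x)"
      by (subst nn_integral_add) (measurable, auto)
    also have "emeasure lborel (cball (0::real^'n) R) = ennreal V"
      unfolding V_def by (rule emeasure_eq_ennreal_measure) (use emeasure_bounded_finite[of "cball (0::real^'n) R"] in auto)
    also have "ennreal V + sq_integral lborel (\<lambda>x. \<phi> j x) \<le> ennreal V + ennreal M'"
      by (intro add_left_mono order_trans[OF M(1)] ennreal_leI M')
    also have "\<dots> = ennreal C" using M' by (simp add: C_def V_def)
    finally show ?thesis using M' by (subst (asm) ennreal_le_iff) (auto simp: C_def V_def)
  qed
  let ?d = "\<lambda>i j. \<integral>\<^sup>+x. ennreal ((\<phi> i x - \<phi> j x)\<^sup>2) \<partial>lborel"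
  have "\<exists>t::nat \<Rightarrow> nat. strict_mono t \<and> (\<forall>i j. ?d (s (t i)) (s (t j)) \<le> ennreal e)"
    if e: "e > 0" for e and s :: "nat \<Rightarrow> nat"
  proof -
    define \<epsilon> where "\<epsilon> = min 1 (sqrt (e / 9 / M'))"
    have \<epsilon>: "\<epsilon> > 0" "\<epsilon> \<le> 1" using e M' by (auto simp: \<epsilon>_def)
    have "\<epsilon>\<^sup>2 \<le> (sqrt (e / 9 / M'))\<^sup>2" using \<epsilon> by (intro power_mono) (auto simp: \<epsilon>_def)
    then have \<epsilon>M: "\<epsilon>\<^sup>2 * M' \<le> e / 9" using e M' by (simp add: field_simps)
    obtain \<eta> :: "real^'n \<Rightarrow> real" where \<eta>: "mollifier \<epsilon> \<eta>" using ex_mollifier[OF \<epsilon>(1)] .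
    then have T: "\<eta> \<in> test_functions UNIV" by (simp add: mollifier_def)
    define F where "F j = conv \<eta> (\<phi> j)" for j
    \<comment> \<open>The tolerance is split into three ninths because the square of a sum of three terms costs
      a factor three.\<close>
    have near: "sq_integral lborel (\<lambda>x. F j x - \<phi> j x) \<le> ennreal (e / 9)" for j
      unfolding F_def
    proof (rule conv_approx[OF \<eta> \<phi>i])
      fix y :: "real^'n" assume y: "norm y < \<epsilon>"
      have "sq_integral lborel (\<lambda>x. \<phi> j (x - y) - \<phi> j x)
          \<le> ennreal ((norm y)\<^sup>2) * sq_integral lborel (\<lambda>x. norm (grad (\<phi> j) x))"
        by (rule translation_estimate[OF \<phi>])
      also have "\<dots> \<le> ennreal (\<epsilon>\<^sup>2) * ennreal M'"
        using y by (intro mult_mono order_trans[OF M(2)] ennreal_leI M' power_mono) auto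
      also have "\<dots> = ennreal (\<epsilon>\<^sup>2 * M')" using M' by (simp add: ennreal_mult)
      also have "\<dots> \<le> ennreal (e / 9)" using \<epsilon>M by (rule ennreal_leI)
      finally show "sq_integral lborel (\<lambda>x. \<phi> j (x - y) - \<phi> j x) \<le> ennreal (e / 9)" .
    qed
    obtain B where B: "B > 0" "\<And>x. \<bar>\<eta> x\<bar> \<le> B" using test_functions_bounded[OF T] by metis
    obtain L where L: "L > 0" "\<And>x y. \<bar>\<eta> x - \<eta> y\<bar> \<le> L * norm (x - y)"
      using test_functions_Lipschitz[OF T] by metis
    have C: "C > 0" using M' by (simp add: C_def V_def add_nonneg_pos)
    have e9: "e / 9 > 0" using e by simp
    obtain c where c: "c > 0"
      "\<And>h :: real^'n \<Rightarrow> real. (\<And>x. \<bar>h x\<bar> \<le> c) \<Longrightarrow> (\<And>x. R + 1 < norm x \<Longrightarrow> h x = 0)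
         \<Longrightarrow> sq_integral lborel h \<le> ennreal (e / 9)"
      using ex_sup_bound_imp_L2_bound[OF e9, of "R + 1"] by blast
    obtain g k where k: "strict_mono (k :: nat \<Rightarrow> nat)"
      "\<And>e. 0 < e \<Longrightarrow> \<exists>N. \<forall>n x. n \<ge> N \<and> x \<in> cball 0 (R + 1) \<longrightarrow> norm (F (s (k n)) x - g x) < e"
    proof (rule Arzela_Ascoli[of "cball (0::real^'n) (R + 1)" "\<lambda>n. F (s n)" "B * C"])
      show "compact (cball (0::real^'n) (R + 1))" by simp
      show "norm (F (s n) x) \<le> B * C" for n x
      proof -
        have "norm (F (s n) x) \<le> B * (\<integral>y. \<bar>\<phi> (s n) y\<bar> \<partial>lborel)"
          unfolding F_def real_norm_def by (rule conv_bounded[OF T \<phi>i B(2)])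
        also have "\<dots> \<le> B * C" using B(1) L1 by (intro mult_left_mono) auto
        finally show ?thesis .
      qed
      show "\<exists>d. 0 < d \<and> (\<forall>n y. y \<in> cball 0 (R + 1) \<and> norm (x - y) < d \<longrightarrow> norm (F (s n) x - F (s n) y) < e)"
        if "0 < e" for x and e :: real
      proof (intro exI[of _ "e / (L * C)"] conjI allI impI, goal_cases)
        case 1 show ?case using that L C by simp
      next
        case (2 n y)
        have "norm (F (s n) x - F (s n) y) \<le> L * norm (x - y) * (\<integral>y. \<bar>\<phi> (s n) y\<bar> \<partial>lborel)"
          unfolding F_def real_norm_def by (rule conv_Lipschitz[OF T \<phi>i L(2)])
        also have "\<dots> \<le> L * norm (x - y) * C" using L(1) L1 by (intro mult_left_mono) auto
        also have "\<dots> < e" using 2 L(1) C by (simp add: field_simps)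
        finally show ?case .
      qed
    qed blast
    obtain N where N: "\<And>n x. n \<ge> N \<Longrightarrow> x \<in> cball 0 (R + 1) \<Longrightarrow> norm (F (s (k n)) x - g x) < c / 2"
      using k(2)[of "c / 2"] c(1) by auto
    define t where "t n = k (n + N)" for n
    have F0: "F j x = 0" if "R + 1 < norm x" for j x
      unfolding F_def
    proof (rule conv_outside[OF \<eta>, of "cball 0 R"])
      show "x \<notin> {y + z |y z. y \<in> cball 0 R \<and> z \<in> cball 0 \<epsilon>}"
      proof safe
        fix y z assume "y \<in> cball (0::real^'n) R" "z \<in> cball (0::real^'n) \<epsilon>" "x = y + z"
        then show False using norm_triangle_ineq[of y z] \<epsilon>(2) that by simp
      qed
    qed (use R in auto)
    have [measurable]: "F j \<in> borel_measurable borel" for j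
      unfolding F_def by (intro borel_measurable_continuous_onI smooth_on_continuous smooth_on_conv T \<phi>i)
    have "?d (s (t i)) (s (t j)) \<le> ennreal e" for i j
    proof -
      let ?a = "s (t i)" and ?b = "s (t j)"
      have mid: "sq_integral lborel (\<lambda>x. F ?a x - F ?b x) \<le> ennreal (e / 9)"
      proof (rule c(2))
        fix x :: "real^'n"
        show "\<bar>F ?a x - F ?b x\<bar> \<le> c"
        proof (cases "norm x \<le> R + 1")
          case True
          then have "\<bar>F ?a x - g x\<bar> < c / 2" "\<bar>F ?b x - g x\<bar> < c / 2"
            using N[of "i + N" x] N[of "j + N" x] by (auto simp: t_def)
          then show ?thesis by linarith
        next
          case False then show ?thesis using F0[of x] c(1) by simp
        qed
      qed (use F0 in auto)
      have "?d ?a ?b \<le> 3 * (sq_integral lborel (\<lambda>x. \<phi> ?a x - F ?a x)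
        + sq_integral lborel (\<lambda>x. F ?a x - F ?b x) + sq_integral lborel (\<lambda>x. F ?b x - \<phi> ?b x))"
        by (rule nn_integral_power2_triangle) measurable
      also have "sq_integral lborel (\<lambda>x. \<phi> ?a x - F ?a x) = sq_integral lborel (\<lambda>x. F ?a x - \<phi> ?a x)"
        by (simp add: power2_commute)
      also have "3 * (sq_integral lborel (\<lambda>x. F ?a x - \<phi> ?a x)
          + sq_integral lborel (\<lambda>x. F ?a x - F ?b x) + sq_integral lborel (\<lambda>x. F ?b x - \<phi> ?b x))
          \<le> 3 * (ennreal (e/9) + ennreal (e/9) + ennreal (e/9))"
        by (intro mult_left_mono add_mono mid near) auto
      also have "\<dots> = ennreal e" using e by (simp add: ennreal_plus[symmetric] ennreal_mult'[symmetric] flip: ennreal_numeral)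
      finally show ?thesis .
    qed
    moreover have "strict_mono t"
      using k(1) by (auto simp: t_def strict_mono_def)
    ultimately show ?thesis by blast
  qed
  then show ?thesis using diagonal_Cauchy_subsequence[of ?d] that by blast
qed

section \<open>Weak gradients\<close>

text \<open>Test functions on \<open>S\<close> vanish outside \<open>S\<close>, so the integrals over \<open>S\<close> in weak formulations
  are integrals over the whole space, where functions on different open sets can be compared.\<close>
lemma lebesgue_on_support:
  fixes f :: "'a::euclidean_space \<Rightarrow> 'b::{banach, second_countable_topology}"
  assumes "S \<in> sets lebesgue" "\<And>x. x \<notin> S \<Longrightarrow> f x = 0"
  shows "integrable (lebesgue_on S) f \<longleftrightarrow> integrable lebesgue f"
    "(LINT x|lebesgue_on S. f x) = (LINT x|lebesgue. f x)"
proof -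
  have S: "S \<inter> space lebesgue \<in> sets lebesgue" using assms(1) by simp
  have e: "(\<lambda>x. indicator S x *\<^sub>R f x) = f" using assms(2) by (auto simp: indicator_def)
  show "integrable (lebesgue_on S) f \<longleftrightarrow> integrable lebesgue f"
    using integrable_restrict_space[OF S, of f] by (simp add: e)
  show "(LINT x|lebesgue_on S. f x) = (LINT x|lebesgue. f x)"
    using integral_restrict_space[OF S, of f] by (simp add: e)
qed

lemma integrable_lebesgue_on:
  fixes f :: "'a::euclidean_space \<Rightarrow> 'b::{banach, second_countable_topology}"
  assumes "S \<in> sets lebesgue" "integrable lebesgue f"
  shows "integrable (lebesgue_on S) f"
  using integrable_restrict_space[of S lebesgue f] integrable_mult_indicator[OF assms] assms by simp

lemma continuous_borel_lebesgue:
  fixes f :: "'a::euclidean_space \<Rightarrow> 'b::metric_space"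
  assumes "continuous_on UNIV f" shows "f \<in> borel_measurable lebesgue"
  using borel_measurable_continuous_onI[OF assms] by (simp add: measurable_completion)

lemma sets_lebesgue_compact: "compact K \<Longrightarrow> K \<in> sets lebesgue"
  and sets_lebesgue_open: "open U \<Longrightarrow> U \<in> sets lebesgue"
  by (auto simp: borel_compact)

lemma L1_loc_mult_integrable:
  fixes f :: "real^'n \<Rightarrow> 'b::euclidean_space"
  assumes f: "L1_loc S f" and \<psi>: "continuous_on UNIV \<psi>" and K: "compact K" "K \<subseteq> S" "\<And>x. x \<notin> K \<Longrightarrow> \<psi> x = 0"
  shows "integrable lebesgue (\<lambda>x. \<psi> x *\<^sub>R f x)"
proof -
  obtain B where B: "B > 0" "\<And>x. norm (\<psi> x) \<le> B"
    using continuous_compact_support_bounded[OF \<psi> K(1,3)] by blast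
  have [measurable]: "\<psi> \<in> borel_measurable lebesgue" by (rule continuous_borel_lebesgue[OF \<psi>])
  have "integrable (lebesgue_on K) f" using f K by (simp add: L1_loc_def)
  then have i: "integrable lebesgue (\<lambda>x. indicator K x *\<^sub>R f x)"
    using integrable_restrict_space[of K lebesgue f] sets_lebesgue_compact[OF K(1)] by simp
  have "integrable lebesgue (\<lambda>x. \<psi> x *\<^sub>R (indicator K x *\<^sub>R f x))"
  proof (rule Bochner_Integration.integrable_bound)
    show "integrable lebesgue (\<lambda>x. B *\<^sub>R (indicator K x *\<^sub>R f x))" by (intro integrable_scaleR_right i)
    show "AE x in lebesgue. norm (\<psi> x *\<^sub>R indicator K x *\<^sub>R f x) \<le> norm (B *\<^sub>R indicator K x *\<^sub>R f x)"
      using B by (intro AE_I2) (simp add: indicator_def mult_right_mono)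
  qed (use i in measurable)
  moreover have "(\<lambda>x. \<psi> x *\<^sub>R (indicator K x *\<^sub>R f x)) = (\<lambda>x. \<psi> x *\<^sub>R f x)"
    using K(3) by (intro ext) (auto split: split_indicator)
  ultimately show ?thesis by simp
qed

lemma L1_loc_test_integrable:
  fixes f :: "real^'n \<Rightarrow> 'b::euclidean_space"
  assumes f: "L1_loc S f" and \<psi>: "\<psi> \<in> test_functions S"
  shows "integrable lebesgue (\<lambda>x. \<psi> x *\<^sub>R f x)"
proof -
  obtain K where "compact K" "K \<subseteq> S" "\<And>x. x \<notin> K \<Longrightarrow> \<psi> x = 0"
    using test_functions_support[OF \<psi>] by metis
  then show ?thesis
    by (intro L1_loc_mult_integrable[OF f smooth_on_continuous[OF test_functions_smooth[OF \<psi>]]])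
qed

lemma L1_loc_grad_integrable:
  fixes u :: "real^'n \<Rightarrow> real"
  assumes u: "L1_loc S u" and \<phi>: "\<phi> \<in> test_functions S"
  shows "integrable lebesgue (\<lambda>x. u x *\<^sub>R grad \<phi> x)"
proof -
  have "integrable lebesgue (\<lambda>x. \<Sum>i\<in>UNIV. (grad \<phi> x $ i *\<^sub>R u x) *\<^sub>R axis i (1::real))"
    by (intro Bochner_Integration.integrable_sum integrable_scaleR_left L1_loc_test_integrable[OF u] test_functions_grad \<phi>)
  moreover have "(\<Sum>i\<in>UNIV. (grad \<phi> x $ i *\<^sub>R u x) *\<^sub>R axis i (1::real)) = u x *\<^sub>R grad \<phi> x" for x
    by (simp add: vec_eq_iff axis_def if_distrib sum.If_cases mult.commute cong: if_cong)
  ultimately show ?thesis by simp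
qed

lemma L1_loc_integrable:
  "S \<in> sets lebesgue \<Longrightarrow> integrable lebesgue f \<Longrightarrow> L1_loc S f"
  unfolding L1_loc_def by (auto intro: integrable_lebesgue_on sets_lebesgue_compact)

lemma L1_loc_component: "L1_loc S g \<Longrightarrow> L1_loc S (\<lambda>x. g x $ i)"
  unfolding L1_loc_def by (auto intro: integrable_bounded_linear[OF bounded_linear_vec_nth])

lemma L1_loc_diff: "L1_loc S f \<Longrightarrow> L1_loc S g \<Longrightarrow> L1_loc S (\<lambda>x. f x - g x)"
  and L1_loc_subset: "T \<subseteq> S \<Longrightarrow> L1_loc S f \<Longrightarrow> L1_loc T f"
  unfolding L1_loc_def by auto

lemma test_functions_zero: "\<phi> \<in> test_functions S \<Longrightarrow> x \<notin> S \<Longrightarrow> \<phi> x = 0 \<and> grad \<phi> x = 0"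
  using test_functions_support[of \<phi> S] by (metis subsetD)

text \<open>Scalar integrals over the whole space, one for each component, obey the linearity rules
  directly; the vector-valued identity of the definition is used only here and in the converse.\<close>
lemma has_weak_gradD:
  fixes u :: "real^'n \<Rightarrow> real"
  assumes u: "has_weak_grad S u g" and S: "open S" and \<phi>: "\<phi> \<in> test_functions S"
  shows "(LINT x|lebesgue. grad \<phi> x $ i * u x) = - (LINT x|lebesgue. \<phi> x * g x $ i)"
proof -
  note l1 = u[unfolded has_weak_grad_def, THEN conjunct1] u[unfolded has_weak_grad_def, THEN conjunct2, THEN conjunct1]
  note Sm = sets_lebesgue_open[OF S]
  have iu: "integrable lebesgue (\<lambda>x. u x *\<^sub>R grad \<phi> x)"
    by (rule L1_loc_grad_integrable[OF l1(1) \<phi>])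
  have ig: "integrable lebesgue (\<lambda>x. \<phi> x *\<^sub>R g x)" by (rule L1_loc_test_integrable[OF l1(2) \<phi>])
  have "(LINT x|lebesgue_on S. u x *\<^sub>R grad \<phi> x) = - (LINT x|lebesgue_on S. \<phi> x *\<^sub>R g x)"
    using u \<phi> by (simp add: has_weak_grad_def)
  then have "(LINT x|lebesgue. u x *\<^sub>R grad \<phi> x) $ i = - ((LINT x|lebesgue. \<phi> x *\<^sub>R g x) $ i)"
    using test_functions_zero[OF \<phi>] by (simp add: lebesgue_on_support(2)[OF Sm])
  then show ?thesis
    using integral_bounded_linear[OF bounded_linear_vec_nth iu, of i] integral_bounded_linear[OF bounded_linear_vec_nth ig, of i]
    by (simp add: mult.commute)
qed

lemma has_weak_gradI:
  fixes u :: "real^'n \<Rightarrow> real"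
  assumes u: "L1_loc S u" and g: "L1_loc S g" and S: "open S"
    and eq: "\<And>\<phi> i. \<phi> \<in> test_functions S \<Longrightarrow> (LINT x|lebesgue. grad \<phi> x $ i * u x) = - (LINT x|lebesgue. \<phi> x * g x $ i)"
  shows "has_weak_grad S u g"
  unfolding has_weak_grad_def
proof (intro conjI ballI u g)
  fix \<phi> :: "real^'n \<Rightarrow> real" assume \<phi>: "\<phi> \<in> test_functions S"
  note Sm = sets_lebesgue_open[OF S]
  have iu: "integrable lebesgue (\<lambda>x. u x *\<^sub>R grad \<phi> x)"
    by (rule L1_loc_grad_integrable[OF u \<phi>])
  have ig: "integrable lebesgue (\<lambda>x. \<phi> x *\<^sub>R g x)" by (rule L1_loc_test_integrable[OF g \<phi>])
  have "(LINT x|lebesgue. u x *\<^sub>R grad \<phi> x) $ i = (- (LINT x|lebesgue. \<phi> x *\<^sub>R g x)) $ i" for i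
    using integral_bounded_linear[OF bounded_linear_vec_nth iu, of i] integral_bounded_linear[OF bounded_linear_vec_nth ig, of i]
      eq[OF \<phi>, of i]
    by (simp add: mult.commute)
  then have "(LINT x|lebesgue. u x *\<^sub>R grad \<phi> x) = - (LINT x|lebesgue. \<phi> x *\<^sub>R g x)"
    by (simp add: vec_eq_iff)
  then show "(LINT x|lebesgue_on S. u x *\<^sub>R grad \<phi> x) = - (LINT x|lebesgue_on S. \<phi> x *\<^sub>R g x)"
    using test_functions_zero[OF \<phi>] by (simp add: lebesgue_on_support(2)[OF Sm])
qed

lemma has_weak_grad_L1:
  assumes "has_weak_grad S u g" shows "L1_loc S u" "L1_loc S g" "L1_loc S (\<lambda>x. g x $ i)"
  using assms L1_loc_component by (auto simp: has_weak_grad_def)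

lemma has_weak_grad_subset:
  assumes "has_weak_grad S u g" "open S" "open T" "T \<subseteq> S"
  shows "has_weak_grad T u g"
  using assms test_functions_mono[OF assms(4)]
  by (intro has_weak_gradI has_weak_gradD[OF assms(1,2)] L1_loc_subset[OF assms(4)] has_weak_grad_L1[OF assms(1)]) auto

lemma has_weak_grad_diff:
  assumes u: "has_weak_grad S u g" and v: "has_weak_grad S v h" and S: "open S"
  shows "has_weak_grad S (\<lambda>x. u x - v x) (\<lambda>x. g x - h x)"
proof (rule has_weak_gradI[OF _ _ S])
  note lu = has_weak_grad_L1[OF u] and lv = has_weak_grad_L1[OF v]
  show "L1_loc S (\<lambda>x. u x - v x)" "L1_loc S (\<lambda>x. g x - h x)" using lu lv by (auto intro: L1_loc_diff)
  fix \<phi> i assume \<phi>: "\<phi> \<in> test_functions S"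
  note t = L1_loc_test_integrable[OF _ test_functions_grad[OF \<phi>], where 'b=real, unfolded real_scaleR_def]
  note t' = L1_loc_test_integrable[OF _ \<phi>, where 'b=real, unfolded real_scaleR_def]
  show "(LINT x|lebesgue. grad \<phi> x $ i * (u x - v x)) = - (LINT x|lebesgue. \<phi> x * (g x - h x) $ i)"
    using has_weak_gradD[OF u S \<phi>, of i] has_weak_gradD[OF v S \<phi>, of i]
      t[OF lu(1), of i] t[OF lv(1), of i] t'[OF lu(3), of i] t'[OF lv(3), of i]
    by (simp add: right_diff_distrib)
qed

text \<open>For a test function \<open>\<phi>\<close> on the whole space, \<open>\<zeta> \<phi>\<close> is a test function on \<open>S\<close>; the classical
  product rule for it splits off the term with the gradient of \<open>\<zeta>\<close>.\<close>
lemma has_weak_grad_mult: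
  fixes v :: "real^'n \<Rightarrow> real"
  assumes v: "has_weak_grad S v G" and S: "open S" and \<zeta>: "\<zeta> \<in> test_functions S"
  shows "has_weak_grad UNIV (\<lambda>x. \<zeta> x * v x) (\<lambda>x. \<zeta> x *\<^sub>R G x + v x *\<^sub>R grad \<zeta> x)"
    and "integrable lebesgue (\<lambda>x. \<zeta> x * v x)" and "integrable lebesgue (\<lambda>x. \<zeta> x *\<^sub>R G x + v x *\<^sub>R grad \<zeta> x)"
proof -
  note lv = has_weak_grad_L1[OF v]
  show i1: "integrable lebesgue (\<lambda>x. \<zeta> x * v x)"
    using L1_loc_test_integrable[OF lv(1) \<zeta>] by simp
  show i2: "integrable lebesgue (\<lambda>x. \<zeta> x *\<^sub>R G x + v x *\<^sub>R grad \<zeta> x)"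
  proof (rule Bochner_Integration.integrable_add)
    show "integrable lebesgue (\<lambda>x. \<zeta> x *\<^sub>R G x)" by (rule L1_loc_test_integrable[OF lv(2) \<zeta>])
    show "integrable lebesgue (\<lambda>x. v x *\<^sub>R grad \<zeta> x)"
      by (rule L1_loc_grad_integrable[OF lv(1) \<zeta>])
  qed
  show "has_weak_grad UNIV (\<lambda>x. \<zeta> x * v x) (\<lambda>x. \<zeta> x *\<^sub>R G x + v x *\<^sub>R grad \<zeta> x)"
  proof (rule has_weak_gradI)
    show "L1_loc UNIV (\<lambda>x. \<zeta> x * v x)" "L1_loc UNIV (\<lambda>x. \<zeta> x *\<^sub>R G x + v x *\<^sub>R grad \<zeta> x)"
      using i1 i2 by (auto intro: L1_loc_integrable)
    fix \<phi> i assume \<phi>: "\<phi> \<in> test_functions (UNIV :: (real^'n) set)"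
    note s = test_functions_smooth[OF \<phi>]
    have p: "(\<lambda>x. \<zeta> x * \<phi> x) \<in> test_functions S" by (rule test_functions_mult[OF \<zeta> s])
    have gp: "grad (\<lambda>x. \<zeta> x * \<phi> x) x = \<zeta> x *\<^sub>R grad \<phi> x + \<phi> x *\<^sub>R grad \<zeta> x" for x
      by (rule grad_mult) (intro smooth_on_differentiable s test_functions_smooth[OF \<zeta>])+
    have j1: "integrable lebesgue (\<lambda>x. grad (\<lambda>x. \<zeta> x * \<phi> x) x $ i * v x)"
      using L1_loc_test_integrable[OF lv(1) test_functions_grad[OF p, of i]] by simp
    have j2: "integrable lebesgue (\<lambda>x. grad \<zeta> x $ i * \<phi> x * v x)"
      using L1_loc_test_integrable[OF lv(1) test_functions_mult[OF test_functions_grad[OF \<zeta>, of i] s]] by simp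
    have j3: "integrable lebesgue (\<lambda>x. \<zeta> x * \<phi> x * G x $ i)"
      using L1_loc_test_integrable[OF lv(3) p] by simp
    have "(LINT x|lebesgue. grad \<phi> x $ i * (\<zeta> x * v x))
        = (LINT x|lebesgue. grad (\<lambda>x. \<zeta> x * \<phi> x) x $ i * v x - grad \<zeta> x $ i * \<phi> x * v x)"
      unfolding gp by (simp add: algebra_simps)
    also have "\<dots> = (LINT x|lebesgue. grad (\<lambda>x. \<zeta> x * \<phi> x) x $ i * v x) - (LINT x|lebesgue. grad \<zeta> x $ i * \<phi> x * v x)"
      using j1 j2 by simp
    also have "\<dots> = - (LINT x|lebesgue. \<zeta> x * \<phi> x * G x $ i) - (LINT x|lebesgue. grad \<zeta> x $ i * \<phi> x * v x)"
      using has_weak_gradD[OF v S p, of i] by simp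
    also have "\<dots> = - (LINT x|lebesgue. \<zeta> x * \<phi> x * G x $ i + grad \<zeta> x $ i * \<phi> x * v x)"
      using j2 j3 by simp
    also have "\<dots> = - (LINT x|lebesgue. \<phi> x * (\<zeta> x *\<^sub>R G x + v x *\<^sub>R grad \<zeta> x) $ i)"
      by (simp add: algebra_simps)
    finally show "(LINT x|lebesgue. grad \<phi> x $ i * (\<zeta> x * v x))
        = - (LINT x|lebesgue. \<phi> x * (\<zeta> x *\<^sub>R G x + v x *\<^sub>R grad \<zeta> x) $ i)" .
  qed simp
qed

section \<open>The fundamental lemma of the calculus of variations\<close>

text \<open>The indicator of \<open>K\<close> is the pointwise limit of cutoffs \<open>\<zeta> m\<close> that live in neighbourhoods
  \<open>V m\<close> shrinking to \<open>K\<close>. All of them are supported in one compact set \<open>K0\<close>, on which \<open>f\<close> is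
  integrable.\<close>
lemma integral_compact_eq_0:
  fixes f :: "real^'n \<Rightarrow> real"
  assumes S: "open S" and f: "L1_loc S f" and z: "\<And>\<phi>. \<phi> \<in> test_functions S \<Longrightarrow> (LINT x|lebesgue. \<phi> x * f x) = 0"
    and K: "compact K" "K \<subseteq> S"
  shows "(LINT x|lebesgue. indicator K x * f x) = 0"
proof (cases "K = {}")
  case False
  obtain d where d: "d > 0" "(\<Union>y\<in>K. cball y d) \<subseteq> S"
    using compact_subset_open_imp_cball_epsilon_subset[OF K(1) S K(2)] by metis
  define K0 where "K0 = {y + z |y z. y \<in> K \<and> z \<in> cball 0 d}"
  have K0: "compact K0" unfolding K0_def using K by (intro compact_sums) auto
  have K0_eq: "K0 = (\<Union>y\<in>K. cball y d)"
  proof (intro set_eqI iffI)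
    fix x assume "x \<in> (\<Union>y\<in>K. cball y d)"
    then obtain y where "y \<in> K" "norm (x - y) \<le> d" by (auto simp: dist_norm norm_minus_commute)
    then show "x \<in> K0" unfolding K0_def by (intro CollectI exI[of _ y] exI[of _ "x - y"]) auto
  next
    fix x assume "x \<in> K0"
    then obtain y z where "x = y + z" "y \<in> K" "norm z \<le> d" by (auto simp: K0_def)
    then show "x \<in> (\<Union>y\<in>K. cball y d)" by (intro UN_I[of y]) (auto simp: dist_norm)
  qed
  define V where "V m = (\<Union>y\<in>K. ball y (d / real (Suc m)))" for m
  have dm: "d / real (Suc m) \<le> d" "d / real (Suc m) > 0" for m using d(1) by (auto simp: field_simps)
  have V: "open (V m)" "K \<subseteq> V m" "V m \<subseteq> K0" for m
    using dm[of m] unfolding V_def K0_eq by (auto simp: less_imp_le intro: order_trans[OF less_imp_le dm(1)])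
  have "\<forall>m. \<exists>\<zeta>. \<zeta> \<in> test_functions (V m) \<and> (\<forall>x. 0 \<le> \<zeta> x \<and> \<zeta> x \<le> 1) \<and> (\<forall>x\<in>K. \<zeta> x = 1)"
    using ex_cutoff[OF K(1) V(1,2)] by metis
  then obtain \<zeta> where \<zeta>: "\<And>m. \<zeta> m \<in> test_functions (V m)" "\<And>m x. 0 \<le> \<zeta> m x" "\<And>m x. \<zeta> m x \<le> 1"
    "\<And>m x. x \<in> K \<Longrightarrow> \<zeta> m x = 1"
    by metis
  have K0S: "K0 \<subseteq> S" using d(2) K0_eq by simp
  have \<zeta>S: "\<zeta> m \<in> test_functions S" for m
    using \<zeta>(1)[of m] test_functions_mono[of "V m" S] V(3)[of m] K0S by blast
  have w: "integrable lebesgue (\<lambda>x. indicator K0 x *\<^sub>R f x)"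
    using f K0 K0S integrable_restrict_space[of K0 lebesgue f] sets_lebesgue_compact[OF K0] by (simp add: L1_loc_def)
  then have w': "integrable lebesgue (\<lambda>x. \<bar>indicator K0 x * f x\<bar>)" by auto
  have wK: "integrable lebesgue (\<lambda>x. indicator K x *\<^sub>R f x)"
    using f K integrable_restrict_space[of K lebesgue f] sets_lebesgue_compact[OF K(1)] by (simp add: L1_loc_def)
  have "(\<lambda>m. LINT x|lebesgue. \<zeta> m x * f x) \<longlonglongrightarrow> (LINT x|lebesgue. indicator K x * f x)"
  proof (rule integral_dominated_convergence[OF _ _ w'])
    show "AE x in lebesgue. (\<lambda>m. \<zeta> m x * f x) \<longlonglongrightarrow> indicator K x * f x"
    proof (intro AE_I2 tendsto_intros)
      fix x :: "real^'n"
      show "(\<lambda>m. \<zeta> m x) \<longlonglongrightarrow> indicator K x"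
      proof (cases "x \<in> K")
        case True then show ?thesis using \<zeta>(4) by simp
      next
        case False
        define \<rho> where "\<rho> = infdist x K"
        have \<rho>: "\<rho> > 0" unfolding \<rho>_def
          using False K(1) \<open>K \<noteq> {}\<close> by (metis compact_imp_closed in_closed_iff_infdist_zero infdist_nonneg less_eq_real_def)
        have "(\<lambda>m. d / real (Suc m)) \<longlonglongrightarrow> 0" by (rule LIMSEQ_Suc[OF lim_const_over_n])
        then have "\<forall>\<^sub>F m in sequentially. d / real (Suc m) < \<rho>" using \<rho> by (rule order_tendstoD)
        then have "\<forall>\<^sub>F m in sequentially. \<zeta> m x = indicator K x"
        proof eventually_elim
          case (elim m)
          have "x \<notin> V m"
          proof
            assume "x \<in> V m"
            then obtain y where "y \<in> K" "dist y x < d / real (Suc m)" by (auto simp: V_def)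
            then show False using elim infdist_le[of y K x] by (simp add: \<rho>_def dist_commute)
          qed
          then show ?case using test_functions_zero[OF \<zeta>(1)] False by simp
        qed
        then show ?thesis by (rule tendsto_eventually)
      qed
    qed
    show "AE x in lebesgue. norm (\<zeta> m x * f x) \<le> \<bar>indicator K0 x * f x\<bar>" for m
    proof (rule AE_I2)
      fix x
      show "norm (\<zeta> m x * f x) \<le> \<bar>indicator K0 x * f x\<bar>"
      proof (cases "x \<in> K0")
        case True then show ?thesis using \<zeta>(2,3)[of m x] by (auto simp: abs_mult intro!: mult_left_le_one_le)
      next
        case False then have "\<zeta> m x = 0" using V(3)[of m] test_functions_zero[OF \<zeta>(1)[of m], of x] by blast
        then show ?thesis by simp
      qed
    qed
    show "(\<lambda>x. \<zeta> m x * f x) \<in> borel_measurable lebesgue" for m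
      using L1_loc_test_integrable[OF f \<zeta>S[of m]] by (simp add: borel_measurable_integrable)
    show "(\<lambda>x. indicator K x * f x) \<in> borel_measurable lebesgue"
      using borel_measurable_integrable[OF wK] by simp
  qed
  moreover have "(LINT x|lebesgue. \<zeta> m x * f x) = 0" for m by (rule z[OF \<zeta>S])
  ultimately show ?thesis by (simp add: LIMSEQ_const_iff)
qed simp

text \<open>The set of points of \<open>K\<close> where \<open>f\<close> is positive is a countable union of compact sets up to
  a null set, and on a compact set a positive function with integral zero forces measure zero.\<close>
lemma AE_le_0_of_test_functions:
  fixes f :: "real^'n \<Rightarrow> real"
  assumes S: "open S" and f: "L1_loc S f" and z: "\<And>\<phi>. \<phi> \<in> test_functions S \<Longrightarrow> (LINT x|lebesgue. \<phi> x * f x) = 0"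
    and K: "compact K" "K \<subseteq> S"
  shows "AE x in lebesgue. x \<in> K \<longrightarrow> f x \<le> 0"
proof -
  have i: "integrable lebesgue (\<lambda>x. indicator C x * f x)" if "compact C" "C \<subseteq> S" for C
    using f that integrable_restrict_space[of C lebesgue f] sets_lebesgue_compact[OF that(1)] by (simp add: L1_loc_def)
  define E where "E = {x \<in> space lebesgue. indicator K x * f x > 0}"
  have E: "E \<in> sets lebesgue"
    unfolding E_def using borel_measurable_integrable[OF i[OF K]] by measurable
  have EK: "x \<in> K \<and> f x > 0" if "x \<in> E" for x
    using that unfolding E_def by (cases "x \<in> K") auto
  obtain C T where C: "fsigma C" "T \<in> null_sets lebesgue" "C \<union> T = E"
    using lebesgue_set_almost_fsigma[OF E] by metis
  obtain F :: "nat \<Rightarrow> (real^'n) set" where F': "range F \<subseteq> Collect compact" "C = \<Union> (range F)"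
    using C(1) unfolding fsigma_Union_compact by auto
  then have F: "\<And>n. compact (F n)" "\<Union> (range F) = C" by auto
  have "F n \<in> null_sets lebesgue" for n
  proof -
    have FE: "F n \<subseteq> E" using F(2) C(3) by blast
    then have sub: "F n \<subseteq> S" using EK K(2) by blast
    have nonneg: "AE x in lebesgue. 0 \<le> indicator (F n) x * f x"
      using FE EK by (intro AE_I2) (auto simp: indicator_def less_imp_le)
    have "AE x in lebesgue. indicator (F n) x * f x = 0"
      using integral_nonneg_eq_0_iff_AE[OF i[OF F(1) sub] nonneg] integral_compact_eq_0[OF S f z F(1) sub] by simp
    then have "AE x in lebesgue. x \<notin> F n"
      by eventually_elim (use FE EK in \<open>force simp: indicator_def split: if_splits\<close>)
    then show ?thesis using AE_iff_null_sets[of "F n" lebesgue] sets_lebesgue_compact[OF F(1)] by simp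
  qed
  then have "C \<in> null_sets lebesgue" unfolding F(2)[symmetric] by (intro null_sets_UN) auto
  then have "E \<in> null_sets lebesgue" using C by (metis null_sets.Un)
  then have "AE x in lebesgue. x \<notin> E" by (rule AE_not_in)
  then show ?thesis by eventually_elim (auto simp: E_def not_less)
qed

lemma fundamental_lemma_of_variations:
  fixes f :: "real^'n \<Rightarrow> real"
  assumes S: "open S" and f: "L1_loc S f" and z: "\<And>\<phi>. \<phi> \<in> test_functions S \<Longrightarrow> (LINT x|lebesgue. \<phi> x * f x) = 0"
  shows "AE x in lebesgue. x \<in> S \<longrightarrow> f x = 0"
proof -
  obtain C where C: "\<And>n::nat. compact (C n)" "\<And>n. C n \<subseteq> S" "\<Union>(range C) = S"
    by (rule open_Union_compact_subsets[OF S]; rule that; assumption?)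
  have f': "L1_loc S (\<lambda>x. - f x)" using f by (simp add: L1_loc_def)
  have "AE x in lebesgue. x \<in> C n \<longrightarrow> f x = 0" for n
  proof -
    have "AE x in lebesgue. x \<in> C n \<longrightarrow> - f x \<le> 0"
      by (rule AE_le_0_of_test_functions[OF S f' _ C(1,2)]) (simp add: z)
    moreover have "AE x in lebesgue. x \<in> C n \<longrightarrow> f x \<le> 0"
      by (rule AE_le_0_of_test_functions[OF S f z C(1,2)])
    ultimately show ?thesis by eventually_elim auto
  qed
  then have "AE x in lebesgue. \<forall>n. x \<in> C n \<longrightarrow> f x = 0" unfolding AE_all_countable by simp
  then show ?thesis by eventually_elim (use C(3) in blast)
qed

text \<open>Properties of one weak gradient thereby pass to the gradient picked by \<open>weak_grad\<close>.\<close>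
lemma weak_grad_unique:
  assumes S: "open S" and g: "has_weak_grad S u g" and h: "has_weak_grad S u h"
  shows "AE x in lebesgue. x \<in> S \<longrightarrow> g x = h x"
proof -
  have "AE x in lebesgue. x \<in> S \<longrightarrow> g x $ i - h x $ i = 0" for i
  proof (rule fundamental_lemma_of_variations[OF S])
    note lg = has_weak_grad_L1(3)[OF g, of i] and lh = has_weak_grad_L1(3)[OF h, of i]
    show "L1_loc S (\<lambda>x. g x $ i - h x $ i)" by (rule L1_loc_diff[OF lg lh])
    fix \<phi> assume \<phi>: "\<phi> \<in> test_functions S"
    note t' = L1_loc_test_integrable[OF _ \<phi>, where 'b=real, unfolded real_scaleR_def]
    show "(LINT x|lebesgue. \<phi> x * (g x $ i - h x $ i)) = 0"
      using has_weak_gradD[OF g S \<phi>, of i] has_weak_gradD[OF h S \<phi>, of i] t'[OF lg] t'[OF lh]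
      by (simp add: right_diff_distrib)
  qed
  then have "AE x in lebesgue. \<forall>i. x \<in> S \<longrightarrow> g x $ i - h x $ i = 0" unfolding AE_all_countable by simp
  then show ?thesis by eventually_elim (auto simp: vec_eq_iff)
qed

section \<open>Approximation of weakly differentiable functions by test functions\<close>

text \<open>Tonelli's theorem is applied to Borel functions on a product of Borel measures, so
  Lebesgue measurable functions are first replaced by Borel ones, which vanish off the same set.\<close>
lemma ex_borel_version:
  fixes f :: "'a::euclidean_space \<Rightarrow> real"
  assumes f: "f \<in> borel_measurable lebesgue" and K: "K \<in> sets borel" "\<And>x. x \<notin> K \<Longrightarrow> f x = 0"
  obtains f' where "f' \<in> borel_measurable borel" "\<And>x. x \<notin> K \<Longrightarrow> f' x = 0" "AE x in lebesgue. f x = f' x"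
proof -
  obtain g where g: "g \<in> borel_measurable lborel" "AE x in lborel. f x = g x"
    using completion_ex_borel_measurable_real[OF f] by blast
  note [measurable] = K(1)
  show ?thesis
  proof (rule that[of "\<lambda>x. indicator K x * g x"])
    show "(\<lambda>x. indicator K x * g x) \<in> borel_measurable borel" using g(1) by simp
    show "AE x in lebesgue. f x = indicator K x * g x"
      using AE_completion[OF g(2)] by eventually_elim (use K(2) in \<open>auto split: split_indicator\<close>)
  qed auto
qed

lemma borel_version_integrable:
  fixes f f' :: "'a::euclidean_space \<Rightarrow> real"
  assumes "f' \<in> borel_measurable borel" "AE x in lebesgue. f x = f' x" "integrable lebesgue f"
  shows "integrable lborel f'"
proof -
  have "integrable lebesgue f'"
    using integrable_cong_AE_imp[OF assms(3), of f'] assms by (simp add: measurable_completion eq_commute)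
  then show ?thesis using assms(1) by (simp add: integrable_completion)
qed

lemma conv_borel_version:
  fixes f f' :: "real^'n \<Rightarrow> real"
  assumes \<eta>: "\<eta> \<in> test_functions UNIV" and f: "f' \<in> borel_measurable borel" "AE x in lebesgue. f x = f' x" "integrable lebesgue f"
  shows "conv \<eta> f' x = (LINT y|lebesgue. \<eta> (x - y) * f y)"
proof -
  note [measurable] = test_functions_borel[OF \<eta>] f(1)
  have [measurable]: "(\<lambda>y. \<eta> (x - y)) \<in> borel_measurable lebesgue" by (simp add: measurable_completion)
  have "conv \<eta> f' x = (LINT y|lebesgue. \<eta> (x - y) * f' y)"
    unfolding conv_def by (rule integral_completion[symmetric]) measurable
  also have "\<dots> = (LINT y|lebesgue. \<eta> (x - y) * f y)"
  proof (rule integral_cong_AE)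
    show "(\<lambda>y. \<eta> (x - y) * f' y) \<in> borel_measurable lebesgue" by (simp add: measurable_completion)
    show "(\<lambda>y. \<eta> (x - y) * f y) \<in> borel_measurable lebesgue" using f(3) by measurable
    show "AE y in lebesgue. \<eta> (x - y) * f' y = \<eta> (x - y) * f y"
      using f(2) by eventually_elim simp
  qed
  finally show ?thesis .
qed

lemma norm2_vec: "(norm (x::real^'n))\<^sup>2 = (\<Sum>i\<in>UNIV. (x $ i)\<^sup>2)"
  unfolding power2_norm_eq_inner inner_vec_def by (simp add: power2_eq_square)

text \<open>Mollify a Borel version of \<open>w\<close>. The reflected kernel is an admissible test function, so
  the gradient of the mollification is the mollification of \<open>H\<close>, and both converge in mean
  square. The scale \<open>\<epsilon>\<close> is also taken small enough to keep the support inside \<open>V\<close>.\<close>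
lemma weak_grad_approx:
  fixes w :: "real^'n \<Rightarrow> real"
  assumes wg: "has_weak_grad UNIV w H" and K: "compact K" "\<And>x. x \<notin> K \<Longrightarrow> w x = 0" "\<And>x. x \<notin> K \<Longrightarrow> H x = 0"
    and i2: "integrable lebesgue (\<lambda>x. (w x)\<^sup>2)" "integrable lebesgue (\<lambda>x. (norm (H x))\<^sup>2)"
    and V: "open V" "K \<subseteq> V" and e: "e > 0"
  obtains \<phi> where "\<phi> \<in> test_functions V" "sq_integral lebesgue (\<lambda>x. \<phi> x - w x) \<le> ennreal e"
    "sq_integral lebesgue (\<lambda>x. norm (grad \<phi> x - H x)) \<le> ennreal e"
proof -
  obtain R where R: "K \<subseteq> cball 0 R" using compact_imp_bounded[OF K(1)] unfolding bounded_iff by (auto simp: subset_eq)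
  note Km = sets_lebesgue_compact[OF K(1)]
  have Kb: "K \<in> sets borel" using K(1) by (rule borel_compact)
  have iw: "integrable lebesgue w" and iH: "integrable lebesgue H"
    using has_weak_grad_L1(1,2)[OF wg] K lebesgue_on_support(1)[OF Km, of w] lebesgue_on_support(1)[OF Km, of H]
    by (auto simp: L1_loc_def)
  have iHi: "integrable lebesgue (\<lambda>x. H x $ i)" for i
    using integrable_bounded_linear[OF bounded_linear_vec_nth iH] .
  have iHi2: "integrable lebesgue (\<lambda>x. (H x $ i)\<^sup>2)" for i
  proof (rule Bochner_Integration.integrable_bound[OF i2(2)])
    show "(\<lambda>x. (H x $ i)\<^sup>2) \<in> borel_measurable lebesgue" using borel_measurable_integrable[OF iHi[of i]] by measurable
    have "\<bar>H x $ i\<bar>\<^sup>2 \<le> (norm (H x))\<^sup>2" for x by (rule power_mono[OF component_le_norm_cart]) simp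
    then show "AE x in lebesgue. norm ((H x $ i)\<^sup>2) \<le> norm ((norm (H x))\<^sup>2)" by simp
  qed
  obtain w' where w': "w' \<in> borel_measurable borel" "\<And>x. x \<notin> K \<Longrightarrow> w' x = 0" "AE x in lebesgue. w x = w' x"
    using ex_borel_version[OF borel_measurable_integrable[OF iw] Kb K(2)] by blast
  have "\<forall>i. \<exists>h. h \<in> borel_measurable borel \<and> (\<forall>x. x \<notin> K \<longrightarrow> h x = 0) \<and> (AE x in lebesgue. H x $ i = h x)"
  proof
    fix i
    show "\<exists>h. h \<in> borel_measurable borel \<and> (\<forall>x. x \<notin> K \<longrightarrow> h x = 0) \<and> (AE x in lebesgue. H x $ i = h x)"
      by (rule ex_borel_version[OF borel_measurable_integrable[OF iHi[of i]] Kb]) (use K(3) in auto)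
  qed
  then obtain H' where H': "\<And>i. H' i \<in> borel_measurable borel" "\<And>i x. x \<notin> K \<Longrightarrow> H' i x = 0"
    "\<And>i. AE x in lebesgue. H x $ i = H' i x" by metis
  have iw': "integrable lborel w'" by (rule borel_version_integrable[OF w'(1,3) iw])
  have iH': "integrable lborel (H' i)" for i by (rule borel_version_integrable[OF H'(1,3) iHi])
  have iw2: "integrable lborel (\<lambda>x. (w' x)\<^sup>2)"
  proof (rule borel_version_integrable[OF _ _ i2(1)])
    show "(\<lambda>x. (w' x)\<^sup>2) \<in> borel_measurable borel" using w'(1) by measurable
    show "AE x in lebesgue. (w x)\<^sup>2 = (w' x)\<^sup>2" using w'(3) by eventually_elim simp
  qed
  have iH2: "integrable lborel (\<lambda>x. (H' i x)\<^sup>2)" for i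
  proof (rule borel_version_integrable[OF _ _ iHi2])
    show "(\<lambda>x. (H' i x)\<^sup>2) \<in> borel_measurable borel" using H'(1)[of i] by measurable
    show "AE x in lebesgue. (H x $ i)\<^sup>2 = (H' i x)\<^sup>2" using H'(3)[of i] by eventually_elim simp
  qed
  have out: "x \<notin> K" if "R < norm x" for x using R that by auto
  define e' where "e' = e / real CARD('n)"
  have e': "e' > 0" using e by (simp add: e'_def)
  obtain \<delta>0 where \<delta>0: "\<delta>0 > 0"
    "\<And>\<epsilon> \<eta>. \<epsilon> \<le> \<delta>0 \<Longrightarrow> mollifier \<epsilon> \<eta> \<Longrightarrow> sq_integral lborel (\<lambda>x. conv \<eta> w' x - w' x) \<le> ennreal e"
    using conv_tendsto_L2[OF iw' iw2 w'(2)[OF out] e] by blast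
  have "\<forall>i. \<exists>\<delta>>0. \<forall>\<epsilon> \<eta>. \<epsilon> \<le> \<delta> \<longrightarrow> mollifier \<epsilon> \<eta> \<longrightarrow> sq_integral lborel (\<lambda>x. conv \<eta> (H' i) x - H' i x) \<le> ennreal e'"
  proof
    fix i
    obtain d where "d > 0" "\<And>\<epsilon> \<eta>. \<epsilon> \<le> d \<Longrightarrow> mollifier \<epsilon> \<eta> \<Longrightarrow> sq_integral lborel (\<lambda>x. conv \<eta> (H' i) x - H' i x) \<le> ennreal e'"
      using conv_tendsto_L2[OF iH' iH2 H'(2)[OF out] e'] by blast
    then show "\<exists>\<delta>>0. \<forall>\<epsilon> \<eta>. \<epsilon> \<le> \<delta> \<longrightarrow> mollifier \<epsilon> \<eta> \<longrightarrow> sq_integral lborel (\<lambda>x. conv \<eta> (H' i) x - H' i x) \<le> ennreal e'"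
      by blast
  qed
  then obtain \<delta> where \<delta>: "\<And>i. \<delta> i > 0"
    "\<And>i \<epsilon> \<eta>. \<epsilon> \<le> \<delta> i \<Longrightarrow> mollifier \<epsilon> \<eta> \<Longrightarrow> sq_integral lborel (\<lambda>x. conv \<eta> (H' i) x - H' i x) \<le> ennreal e'"
    by metis
  obtain d where d: "d > 0" "{y + z |y z. y \<in> K \<and> z \<in> cball 0 d} \<subseteq> V"
    using compact_thickening_subset[OF K(1) V] by blast
  define \<epsilon> where "\<epsilon> = Min (insert d (insert \<delta>0 (range \<delta>)))"
  have \<epsilon>: "\<epsilon> > 0" "\<epsilon> \<le> d" "\<epsilon> \<le> \<delta>0" "\<And>i. \<epsilon> \<le> \<delta> i"
  proof -
    show "\<epsilon> > 0" using d(1) \<delta>0(1) \<delta>(1) by (auto simp: \<epsilon>_def)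
    show "\<epsilon> \<le> d" "\<epsilon> \<le> \<delta>0" "\<And>i. \<epsilon> \<le> \<delta> i" unfolding \<epsilon>_def by (rule Min_le; simp)+
  qed
  obtain \<eta> :: "real^'n \<Rightarrow> real" where \<eta>: "mollifier \<epsilon> \<eta>" using ex_mollifier[OF \<epsilon>(1)] .
  then have T: "\<eta> \<in> test_functions UNIV" by (simp add: mollifier_def)
  have grad_eq: "grad (conv \<eta> w') x $ i = conv \<eta> (H' i) x" for x i
  proof -
    have "grad (conv \<eta> w') x $ i = conv (\<lambda>x. grad \<eta> x $ i) w' x"
      by (simp add: grad_conv[OF T iw'])
    also have "\<dots> = (LINT y|lebesgue. grad \<eta> (x - y) $ i * w y)"
      by (rule conv_borel_version[OF test_functions_grad[OF T] w'(1,3) iw])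
    also have "\<dots> = - (LINT y|lebesgue. grad (\<lambda>y. \<eta> (x - y)) y $ i * w y)"
      by (simp add: test_functions_reflect(2)[OF T])
    also have "\<dots> = (LINT y|lebesgue. \<eta> (x - y) * H y $ i)"
      using has_weak_gradD[OF wg open_UNIV test_functions_reflect(1)[OF T, of x], of i] by simp
    also have "\<dots> = conv \<eta> (H' i) x"
      by (rule conv_borel_version[OF T H'(1,3) iHi, symmetric])
    finally show ?thesis .
  qed
  show ?thesis
  proof (rule that)
    have "{y + z |y z. y \<in> K \<and> z \<in> cball 0 \<epsilon>} \<subseteq> {y + z |y z. y \<in> K \<and> z \<in> cball 0 d}" using \<epsilon>(2) by force
    then show "conv \<eta> w' \<in> test_functions V"
      by (intro conv_test_function[OF \<eta> iw' K(1) w'(2)] order_trans[OF _ d(2)])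
    have "sq_integral lebesgue (\<lambda>x. conv \<eta> w' x - w x) = sq_integral lebesgue (\<lambda>x. conv \<eta> w' x - w' x)"
      by (rule nn_integral_cong_AE) (use w'(3) in \<open>eventually_elim, simp\<close>)
    also have "\<dots> \<le> ennreal e"
      using \<delta>0(2)[OF \<epsilon>(3) \<eta>] by (simp add: nn_integral_completion)
    finally show "sq_integral lebesgue (\<lambda>x. conv \<eta> w' x - w x) \<le> ennreal e" .
    note [measurable] = H'(1)
    have [measurable]: "conv \<eta> (H' i) \<in> borel_measurable borel" for i
      by (intro borel_measurable_continuous_onI smooth_on_continuous smooth_on_conv T iH')
    have AEH: "AE x in lebesgue. \<forall>i. H x $ i = H' i x" unfolding AE_all_countable using H'(3) by simp
    have "sq_integral lebesgue (\<lambda>x. norm (grad (conv \<eta> w') x - H x))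
        = (\<integral>\<^sup>+x. (\<Sum>i\<in>UNIV. ennreal ((conv \<eta> (H' i) x - H' i x)\<^sup>2)) \<partial>lebesgue)"
      by (rule nn_integral_cong_AE) (use AEH in \<open>eventually_elim, simp add: norm2_vec grad_eq\<close>)
    also have "\<dots> = (\<integral>\<^sup>+x. (\<Sum>i\<in>UNIV. ennreal ((conv \<eta> (H' i) x - H' i x)\<^sup>2)) \<partial>lborel)"
      by (rule nn_integral_completion)
    also have "\<dots> = (\<Sum>i\<in>UNIV. \<integral>\<^sup>+x. ennreal ((conv \<eta> (H' i) x - H' i x)\<^sup>2) \<partial>lborel)"
      by (rule nn_integral_sum) measurable
    also have "\<dots> \<le> (\<Sum>i\<in>(UNIV::'n set). ennreal e')"
      by (rule sum_mono) (rule \<delta>(2)[OF \<epsilon>(4) \<eta>])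
    also have "\<dots> = ennreal e"
      using e by (simp add: e'_def ennreal_of_nat_eq_real_of_nat ennreal_mult'[symmetric])
    finally show "sq_integral lebesgue (\<lambda>x. norm (grad (conv \<eta> w') x - H x)) \<le> ennreal e" .
  qed
qed

section \<open>The Caccioppoli inequality\<close>

lemma ennreal_power2_le_imp_le:
  assumes "x\<^sup>2 \<le> (ennreal c)\<^sup>2" "0 \<le> c"
  shows "x \<le> ennreal c"
proof (cases x)
  case (real r)
  then have "r\<^sup>2 \<le> c\<^sup>2" using assms by (simp add: ennreal_power ennreal_le_iff)
  then show ?thesis using real assms(2) by (auto intro: ennreal_leI power2_le_imp_le)
next
  case top
  then show ?thesis using assms by (simp add: power2_eq_square ennreal_mult[symmetric] top_unique)
qed

lemma L2_inner_bound:
  fixes f g :: "'a \<Rightarrow> 'b::euclidean_space"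
  assumes [measurable]: "f \<in> borel_measurable M" "g \<in> borel_measurable M"
    and a: "sq_integral M (\<lambda>x. norm (f x)) \<le> ennreal a" and b: "sq_integral M (\<lambda>x. norm (g x)) \<le> ennreal b"
    and nonneg: "0 \<le> a" "0 \<le> b"
  shows "integrable M (\<lambda>x. f x \<bullet> g x)" "\<bar>\<integral>x. f x \<bullet> g x \<partial>M\<bar> \<le> sqrt (a * b)"
proof -
  have "(\<integral>\<^sup>+x. ennreal (norm (f x \<bullet> g x)) \<partial>M)\<^sup>2 \<le> (\<integral>\<^sup>+x. ennreal (norm (f x)) * ennreal (norm (g x)) \<partial>M)\<^sup>2"
    by (intro power_mono nn_integral_mono)
      (auto simp: ennreal_mult'[symmetric] Cauchy_Schwarz_ineq2 intro!: ennreal_leI)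
  also have "\<dots> \<le> (\<integral>\<^sup>+x. (ennreal (norm (f x)))\<^sup>2 \<partial>M) * (\<integral>\<^sup>+x. (ennreal (norm (g x)))\<^sup>2 \<partial>M)"
    by (rule Cauchy_Schwarz_nn_integral) measurable
  also have "\<dots> \<le> ennreal a * ennreal b"
    using a b by (intro mult_mono) (auto simp: ennreal_power)
  also have "\<dots> = (ennreal (sqrt (a * b)))\<^sup>2" using nonneg by (simp add: ennreal_mult ennreal_power)
  finally have le: "(\<integral>\<^sup>+x. ennreal (norm (f x \<bullet> g x)) \<partial>M) \<le> ennreal (sqrt (a * b))"
    by (rule ennreal_power2_le_imp_le) (use nonneg in simp)
  show i: "integrable M (\<lambda>x. f x \<bullet> g x)"
    by (rule integrableI_bounded) (use le in \<open>auto intro: le_less_trans\<close>)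
  have "ennreal \<bar>\<integral>x. f x \<bullet> g x \<partial>M\<bar> \<le> (\<integral>\<^sup>+x. ennreal (norm (f x \<bullet> g x)) \<partial>M)"
    using integral_norm_bound_ennreal[OF i] by simp
  also note le
  finally show "\<bar>\<integral>x. f x \<bullet> g x \<partial>M\<bar> \<le> sqrt (a * b)"
    using nonneg by (simp add: ennreal_le_iff)
qed

text \<open>This allows solutions themselves, multiplied with cutoffs, as test functions \<open>w\<close> in their
  own equation. Smooth approximations of \<open>w\<close> can be taken in one neighbourhood of \<open>K\<close> with
  compact closure, where \<open>F\<close> is square integrable, so the Cauchy-Schwarz inequality passes to
  the limit.\<close>
lemma weak_div_zero_weakly_differentiable:
  fixes F :: "real^'n \<Rightarrow> real^'n"
  assumes F: "weak_div_zero S F" "L2_loc S F" and S: "open S"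
    and wg: "has_weak_grad UNIV w H" and K: "compact K" "K \<subseteq> S" "\<And>x. x \<notin> K \<Longrightarrow> w x = 0" "\<And>x. x \<notin> K \<Longrightarrow> H x = 0"
    and i2: "integrable lebesgue (\<lambda>x. (w x)\<^sup>2)" "integrable lebesgue (\<lambda>x. (norm (H x))\<^sup>2)"
  shows "integrable lebesgue (\<lambda>x. F x \<bullet> H x)" "(LINT x|lebesgue. F x \<bullet> H x) = 0"
proof -
  obtain \<zeta> where \<zeta>: "\<zeta> \<in> test_functions S" "\<And>x. x \<in> K \<Longrightarrow> \<zeta> x = 1"
    using ex_cutoff[OF K(1) S K(2)] by metis
  obtain K1 where K1: "compact K1" "K1 \<subseteq> S" "\<And>x. x \<notin> K1 \<Longrightarrow> \<zeta> x = 0"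
    using test_functions_support[OF \<zeta>(1)] by metis
  define V where "V = {x. 1/2 < \<zeta> x}"
  have V: "open V" "K \<subseteq> V" "V \<subseteq> K1"
    unfolding V_def using \<zeta>(2) K1(3) smooth_on_continuous[OF test_functions_smooth[OF \<zeta>(1)]]
    by (auto intro!: open_Collect_less continuous_intros) force
  define F1 where "F1 x = indicator K1 x *\<^sub>R F x" for x
  have K1m: "K1 \<inter> space lebesgue \<in> sets lebesgue" using sets_lebesgue_compact[OF K1(1)] by simp
  have L2F: "L2 K1 F" using F(2) K1 by (simp add: L2_loc_def)
  have F1m [measurable]: "F1 \<in> borel_measurable lebesgue"
    unfolding F1_def using L2F borel_measurable_restrict_space_iff[OF K1m, of F] by (simp add: L2_def)
  have i: "integrable lebesgue (\<lambda>x. (norm (F1 x))\<^sup>2)"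
  proof -
    have "integrable lebesgue (\<lambda>x. indicator K1 x *\<^sub>R (norm (F x))\<^sup>2)"
      using L2F integrable_restrict_space[OF K1m, of "\<lambda>x. (norm (F x))\<^sup>2"] by (simp add: L2_def)
    moreover have "(\<lambda>x. indicator K1 x *\<^sub>R (norm (F x))\<^sup>2) = (\<lambda>x. (norm (F1 x))\<^sup>2)"
      by (auto simp: F1_def split: split_indicator)
    ultimately show ?thesis by simp
  qed
  define a where "a = (LINT x|lebesgue. (norm (F1 x))\<^sup>2)"
  have a: "a \<ge> 0" "sq_integral lebesgue (\<lambda>x. norm (F1 x)) \<le> ennreal a"
    unfolding a_def using nn_integral_eq_integral[OF i] by auto
  have Hm [measurable]: "H \<in> borel_measurable lebesgue"
    using has_weak_grad_L1(2)[OF wg] K lebesgue_on_support(1)[OF sets_lebesgue_compact[OF K(1)], of H]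
    by (auto simp: L1_loc_def)
  have FH: "F x \<bullet> H x = F1 x \<bullet> H x" for x
    using K(4)[of x] V by (cases "x \<in> K") (auto simp: F1_def split: split_indicator)
  have "sq_integral lebesgue (\<lambda>x. norm (H x)) \<le> ennreal (LINT x|lebesgue. (norm (H x))\<^sup>2)"
    using nn_integral_eq_integral[OF i2(2)] by auto
  from L2_inner_bound(1)[OF F1m Hm a(2) this a(1)]
  have iFH: "integrable lebesgue (\<lambda>x. F1 x \<bullet> H x)" by simp
  then show "integrable lebesgue (\<lambda>x. F x \<bullet> H x)" by (simp add: FH)
  let ?I = "LINT x|lebesgue. F1 x \<bullet> H x"
  have bd: "\<bar>?I\<bar> \<le> sqrt (a * e)" if e: "e > 0" for e
  proof -
    obtain \<phi> where \<phi>: "\<phi> \<in> test_functions V" "sq_integral lebesgue (\<lambda>x. norm (grad \<phi> x - H x)) \<le> ennreal e"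
      using weak_grad_approx[OF wg K(1,3,4) i2 V(1,2) e] by blast
    have VS: "V \<subseteq> S" using V(3) K1(2) by blast
    then have \<phi>S: "\<phi> \<in> test_functions S" using \<phi>(1) test_functions_mono by blast
    have gm [measurable]: "grad \<phi> \<in> borel_measurable lebesgue"
      by (intro continuous_borel_lebesgue smooth_on_continuous_grad test_functions_smooth[OF \<phi>(1)])
    have "F x \<bullet> grad \<phi> x = F1 x \<bullet> grad \<phi> x" for x
      using test_functions_zero[OF \<phi>(1), of x] V(3) by (cases "x \<in> V") (auto simp: F1_def split: split_indicator)
    moreover have "(LINT x|lebesgue_on S. F x \<bullet> grad \<phi> x) = 0" using F(1) \<phi>S by (simp add: weak_div_zero_def)
    ultimately have 0: "(LINT x|lebesgue. F1 x \<bullet> grad \<phi> x) = 0"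
      using test_functions_zero[OF \<phi>S] lebesgue_on_support(2)[OF sets_lebesgue_open[OF S], of "\<lambda>x. F x \<bullet> grad \<phi> x"]
      by simp
    have dm: "(\<lambda>x. grad \<phi> x - H x) \<in> borel_measurable lebesgue" by measurable
    note cs = L2_inner_bound[OF F1m dm a(2) \<phi>(2) a(1) less_imp_le[OF e]]
    have "(LINT x|lebesgue. F1 x \<bullet> (grad \<phi> x - H x)) = (LINT x|lebesgue. F1 x \<bullet> grad \<phi> x) - ?I"
    proof -
      have "integrable lebesgue (\<lambda>x. F1 x \<bullet> (grad \<phi> x - H x) + F1 x \<bullet> H x)"
        using cs(1) iFH by (rule Bochner_Integration.integrable_add)
      then have "integrable lebesgue (\<lambda>x. F1 x \<bullet> grad \<phi> x)" by (simp add: inner_diff_right)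
      then show ?thesis using iFH by (simp add: inner_diff_right)
    qed
    with cs(2) 0 show ?thesis by simp
  qed
  have "?I = 0"
  proof (rule ccontr)
    assume I: "?I \<noteq> 0"
    define e where "e = ?I\<^sup>2 / (4 * (a + 1))"
    have e: "e > 0" unfolding e_def using I a(1) by (intro divide_pos_pos) auto
    have "a * e = (a / (a + 1)) * (?I\<^sup>2 / 4)" using a(1) by (simp add: e_def field_simps)
    also have "\<dots> \<le> 1 * (?I\<^sup>2 / 4)" using a(1) by (intro mult_right_mono) auto
    finally have "sqrt (a * e) \<le> sqrt ((\<bar>?I\<bar> / 2)\<^sup>2)" by (simp add: power_divide)
    then have "\<bar>?I\<bar> \<le> \<bar>?I\<bar> / 2" using bd[OF e] by simp
    with I show False by simp
  qed
  then show "(LINT x|lebesgue. F x \<bullet> H x) = 0" by (simp add: FH)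
qed

lemma L2_loc_power2: "L2_loc S f \<Longrightarrow> L1_loc S (\<lambda>x. (norm (f x))\<^sup>2)"
  by (simp add: L2_loc_def L1_loc_def L2_def)

lemma norm_grad_power2_integrable:
  fixes \<zeta> :: "real^'n \<Rightarrow> real"
  assumes \<zeta>: "\<zeta> \<in> test_functions S" and v: "L2_loc S v"
  shows "integrable lebesgue (\<lambda>x. (norm (grad \<zeta> x))\<^sup>2 * (norm (v x))\<^sup>2)"
proof -
  obtain K where K: "compact K" "K \<subseteq> S" "\<And>x. x \<notin> K \<Longrightarrow> grad \<zeta> x = 0"
    using test_functions_support[OF \<zeta>] by metis
  have "continuous_on UNIV (\<lambda>x. (norm (grad \<zeta> x))\<^sup>2)"
    by (intro continuous_intros smooth_on_continuous_grad test_functions_smooth[OF \<zeta>])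
  from L1_loc_mult_integrable[OF L2_loc_power2[OF v] this K(1,2)] K(3) show ?thesis by simp
qed

lemma test_power2_integrable:
  fixes \<zeta> :: "real^'n \<Rightarrow> real"
  assumes \<zeta>: "\<zeta> \<in> test_functions S" and v: "L2_loc S v"
  shows "integrable lebesgue (\<lambda>x. (\<zeta> x)\<^sup>2 * (norm (v x))\<^sup>2)"
  using L1_loc_test_integrable[OF L2_loc_power2[OF v] test_functions_mult[OF \<zeta> test_functions_smooth[OF \<zeta>]]]
  by (simp add: power2_eq_square mult.assoc)

lemma norm_add_power2_le: "(norm (x + y))\<^sup>2 \<le> 2 * (norm x)\<^sup>2 + 2 * (norm (y::'a::real_inner))\<^sup>2"
proof -
  have "(norm (x + y))\<^sup>2 + (norm (x - y))\<^sup>2 = 2 * (norm x)\<^sup>2 + 2 * (norm y)\<^sup>2"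
    by (simp add: power2_norm_eq_inner inner_add_left inner_add_right inner_diff_left inner_diff_right inner_commute)
  then show ?thesis using zero_le_power2[of "norm (x - y)"] by linarith
qed

lemma cutoff_mult_L2:
  fixes v :: "real^'n \<Rightarrow> real"
  assumes v: "has_weak_grad S v G" "L2_loc S v" "L2_loc S G" and S: "open S" and \<zeta>: "\<zeta> \<in> test_functions S"
  shows "integrable lebesgue (\<lambda>x. (\<zeta> x * v x)\<^sup>2)"
    "integrable lebesgue (\<lambda>x. (norm (\<zeta> x *\<^sub>R G x + v x *\<^sub>R grad \<zeta> x))\<^sup>2)"
    "(LINT x|lebesgue. (norm (\<zeta> x *\<^sub>R G x + v x *\<^sub>R grad \<zeta> x))\<^sup>2)
      \<le> 2 * (LINT x|lebesgue. (\<zeta> x)\<^sup>2 * (norm (G x))\<^sup>2) + 2 * (LINT x|lebesgue. (norm (grad \<zeta> x))\<^sup>2 * (v x)\<^sup>2)"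
proof -
  show "integrable lebesgue (\<lambda>x. (\<zeta> x * v x)\<^sup>2)"
    using test_power2_integrable[OF \<zeta> v(2)] by (simp add: power_mult_distrib)
  have i1: "integrable lebesgue (\<lambda>x. (\<zeta> x)\<^sup>2 * (norm (G x))\<^sup>2)" by (rule test_power2_integrable[OF \<zeta> v(3)])
  have i2: "integrable lebesgue (\<lambda>x. (norm (grad \<zeta> x))\<^sup>2 * (v x)\<^sup>2)"
    using norm_grad_power2_integrable[OF \<zeta> v(2)] by simp
  have i: "integrable lebesgue (\<lambda>x. 2 * ((\<zeta> x)\<^sup>2 * (norm (G x))\<^sup>2) + 2 * ((norm (grad \<zeta> x))\<^sup>2 * (v x)\<^sup>2))"
    using i1 i2 by simp
  have le: "(norm (\<zeta> x *\<^sub>R G x + v x *\<^sub>R grad \<zeta> x))\<^sup>2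
      \<le> 2 * ((\<zeta> x)\<^sup>2 * (norm (G x))\<^sup>2) + 2 * ((norm (grad \<zeta> x))\<^sup>2 * (v x)\<^sup>2)" for x
    using norm_add_power2_le[of "\<zeta> x *\<^sub>R G x" "v x *\<^sub>R grad \<zeta> x"]
    by (simp add: power_mult_distrib mult.commute)
  note [measurable] = borel_measurable_integrable[OF has_weak_grad_mult(3)[OF v(1) S \<zeta>]]
  show j: "integrable lebesgue (\<lambda>x. (norm (\<zeta> x *\<^sub>R G x + v x *\<^sub>R grad \<zeta> x))\<^sup>2)"
    by (rule Bochner_Integration.integrable_bound[OF i]) (use le in \<open>auto intro!: AE_I2 order_trans[OF le]\<close>)
  have "(LINT x|lebesgue. (norm (\<zeta> x *\<^sub>R G x + v x *\<^sub>R grad \<zeta> x))\<^sup>2)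
      \<le> (LINT x|lebesgue. 2 * ((\<zeta> x)\<^sup>2 * (norm (G x))\<^sup>2) + 2 * ((norm (grad \<zeta> x))\<^sup>2 * (v x)\<^sup>2))"
    by (rule Bochner_Integration.integral_mono[OF j i le])
  then show "(LINT x|lebesgue. (norm (\<zeta> x *\<^sub>R G x + v x *\<^sub>R grad \<zeta> x))\<^sup>2)
      \<le> 2 * (LINT x|lebesgue. (\<zeta> x)\<^sup>2 * (norm (G x))\<^sup>2) + 2 * (LINT x|lebesgue. (norm (grad \<zeta> x))\<^sup>2 * (v x)\<^sup>2)"
    using i1 i2 by simp
qed

text \<open>Test the equation with \<open>\<zeta>\<^sup>2 v\<close>. Ellipticity bounds \<open>lam \<zeta>\<^sup>2 |G|\<^sup>2\<close> by \<open>\<zeta>\<^sup>2 F \<bullet> G\<close>, the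
  equation turns this into \<open>- 2 \<zeta> v F \<bullet> grad \<zeta>\<close>, and Young's inequality absorbs half of the left
  side. Only the size of the field \<open>F\<close> and its pairing with \<open>G\<close> enter, so the inequality is
  stated for \<open>F\<close> instead of a coefficient matrix.\<close>
theorem Caccioppoli_inequality:
  fixes v :: "real^'n \<Rightarrow> real"
  assumes S: "open S" and v: "has_weak_grad S v G" "L2_loc S v" "L2_loc S G"
    and F: "weak_div_zero S F" "L2_loc S F"
    and lam: "0 < lam" "0 \<le> Lam"
    and ell: "AE x in lebesgue. x \<in> S \<longrightarrow> lam * (norm (G x))\<^sup>2 \<le> F x \<bullet> G x \<and> norm (F x) \<le> Lam * norm (G x)"
    and \<zeta>: "\<zeta> \<in> test_functions S"
  shows "(LINT x|lebesgue. (\<zeta> x)\<^sup>2 * (norm (G x))\<^sup>2) \<le> 4 * Lam\<^sup>2 / lam\<^sup>2 * (LINT x|lebesgue. (norm (grad \<zeta> x))\<^sup>2 * (v x)\<^sup>2)"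
proof -
  note s = test_functions_smooth[OF \<zeta>]
  define \<theta> where "\<theta> x = \<zeta> x * \<zeta> x" for x
  have \<theta>: "\<theta> \<in> test_functions S" unfolding \<theta>_def[abs_def] by (rule test_functions_mult[OF \<zeta> s])
  have g\<theta>: "grad \<theta> x = (2 * \<zeta> x) *\<^sub>R grad \<zeta> x" for x
    unfolding \<theta>_def[abs_def] by (subst grad_mult) (auto intro: smooth_on_differentiable[OF s] simp: scaleR_add_left[symmetric])
  obtain K where K: "compact K" "K \<subseteq> S" "\<And>x. x \<notin> K \<Longrightarrow> \<theta> x = 0" "\<And>x. x \<notin> K \<Longrightarrow> grad \<theta> x = 0"
    using test_functions_support[OF \<theta>] by metis
  let ?w = "\<lambda>x. \<theta> x * v x" and ?H = "\<lambda>x. \<theta> x *\<^sub>R G x + v x *\<^sub>R grad \<theta> x"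
  have wz: "\<theta> x * v x = 0" and Hz: "\<theta> x *\<^sub>R G x + v x *\<^sub>R grad \<theta> x = 0" if "x \<notin> K" for x
    using K(3,4) that by auto
  note T = weak_div_zero_weakly_differentiable[OF F S has_weak_grad_mult(1)[OF v(1) S \<theta>] K(1,2) wz Hz
      cutoff_mult_L2(1,2)[OF v S \<theta>]]
  have i1: "integrable lebesgue (\<lambda>x. (\<zeta> x)\<^sup>2 * (norm (G x))\<^sup>2)" by (rule test_power2_integrable[OF \<zeta> v(3)])
  have i2: "integrable lebesgue (\<lambda>x. (norm (grad \<zeta> x))\<^sup>2 * (v x)\<^sup>2)"
    using norm_grad_power2_integrable[OF \<zeta> v(2)] by simp
  have "(LINT x|lebesgue. lam / 2 * ((\<zeta> x)\<^sup>2 * (norm (G x))\<^sup>2) - 2 * Lam\<^sup>2 / lam * ((norm (grad \<zeta> x))\<^sup>2 * (v x)\<^sup>2))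
      \<le> (LINT x|lebesgue. F x \<bullet> ?H x)"
  proof (rule integral_mono_AE)
    show "integrable lebesgue (\<lambda>x. F x \<bullet> ?H x)" by (rule T(1))
    show "integrable lebesgue (\<lambda>x. lam / 2 * ((\<zeta> x)\<^sup>2 * (norm (G x))\<^sup>2) - 2 * Lam\<^sup>2 / lam * ((norm (grad \<zeta> x))\<^sup>2 * (v x)\<^sup>2))"
      using i1 i2 by simp
    show "AE x in lebesgue. lam / 2 * ((\<zeta> x)\<^sup>2 * (norm (G x))\<^sup>2) - 2 * Lam\<^sup>2 / lam * ((norm (grad \<zeta> x))\<^sup>2 * (v x)\<^sup>2)
        \<le> F x \<bullet> ?H x"
      using ell
    proof eventually_elim
      case (elim x)
      show ?case
      proof (cases "x \<in> S")
        case False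
        then show ?thesis using test_functions_zero[OF \<zeta>] test_functions_zero[OF \<theta>] by simp
      next
        case True
        then have e: "lam * (norm (G x))\<^sup>2 \<le> F x \<bullet> G x" "norm (F x) \<le> Lam * norm (G x)" using elim by auto
        define p q where "p = \<bar>\<zeta> x\<bar> * norm (G x)" and "q = \<bar>v x\<bar> * norm (grad \<zeta> x)"
        have H: "F x \<bullet> ?H x = (\<zeta> x)\<^sup>2 * (F x \<bullet> G x) + 2 * \<zeta> x * v x * (F x \<bullet> grad \<zeta> x)"
          by (simp add: g\<theta> \<theta>_def inner_add_right power2_eq_square)
        have "lam * p\<^sup>2 = (\<zeta> x)\<^sup>2 * (lam * (norm (G x))\<^sup>2)" by (simp add: p_def power_mult_distrib)
        also have "\<dots> \<le> (\<zeta> x)\<^sup>2 * (F x \<bullet> G x)" by (rule mult_left_mono[OF e(1)]) simp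
        finally have 1: "lam * p\<^sup>2 \<le> (\<zeta> x)\<^sup>2 * (F x \<bullet> G x)" .
        have "\<bar>2 * \<zeta> x * v x * (F x \<bullet> grad \<zeta> x)\<bar> = 2 * (\<bar>\<zeta> x\<bar> * \<bar>v x\<bar>) * \<bar>F x \<bullet> grad \<zeta> x\<bar>"
          by (simp add: abs_mult)
        also have "\<dots> \<le> 2 * (\<bar>\<zeta> x\<bar> * \<bar>v x\<bar>) * (norm (F x) * norm (grad \<zeta> x))"
          by (intro mult_left_mono Cauchy_Schwarz_ineq2) simp
        also have "\<dots> \<le> 2 * (\<bar>\<zeta> x\<bar> * \<bar>v x\<bar>) * ((Lam * norm (G x)) * norm (grad \<zeta> x))"
          by (intro mult_left_mono mult_right_mono e(2)) simp_all
        also have "\<dots> = 2 * Lam * (p * q)" by (simp add: p_def q_def)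
        finally have 2: "- (2 * \<zeta> x * v x * (F x \<bullet> grad \<zeta> x)) \<le> 2 * Lam * (p * q)" by linarith
        \<comment> \<open>Young's inequality with the weight that leaves exactly half of the elliptic term.\<close>
        have "0 \<le> (lam * p - 2 * Lam * q)\<^sup>2 / (2 * lam)" using lam by simp
        also have "\<dots> = lam / 2 * p\<^sup>2 - 2 * Lam * (p * q) + 2 * Lam\<^sup>2 / lam * q\<^sup>2"
          using lam(1) by (simp add: power2_eq_square field_simps)
        finally have 3: "2 * Lam * (p * q) \<le> lam / 2 * p\<^sup>2 + 2 * Lam\<^sup>2 / lam * q\<^sup>2" by linarith
        have p2: "p\<^sup>2 = (\<zeta> x)\<^sup>2 * (norm (G x))\<^sup>2" and q2: "q\<^sup>2 = (norm (grad \<zeta> x))\<^sup>2 * (v x)\<^sup>2"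
          by (simp_all add: p_def q_def power_mult_distrib)
        show ?thesis unfolding H p2[symmetric] q2[symmetric] using 1 2 3 by linarith
      qed
    qed
  qed
  then have "lam / 2 * (LINT x|lebesgue. (\<zeta> x)\<^sup>2 * (norm (G x))\<^sup>2)
      \<le> 2 * Lam\<^sup>2 / lam * (LINT x|lebesgue. (norm (grad \<zeta> x))\<^sup>2 * (v x)\<^sup>2)"
    using i1 i2 T(2) by simp
  then have "(2 / lam) * (lam / 2 * (LINT x|lebesgue. (\<zeta> x)\<^sup>2 * (norm (G x))\<^sup>2))
      \<le> (2 / lam) * (2 * Lam\<^sup>2 / lam * (LINT x|lebesgue. (norm (grad \<zeta> x))\<^sup>2 * (v x)\<^sup>2))"
    using lam(1) by (intro mult_left_mono) auto
  then show ?thesis using lam(1) by (simp add: power2_eq_square)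
qed

section \<open>Square integrable functions\<close>

text \<open>The Riesz-Fischer theorem. Along a subsequence with squared distances at most \<open>8\<^sup>-\<^sup>m\<close> the
  series of squared increments weighted by \<open>4\<^sup>m\<close> has finite integral, hence is finite almost
  everywhere, and the increments decay like \<open>2\<^sup>-\<^sup>m\<close> there. Fatou's lemma carries the Cauchy
  estimate over to the pointwise limit.\<close>
lemma L2_complete:
  fixes f :: "nat \<Rightarrow> 'a \<Rightarrow> 'b::euclidean_space"
  assumes [measurable]: "\<And>n. f n \<in> borel_measurable M"
    and Cauchy: "\<And>e::real. e > 0 \<Longrightarrow> \<exists>N. \<forall>i\<ge>N. \<forall>j\<ge>N. sq_integral M (\<lambda>x. norm (f i x - f j x)) \<le> ennreal e"
  obtains g where "g \<in> borel_measurable M"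
    "\<And>e::real. e > 0 \<Longrightarrow> \<exists>N. \<forall>i\<ge>N. sq_integral M (\<lambda>x. norm (f i x - g x)) \<le> ennreal e"
proof -
  have "\<forall>m. \<exists>N. \<forall>i\<ge>N. \<forall>j\<ge>N. sq_integral M (\<lambda>x. norm (f i x - f j x)) \<le> ennreal ((1/8) ^ m)"
    using Cauchy by simp
  then obtain N where N: "\<And>m i j. i \<ge> N m \<Longrightarrow> j \<ge> N m \<Longrightarrow> sq_integral M (\<lambda>x. norm (f i x - f j x)) \<le> ennreal ((1/8) ^ m)"
    by metis
  define r where "r m = m + (\<Sum>i\<le>m. N i)" for m
  have r: "r m \<ge> m" "r m \<ge> N m" "r (Suc m) \<ge> N m" for m
  proof -
    have "N m \<le> (\<Sum>i\<le>m. N i)" by (rule member_le_sum) auto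
    then show "r m \<ge> m" "r m \<ge> N m" "r (Suc m) \<ge> N m" unfolding r_def by auto
  qed
  define h where "h m = f (r m)" for m
  have [measurable]: "h m \<in> borel_measurable M" for m by (simp add: h_def)
  define S where "S x = (\<Sum>m. ennreal (4 ^ m * (norm (h (Suc m) x - h m x))\<^sup>2))" for x
  have "(\<integral>\<^sup>+x. S x \<partial>M) = (\<Sum>m. \<integral>\<^sup>+x. ennreal (4 ^ m * (norm (h (Suc m) x - h m x))\<^sup>2) \<partial>M)"
    unfolding S_def by (rule nn_integral_suminf) measurable
  also have "\<dots> \<le> (\<Sum>m. ennreal ((1/2) ^ m))"
  proof (rule suminf_le)
    fix m
    have "(\<integral>\<^sup>+x. ennreal (4 ^ m * (norm (h (Suc m) x - h m x))\<^sup>2) \<partial>M)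
        = ennreal (4 ^ m) * sq_integral M (\<lambda>x. norm (h (Suc m) x - h m x))"
      by (simp add: ennreal_mult nn_integral_cmult)
    also have "\<dots> \<le> ennreal (4 ^ m) * ennreal ((1/8) ^ m)"
      unfolding h_def by (intro mult_left_mono N r) simp
    also have "\<dots> = ennreal (4 ^ m * (1/8) ^ m)" by (simp add: ennreal_mult)
    also have "(4::real) ^ m * (1/8) ^ m = (1/2) ^ m" by (simp add: power_mult_distrib[symmetric])
    finally show "(\<integral>\<^sup>+x. ennreal (4 ^ m * (norm (h (Suc m) x - h m x))\<^sup>2) \<partial>M) \<le> ennreal ((1/2) ^ m)" .
  qed auto
  also have "\<dots> = ennreal (\<Sum>m. (1/2) ^ m)" by (rule suminf_ennreal2) (auto intro: summable_geometric)
  finally have "(\<integral>\<^sup>+x. S x \<partial>M) \<noteq> \<infinity>" by (auto simp: top_unique)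
  then have "AE x in M. S x \<noteq> \<infinity>" by (rule nn_integral_PInf_AE[rotated]) (simp add: S_def)
  then have conv: "AE x in M. (\<lambda>m. h m x) \<longlonglongrightarrow> lim (\<lambda>m. h m x)"
  proof eventually_elim
    case (elim x)
    then obtain C where C: "S x = ennreal C" "C \<ge> 0" by (cases "S x") auto
    have step: "norm (h (Suc m) x - h m x) \<le> sqrt C * (1/2) ^ m" for m
    proof -
      have "ennreal (4 ^ m * (norm (h (Suc m) x - h m x))\<^sup>2)
          = (\<Sum>k\<in>{m}. ennreal (4 ^ k * (norm (h (Suc k) x - h k x))\<^sup>2))" by simp
      also have "\<dots> \<le> S x" unfolding S_def by (rule sum_le_suminf) auto
      finally have "4 ^ m * (norm (h (Suc m) x - h m x))\<^sup>2 \<le> C" using C by (simp add: ennreal_le_iff)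
      then have "(2 ^ m * norm (h (Suc m) x - h m x))\<^sup>2 \<le> C"
        by (simp add: power_mult_distrib power_mult[symmetric] mult.commute[of m] power_mult)
      then have "2 ^ m * norm (h (Suc m) x - h m x) \<le> sqrt C" by (rule real_le_rsqrt)
      then have "norm (h (Suc m) x - h m x) \<le> sqrt C / 2 ^ m"
        by (subst pos_le_divide_eq) (simp_all add: mult.commute)
      then show ?thesis by (simp add: power_one_over)
    qed
    have "summable (\<lambda>m. sqrt C * (1/2) ^ m)" by (intro summable_mult summable_geometric) simp
    then have "summable (\<lambda>m. h (Suc m) x - h m x)"
      by (rule summable_comparison_test'[where N=0]) (rule step)
    then have "(\<lambda>n. \<Sum>m<n. h (Suc m) x - h m x) \<longlonglongrightarrow> (\<Sum>m. h (Suc m) x - h m x)" by (rule summable_LIMSEQ)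
    then have "(\<lambda>n. h n x - h 0 x) \<longlonglongrightarrow> (\<Sum>m. h (Suc m) x - h m x)" by (simp add: sum_lessThan_telescope[of "\<lambda>m. h m x"])
    from tendsto_add[OF this tendsto_const[of "h 0 x"]] have "convergent (\<lambda>m. h m x)"
      by (auto simp: convergent_def)
    then show ?case by (simp add: convergent_LIMSEQ_iff)
  qed
  define g where "g x = lim (\<lambda>m. h m x)" for x
  have g [measurable]: "g \<in> borel_measurable M" unfolding g_def by measurable
  show ?thesis
  proof (rule that[OF g])
    fix e :: real assume "e > 0"
    then obtain N0 where N0: "\<And>i j. i \<ge> N0 \<Longrightarrow> j \<ge> N0 \<Longrightarrow> sq_integral M (\<lambda>x. norm (f i x - f j x)) \<le> ennreal e"
      using Cauchy by blast
    have "sq_integral M (\<lambda>x. norm (f i x - g x)) \<le> ennreal e" if i: "i \<ge> N0" for i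
    proof -
      have "sq_integral M (\<lambda>x. norm (f i x - g x))
          = (\<integral>\<^sup>+x. liminf (\<lambda>m. ennreal ((norm (f i x - h m x))\<^sup>2)) \<partial>M)"
      proof (rule nn_integral_cong_AE)
        show "AE x in M. ennreal ((norm (f i x - g x))\<^sup>2) = liminf (\<lambda>m. ennreal ((norm (f i x - h m x))\<^sup>2))"
          using conv
        proof eventually_elim
          case (elim x)
          have "(\<lambda>m. ennreal ((norm (f i x - h m x))\<^sup>2)) \<longlonglongrightarrow> ennreal ((norm (f i x - g x))\<^sup>2)"
            unfolding g_def by (intro tendsto_intros elim)
          then show ?case by (rule lim_imp_Liminf[OF sequentially_bot, symmetric])
        qed
      qed
      also have "\<dots> \<le> liminf (\<lambda>m. \<integral>\<^sup>+x. ennreal ((norm (f i x - h m x))\<^sup>2) \<partial>M)"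
        by (rule nn_integral_liminf) measurable
      also have "\<dots> \<le> ennreal e"
      proof (rule Liminf_le)
        show "\<forall>\<^sub>F m in sequentially. sq_integral M (\<lambda>x. norm (f i x - h m x)) \<le> ennreal e"
          unfolding eventually_sequentially h_def
          by (intro exI[of _ N0] allI impI N0 i order_trans[OF _ r(1)])
      qed simp
      finally show ?thesis .
    qed
    then show "\<exists>N. \<forall>i\<ge>N. sq_integral M (\<lambda>x. norm (f i x - g x)) \<le> ennreal e" by blast
  qed
qed

text \<open>Extension by zero, which makes restrictions to subsets and almost everywhere modifications
  accessible to lemmas about the complete measure on the whole space.\<close>
lemma L2_iff_lebesgue:
  fixes f :: "real^'n \<Rightarrow> 'b::euclidean_space"
  assumes S: "S \<in> sets lebesgue"
  shows "L2 S f \<longleftrightarrow> (\<lambda>x. indicator S x *\<^sub>R f x) \<in> borel_measurable lebesgue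
    \<and> integrable lebesgue (\<lambda>x. (norm (indicator S x *\<^sub>R f x))\<^sup>2)"
proof -
  have S': "S \<inter> space lebesgue \<in> sets lebesgue" using S by simp
  have "(\<lambda>x. (norm (indicator S x *\<^sub>R f x))\<^sup>2) = (\<lambda>x. indicator S x *\<^sub>R (norm (f x))\<^sup>2)"
    by (auto split: split_indicator)
  then show ?thesis
    unfolding L2_def borel_measurable_restrict_space_iff[OF S'] integrable_restrict_space[OF S'] by simp
qed

lemma L2_subset:
  fixes f :: "real^'n \<Rightarrow> 'b::euclidean_space"
  assumes f: "L2 S f" and S: "S \<in> sets lebesgue" "T \<in> sets lebesgue" "T \<subseteq> S"
  shows "L2 T f"
proof -
  have e: "indicator T x *\<^sub>R f x = indicator T x *\<^sub>R (indicator S x *\<^sub>R f x)" for x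
    using S(3) by (auto split: split_indicator)
  note f = f[unfolded L2_iff_lebesgue[OF S(1)]]
  have m [measurable]: "(\<lambda>x. indicator S x *\<^sub>R f x) \<in> borel_measurable lebesgue" using f by simp
  note [measurable] = S(2)
  show ?thesis unfolding L2_iff_lebesgue[OF S(2)] e
  proof
    show 1: "(\<lambda>x. indicator T x *\<^sub>R (indicator S x *\<^sub>R f x)) \<in> borel_measurable lebesgue" by measurable
    show "integrable lebesgue (\<lambda>x. (norm (indicator T x *\<^sub>R (indicator S x *\<^sub>R f x)))\<^sup>2)"
    proof (rule Bochner_Integration.integrable_bound[OF f[THEN conjunct2]])
      show "(\<lambda>x. (norm (indicator T x *\<^sub>R (indicator S x *\<^sub>R f x)))\<^sup>2) \<in> borel_measurable lebesgue"
        using 1 by measurable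
    qed (auto split: split_indicator)
  qed
qed

lemma L2_diff:
  fixes f g :: "real^'n \<Rightarrow> 'b::euclidean_space"
  assumes "L2 S f" "L2 S g" shows "L2 S (\<lambda>x. f x - g x)"
  unfolding L2_def
proof
  note [measurable] = assms[unfolded L2_def, THEN conjunct1]
  show "(\<lambda>x. f x - g x) \<in> borel_measurable (lebesgue_on S)" by measurable
  have i: "integrable (lebesgue_on S) (\<lambda>x. 2 * (norm (f x))\<^sup>2 + 2 * (norm (g x))\<^sup>2)"
    using assms by (simp add: L2_def)
  show "integrable (lebesgue_on S) (\<lambda>x. (norm (f x - g x))\<^sup>2)"
  proof (rule Bochner_Integration.integrable_bound[OF i])
    show "AE x in lebesgue_on S. norm ((norm (f x - g x))\<^sup>2) \<le> norm (2 * (norm (f x))\<^sup>2 + 2 * (norm (g x))\<^sup>2)"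
      using norm_add_power2_le[of "f _" "- g _"] by (intro AE_I2) simp
  qed measurable
qed

lemma L2_loc_diff: "L2_loc S f \<Longrightarrow> L2_loc S g \<Longrightarrow> L2_loc S (\<lambda>x. f x - g x)"
  by (simp add: L2_loc_def L2_diff)

lemma L2_cong_AE:
  fixes f g :: "real^'n \<Rightarrow> 'b::euclidean_space"
  assumes f: "L2 S f" and S: "S \<in> sets lebesgue" and ae: "AE x in lebesgue. x \<in> S \<longrightarrow> f x = g x"
  shows "L2 S g" "L2_norm S g = L2_norm S f"
proof -
  note f' = f[unfolded L2_iff_lebesgue[OF S]]
  have ae': "AE x in lebesgue. indicator S x *\<^sub>R f x = indicator S x *\<^sub>R g x"
    using ae by eventually_elim (auto split: split_indicator)
  have m: "(\<lambda>x. indicator S x *\<^sub>R g x) \<in> borel_measurable lebesgue"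
    using borel_measurable_AE[OF _ ae'] f' by blast
  have m2: "(\<lambda>x. (norm (indicator S x *\<^sub>R g x))\<^sup>2) \<in> borel_measurable lebesgue"
    using m by measurable
  have "integrable lebesgue (\<lambda>x. (norm (indicator S x *\<^sub>R g x))\<^sup>2)"
    by (rule integrable_cong_AE_imp[OF f'[THEN conjunct2] m2]) (use ae' in \<open>eventually_elim, metis\<close>)
  then show g: "L2 S g" using m unfolding L2_iff_lebesgue[OF S] by simp
  have "(LINT x|lebesgue_on S. (norm (g x))\<^sup>2) = (LINT x|lebesgue_on S. (norm (f x))\<^sup>2)"
  proof (rule integral_cong_AE)
    show "(\<lambda>x. (norm (g x))\<^sup>2) \<in> borel_measurable (lebesgue_on S)" using g by (simp add: L2_def borel_measurable_integrable)
    show "(\<lambda>x. (norm (f x))\<^sup>2) \<in> borel_measurable (lebesgue_on S)" using f by (simp add: L2_def borel_measurable_integrable)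
    show "AE x in lebesgue_on S. (norm (g x))\<^sup>2 = (norm (f x))\<^sup>2"
      using S ae by (subst AE_restrict_space_iff) (auto elim: eventually_mono)
  qed
  then show "L2_norm S g = L2_norm S f" by (simp add: L2_norm_def)
qed

lemma L2_imp_L1_loc:
  fixes f :: "real^'n \<Rightarrow> 'b::euclidean_space"
  assumes f: "L2 S f" and S: "S \<in> sets lebesgue"
  shows "L1_loc S f"
  unfolding L1_loc_def
proof (intro allI impI, elim conjE)
  fix K assume K: "compact K" "K \<subseteq> S"
  have Kf: "L2 K f" by (rule L2_subset[OF f S sets_lebesgue_compact[OF K(1)] K(2)])
  have "emeasure (lebesgue_on K) (space (lebesgue_on K)) < \<infinity>"
    using K(1) emeasure_bounded_finite[OF compact_imp_bounded[OF K(1)]] sets_lebesgue_compact[OF K(1)]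
    by (simp add: emeasure_restrict_space borel_compact)
  then have "integrable (lebesgue_on K) (\<lambda>x. 1::real)"
    by (intro finite_measure.integrable_const finite_measureI) auto
  then have i: "integrable (lebesgue_on K) (\<lambda>x. 1 + (norm (f x))\<^sup>2)" using Kf by (simp add: L2_def)
  show "integrable (lebesgue_on K) f"
  proof (rule Bochner_Integration.integrable_bound[OF i])
    show "AE x in lebesgue_on K. norm (f x) \<le> norm (1 + (norm (f x))\<^sup>2)"
    proof (rule AE_I2)
      fix x
      have "0 \<le> (norm (f x) - 1)\<^sup>2" by simp
      then have "2 * norm (f x) \<le> 1 + (norm (f x))\<^sup>2" by (simp add: power2_diff)
      moreover have "0 \<le> norm (f x)" by simp
      ultimately show "norm (f x) \<le> norm (1 + (norm (f x))\<^sup>2)" unfolding real_norm_def by linarith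
    qed
  qed (use Kf in \<open>simp add: L2_def\<close>)
qed

lemma L2_nn_integral:
  "L2 S f \<Longrightarrow> sq_integral (lebesgue_on S) (\<lambda>x. norm (f x)) = ennreal ((L2_norm S f)\<^sup>2)"
  by (subst nn_integral_eq_integral) (auto simp: L2_def L2_norm_def)

lemma L2_I:
  assumes "f \<in> borel_measurable (lebesgue_on S)" "sq_integral (lebesgue_on S) (\<lambda>x. norm (f x)) \<le> ennreal a"
  shows "L2 S f"
proof -
  have "(\<integral>\<^sup>+x. ennreal (norm ((norm (f x))\<^sup>2)) \<partial>lebesgue_on S) < \<infinity>"
    using le_less_trans[OF assms(2) ennreal_less_top] by simp
  then show ?thesis using assms(1) unfolding L2_def integrable_iff_bounded by simp
qed

lemma integral_inner_tendsto:
  fixes f :: "nat \<Rightarrow> 'a \<Rightarrow> 'b::euclidean_space"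
  assumes m: "\<And>n. f n \<in> borel_measurable M" "g \<in> borel_measurable M" "p \<in> borel_measurable M"
    and p: "sq_integral M (\<lambda>x. norm (p x)) \<le> ennreal a"
    and i: "\<And>n. integrable M (\<lambda>x. f n x \<bullet> p x)"
    and lim: "\<And>e::real. e > 0 \<Longrightarrow> \<exists>N. \<forall>i\<ge>N. sq_integral M (\<lambda>x. norm (f i x - g x)) \<le> ennreal e"
  shows "integrable M (\<lambda>x. g x \<bullet> p x)" "(\<lambda>n. \<integral>x. f n x \<bullet> p x \<partial>M) \<longlonglongrightarrow> (\<integral>x. g x \<bullet> p x \<partial>M)"
proof -
  define b where "b = max a 0"
  have b: "b \<ge> 0" "sq_integral M (\<lambda>x. norm (p x)) \<le> ennreal b"
    using p by (auto simp: b_def intro: order_trans ennreal_leI)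
  have dm: "(\<lambda>x. f n x - g x) \<in> borel_measurable M" for n using m by measurable
  have key: "integrable M (\<lambda>x. (f n x - g x) \<bullet> p x)" "\<bar>\<integral>x. (f n x - g x) \<bullet> p x \<partial>M\<bar> \<le> sqrt (e * b)"
    if "e > 0" "sq_integral M (\<lambda>x. norm (f n x - g x)) \<le> ennreal e" for e n
    using L2_inner_bound[OF dm m(3) that(2) b(2) _ b(1)] that(1) by auto
  show ig: "integrable M (\<lambda>x. g x \<bullet> p x)"
  proof -
    obtain N where "sq_integral M (\<lambda>x. norm (f N x - g x)) \<le> ennreal 1" using lim[of 1] by auto
    then have "integrable M (\<lambda>x. f N x \<bullet> p x - (f N x - g x) \<bullet> p x)"
      by (intro Bochner_Integration.integrable_diff i key(1)[of 1]) auto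
    then show ?thesis by (simp add: inner_diff_left)
  qed
  show "(\<lambda>n. \<integral>x. f n x \<bullet> p x \<partial>M) \<longlonglongrightarrow> (\<integral>x. g x \<bullet> p x \<partial>M)"
  proof (rule LIMSEQ_I)
    fix \<epsilon> :: real assume \<epsilon>: "\<epsilon> > 0"
    define e where "e = \<epsilon>\<^sup>2 / (2 * (b + 1))"
    have e: "e > 0" using \<epsilon> b(1) by (simp add: e_def)
    have "e * b = (b / (b + 1)) * (\<epsilon>\<^sup>2 / 2)" by (simp add: e_def mult.commute)
    also have "\<dots> \<le> 1 * (\<epsilon>\<^sup>2 / 2)" using b(1) by (intro mult_right_mono) auto
    also have "\<dots> < \<epsilon>\<^sup>2" using \<epsilon> by simp
    finally have "sqrt (e * b) < sqrt (\<epsilon>\<^sup>2)" by (rule real_sqrt_less_mono)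
    then have eb: "sqrt (e * b) < \<epsilon>" using \<epsilon> by simp
    obtain N where N: "\<And>n. n \<ge> N \<Longrightarrow> sq_integral M (\<lambda>x. norm (f n x - g x)) \<le> ennreal e"
      using lim[OF e] by blast
    have "norm ((\<integral>x. f n x \<bullet> p x \<partial>M) - (\<integral>x. g x \<bullet> p x \<partial>M)) < \<epsilon>" if "n \<ge> N" for n
    proof -
      have "(\<integral>x. f n x \<bullet> p x \<partial>M) - (\<integral>x. g x \<bullet> p x \<partial>M) = (\<integral>x. (f n x - g x) \<bullet> p x \<partial>M)"
        unfolding inner_diff_left using i ig by simp
      then show ?thesis using key(2)[OF e N[OF that]] eb by simp
    qed
    then show "\<exists>N. \<forall>n\<ge>N. norm ((\<integral>x. f n x \<bullet> p x \<partial>M) - (\<integral>x. g x \<bullet> p x \<partial>M)) < \<epsilon>" by blast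
  qed
qed

section \<open>Rellich's theorem\<close>

lemma nn_integral_norm_power2_le:
  fixes f g :: "'a \<Rightarrow> 'b::euclidean_space"
  assumes [measurable]: "f \<in> borel_measurable M" "g \<in> borel_measurable M"
  shows "sq_integral M (\<lambda>x. norm (f x))
    \<le> 2 * sq_integral M (\<lambda>x. norm (f x - g x)) + 2 * sq_integral M (\<lambda>x. norm (g x))"
proof -
  have "sq_integral M (\<lambda>x. norm (f x))
     \<le> (\<integral>\<^sup>+x. 2 * ennreal ((norm (f x - g x))\<^sup>2) + 2 * ennreal ((norm (g x))\<^sup>2) \<partial>M)"
  proof (rule nn_integral_mono)
    fix x
    have "(norm (f x))\<^sup>2 \<le> 2 * (norm (f x - g x))\<^sup>2 + 2 * (norm (g x))\<^sup>2"
      using norm_add_power2_le[of "f x - g x" "g x"] by simp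
    then have "ennreal ((norm (f x))\<^sup>2) \<le> ennreal (2 * (norm (f x - g x))\<^sup>2 + 2 * (norm (g x))\<^sup>2)" by (rule ennreal_leI)
    then show "ennreal ((norm (f x))\<^sup>2) \<le> 2 * ennreal ((norm (f x - g x))\<^sup>2) + 2 * ennreal ((norm (g x))\<^sup>2)"
      by (simp add: ennreal_plus ennreal_mult)
  qed
  also have "\<dots> = 2 * sq_integral M (\<lambda>x. norm (f x - g x)) + 2 * sq_integral M (\<lambda>x. norm (g x))"
    by (simp add: nn_integral_cmult nn_integral_add)
  finally show ?thesis .
qed

text \<open>Replace \<open>w j\<close> by a test function at squared distance at most \<open>1 / (j + 1)\<close>, gradients
  included; the replacements stay bounded and share a bounded support, and the errors vanish
  along every subsequence.\<close>
theorem Rellich_compactness: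
  fixes w :: "nat \<Rightarrow> real^'n \<Rightarrow> real"
  assumes wg: "\<And>j. has_weak_grad UNIV (w j) (H j)"
    and K: "compact K" "\<And>j x. x \<notin> K \<Longrightarrow> w j x = 0" "\<And>j x. x \<notin> K \<Longrightarrow> H j x = 0"
    and i2: "\<And>j. integrable lebesgue (\<lambda>x. (w j x)\<^sup>2)" "\<And>j. integrable lebesgue (\<lambda>x. (norm (H j x))\<^sup>2)"
    and M: "\<And>j. (LINT x|lebesgue. (w j x)\<^sup>2) \<le> M" "\<And>j. (LINT x|lebesgue. (norm (H j x))\<^sup>2) \<le> M"
  obtains r :: "nat \<Rightarrow> nat" where "strict_mono r"
    "\<And>e. e > 0 \<Longrightarrow> \<exists>N. \<forall>i\<ge>N. \<forall>j\<ge>N. sq_integral lebesgue (\<lambda>x. w (r i) x - w (r j) x) \<le> ennreal e"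
proof -
  obtain R where R: "\<And>x. x \<in> K \<Longrightarrow> norm x \<le> R" using compact_imp_bounded[OF K(1)] unfolding bounded_iff by blast
  have KV: "K \<subseteq> ball 0 (R + 1)" using R by force
  note Km = sets_lebesgue_compact[OF K(1)]
  have wm [measurable]: "w j \<in> borel_measurable lebesgue" and Hm [measurable]: "H j \<in> borel_measurable lebesgue" for j
    using has_weak_grad_L1(1,2)[OF wg[of j]] K lebesgue_on_support(1)[OF Km, of "w j"] lebesgue_on_support(1)[OF Km, of "H j"]
    by (auto simp: L1_loc_def)
  have M0: "M \<ge> 0" using M(1)[of 0] by (rule order_trans[rotated]) simp
  have nM: "sq_integral lebesgue (\<lambda>x. norm (w j x)) \<le> ennreal M" "sq_integral lebesgue (\<lambda>x. norm (H j x)) \<le> ennreal M" for j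
    using nn_integral_eq_integral[OF i2(1)[of j]] nn_integral_eq_integral[OF i2(2)[of j]] M[of j] by (auto intro: ennreal_leI)
  have "\<forall>j. \<exists>\<phi>. \<phi> \<in> test_functions (ball 0 (R + 1)) \<and> sq_integral lebesgue (\<lambda>x. \<phi> x - w j x) \<le> ennreal (1 / Suc j)
    \<and> sq_integral lebesgue (\<lambda>x. norm (grad \<phi> x - H j x)) \<le> ennreal (1 / Suc j)" (is "\<forall>j. ?E j")
  proof
    fix j
    have "1 / real (Suc j) > 0" by simp
    from weak_grad_approx[OF wg K i2 open_ball KV this, of j] show "?E j" by blast
  qed
  from choice[OF this] obtain \<phi> where \<phi>: "\<And>j. \<phi> j \<in> test_functions (ball 0 (R + 1))"
    "\<And>j. sq_integral lebesgue (\<lambda>x. \<phi> j x - w j x) \<le> ennreal (1 / Suc j)"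
    "\<And>j. sq_integral lebesgue (\<lambda>x. norm (grad (\<phi> j) x - H j x)) \<le> ennreal (1 / Suc j)"
    by blast
  have \<phi>T: "\<phi> j \<in> test_functions UNIV" for j using \<phi>(1)[of j] test_functions_mono[OF subset_UNIV] by blast
  have [measurable]: "\<phi> j \<in> borel_measurable lebesgue" "grad (\<phi> j) \<in> borel_measurable lebesgue" for j
    using test_functions_smooth[OF \<phi>(1)[of j]]
    by (auto intro: continuous_borel_lebesgue smooth_on_continuous smooth_on_continuous_grad)
  define M' where "M' = 2 * 1 + 2 * M"
  have M'_eq: "2 * ennreal 1 + 2 * ennreal M = ennreal M'"
    unfolding M'_def using M0 by (simp add: ennreal_plus ennreal_mult)
  have le1: "ennreal (1 / Suc j) \<le> ennreal 1" for j by (rule ennreal_leI) simp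
  obtain r :: "nat \<Rightarrow> nat" where r: "strict_mono r"
    "\<And>e. e > 0 \<Longrightarrow> \<exists>N. \<forall>i\<ge>N. \<forall>j\<ge>N. sq_integral lborel (\<lambda>x. \<phi> (r i) x - \<phi> (r j) x) \<le> ennreal e"
  proof (rule Rellich_test_functions[of \<phi> "R + 1" M'])
    show "\<phi> j x = 0" if "R + 1 < norm x" for j x using test_functions_zero[OF \<phi>(1), of x j] that by auto
    show "sq_integral lborel (\<lambda>x. \<phi> j x) \<le> ennreal M'" for j
    proof -
      have "sq_integral lebesgue (\<lambda>x. norm (\<phi> j x))
        \<le> 2 * sq_integral lebesgue (\<lambda>x. norm (\<phi> j x - w j x)) + 2 * sq_integral lebesgue (\<lambda>x. norm (w j x))"
        by (rule nn_integral_norm_power2_le) measurable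
      also have "\<dots> \<le> 2 * ennreal 1 + 2 * ennreal M"
        using nM(1)[of j] order_trans[OF \<phi>(2) le1, of j] by (intro add_mono mult_left_mono) auto
      finally show ?thesis unfolding M'_eq by (simp add: nn_integral_completion)
    qed
    show "sq_integral lborel (\<lambda>x. norm (grad (\<phi> j) x)) \<le> ennreal M'" for j
    proof -
      have "sq_integral lebesgue (\<lambda>x. norm (grad (\<phi> j) x))
        \<le> 2 * sq_integral lebesgue (\<lambda>x. norm (grad (\<phi> j) x - H j x)) + 2 * sq_integral lebesgue (\<lambda>x. norm (H j x))"
        by (rule nn_integral_norm_power2_le) measurable
      also have "\<dots> \<le> 2 * ennreal 1 + 2 * ennreal M"
        using nM(2)[of j] order_trans[OF \<phi>(3) le1, of j] by (intro add_mono mult_left_mono) auto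
      finally show ?thesis unfolding M'_eq by (simp add: nn_integral_completion)
    qed
  qed (use \<phi>T in auto)
  show ?thesis
  proof (rule that[OF r(1)])
    fix e :: real assume e: "e > 0"
    obtain N0 :: nat where N0: "1 / real (Suc N0) < e / 9"
      using reals_Archimedean[of "e / 9"] e by (auto simp: inverse_eq_divide)
    obtain N1 where N1: "\<And>i j. i \<ge> N1 \<Longrightarrow> j \<ge> N1 \<Longrightarrow> sq_integral lborel (\<lambda>x. \<phi> (r i) x - \<phi> (r j) x) \<le> ennreal (e / 9)"
      using r(2)[of "e / 9"] e by auto
    have near: "sq_integral lebesgue (\<lambda>x. \<phi> (r i) x - w (r i) x) \<le> ennreal (e / 9)" if "i \<ge> N0" for i
    proof -
      have "N0 \<le> r i" using that seq_suble[OF r(1), of i] by simp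
      then have "1 / real (Suc (r i)) \<le> 1 / real (Suc N0)" by (intro divide_left_mono) auto
      then have "1 / real (Suc (r i)) \<le> e / 9" using N0 by simp
      with \<phi>(2)[of "r i"] show ?thesis by (meson ennreal_leI order_trans)
    qed
    have "sq_integral lebesgue (\<lambda>x. w (r i) x - w (r j) x) \<le> ennreal e" if "i \<ge> max N0 N1" "j \<ge> max N0 N1" for i j
    proof -
      have "sq_integral lebesgue (\<lambda>x. w (r i) x - w (r j) x)
        \<le> 3 * (sq_integral lebesgue (\<lambda>x. w (r i) x - \<phi> (r i) x) + sq_integral lebesgue (\<lambda>x. \<phi> (r i) x - \<phi> (r j) x)
          + sq_integral lebesgue (\<lambda>x. \<phi> (r j) x - w (r j) x))"
        by (rule nn_integral_power2_triangle) measurable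
      also have "sq_integral lebesgue (\<lambda>x. w (r i) x - \<phi> (r i) x) = sq_integral lebesgue (\<lambda>x. \<phi> (r i) x - w (r i) x)"
        by (simp add: power2_commute)
      also have "3 * (sq_integral lebesgue (\<lambda>x. \<phi> (r i) x - w (r i) x) + sq_integral lebesgue (\<lambda>x. \<phi> (r i) x - \<phi> (r j) x)
          + sq_integral lebesgue (\<lambda>x. \<phi> (r j) x - w (r j) x)) \<le> 3 * (ennreal (e/9) + ennreal (e/9) + ennreal (e/9))"
        using near[of i] near[of j] N1[of i j] that
        by (intro mult_left_mono add_mono) (auto simp: nn_integral_completion)
      also have "\<dots> = ennreal e" using e by (simp add: ennreal_plus[symmetric] ennreal_mult'[symmetric] flip: ennreal_numeral)
      finally show ?thesis .
    qed
    then show "\<exists>N. \<forall>i\<ge>N. \<forall>j\<ge>N. sq_integral lebesgue (\<lambda>x. w (r i) x - w (r j) x) \<le> ennreal e" by blast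
  qed
qed

section \<open>Compactness of sequences of solutions\<close>

lemma inner_grad_integrable:
  fixes F :: "real^'n \<Rightarrow> real^'n"
  assumes F: "L1_loc S F" and \<phi>: "\<phi> \<in> test_functions S"
  shows "integrable lebesgue (\<lambda>x. F x \<bullet> grad \<phi> x)"
proof -
  have "integrable lebesgue (\<lambda>x. \<Sum>i\<in>UNIV. grad \<phi> x $ i *\<^sub>R F x $ i)"
    by (intro Bochner_Integration.integrable_sum L1_loc_test_integrable[OF L1_loc_component[OF F]] test_functions_grad \<phi>)
  then show ?thesis by (simp add: inner_vec_def mult.commute)
qed

lemma weak_div_zeroD:
  assumes "weak_div_zero S F" "open S" "\<phi> \<in> test_functions S"
  shows "(LINT x|lebesgue. F x \<bullet> grad \<phi> x) = 0"
  using assms lebesgue_on_support(2)[OF sets_lebesgue_open[OF assms(2)], of "\<lambda>x. F x \<bullet> grad \<phi> x"]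
    test_functions_zero[OF assms(3)] by (simp add: weak_div_zero_def)

lemma weak_div_zeroI:
  assumes "L1_loc S F" "open S" "\<And>\<phi>. \<phi> \<in> test_functions S \<Longrightarrow> (LINT x|lebesgue. F x \<bullet> grad \<phi> x) = 0"
  shows "weak_div_zero S F"
  unfolding weak_div_zero_def
proof (intro conjI ballI)
  fix \<phi> assume \<phi>: "\<phi> \<in> test_functions S"
  show "(LINT x|lebesgue_on S. F x \<bullet> grad \<phi> x) = 0"
    using lebesgue_on_support(2)[OF sets_lebesgue_open[OF assms(2)], of "\<lambda>x. F x \<bullet> grad \<phi> x"]
    test_functions_zero[OF \<phi>] assms(3)[OF \<phi>] by simp
qed (rule assms(1))

lemma weak_div_zero_diff:
  assumes "weak_div_zero S F" "weak_div_zero S G" "open S"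
  shows "weak_div_zero S (\<lambda>x. F x - G x)"
proof (rule weak_div_zeroI[OF _ assms(3)])
  have l: "L1_loc S F" "L1_loc S G" using assms by (auto simp: weak_div_zero_def)
  show "L1_loc S (\<lambda>x. F x - G x)" by (rule L1_loc_diff[OF l])
  fix \<phi> assume \<phi>: "\<phi> \<in> test_functions S"
  show "(LINT x|lebesgue. (F x - G x) \<bullet> grad \<phi> x) = 0"
    using inner_grad_integrable[OF l(1) \<phi>] inner_grad_integrable[OF l(2) \<phi>]
      weak_div_zeroD[OF assms(1,3) \<phi>] weak_div_zeroD[OF assms(2,3) \<phi>]
    by (simp add: inner_diff_left)
qed

text \<open>Expanding \<open>g x\<close> in the basis reduces the claim to the evaluations at fixed vectors, which
  are continuous in the linear map.\<close>
lemma measurable_blinfun_apply: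
  fixes A :: "'a \<Rightarrow> ((real^'n) \<Rightarrow>\<^sub>L (real^'n))"
  assumes [measurable]: "A \<in> borel_measurable M" "g \<in> borel_measurable M"
  shows "(\<lambda>x. blinfun_apply (A x) (g x)) \<in> borel_measurable M"
proof -
  have [measurable]: "(\<lambda>x. blinfun_apply (A x) b) \<in> borel_measurable M" for b
    by (rule measurable_compose[OF assms(1) borel_measurable_continuous_onI])
      (rule linear_continuous_on, rule blinfun.bounded_linear_left)
  have "blinfun_apply (A x) (g x) = (\<Sum>b\<in>Basis. (g x \<bullet> b) *\<^sub>R blinfun_apply (A x) b)" for x
    by (subst (1) euclidean_representation[of "g x", symmetric]) (simp add: blinfun.sum_right blinfun.scaleR_right)
  then show ?thesis by simp
qed

lemma weighted_integral_le:
  fixes h \<psi> :: "real^'n \<Rightarrow> real"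
  assumes K: "K \<in> sets lebesgue" and h: "integrable (lebesgue_on K) h" "\<And>x. 0 \<le> h x"
    and i: "integrable lebesgue (\<lambda>x. \<psi> x * h x)" and \<psi>: "\<And>x. \<psi> x \<le> B" "\<And>x. x \<notin> K \<Longrightarrow> \<psi> x = 0"
  shows "(LINT x|lebesgue. \<psi> x * h x) \<le> B * (LINT x|lebesgue_on K. h x)"
proof -
  have "(LINT x|lebesgue. \<psi> x * h x) = (LINT x|lebesgue_on K. \<psi> x * h x)"
    using lebesgue_on_support(2)[OF K, of "\<lambda>x. \<psi> x * h x"] \<psi>(2) by simp
  also have "\<dots> \<le> (LINT x|lebesgue_on K. B * h x)"
  proof (rule Bochner_Integration.integral_mono)
    show "integrable (lebesgue_on K) (\<lambda>x. \<psi> x * h x)" by (rule integrable_lebesgue_on[OF K i])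
  qed (use h \<psi> in \<open>auto intro: mult_right_mono\<close>)
  finally show ?thesis by simp
qed

text \<open>The Caccioppoli inequality is used twice. For the single solutions and the cutoff \<open>\<zeta>\<close> it
  turns the bounds in mean square into gradient bounds for \<open>\<zeta> v\<close>, so Rellich's theorem gives a
  subsequence that is Cauchy in mean square. For the differences of solutions and the cutoff
  \<open>\<theta>\<close>, supported where \<open>\<zeta>\<close> is one, it bounds the differences of the gradients on \<open>C\<close> by the
  differences of the functions. The field \<open>F j\<close> plays the role of the flux of \<open>v j\<close>; linearity
  of the equation enters as the second ellipticity assumption, for differences.\<close>
lemma solutions_Cauchy_subsequence:
  fixes v :: "nat \<Rightarrow> real^'n \<Rightarrow> real"
  assumes S: "open S" and v: "\<And>j. has_weak_grad S (v j) (g j)" "\<And>j. L2_loc S (v j)" "\<And>j. L2_loc S (g j)"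
    and F: "\<And>j. weak_div_zero S (F j)" "\<And>j. L2_loc S (F j)"
    and lam: "0 < lam" "0 \<le> Lam"
    and ell: "\<And>j. AE x in lebesgue. x \<in> S \<longrightarrow> lam * (norm (g j x))\<^sup>2 \<le> F j x \<bullet> g j x \<and> norm (F j x) \<le> Lam * norm (g j x)"
    and ell_diff: "\<And>i j. AE x in lebesgue. x \<in> S \<longrightarrow>
      lam * (norm (g i x - g j x))\<^sup>2 \<le> (F i x - F j x) \<bullet> (g i x - g j x) \<and> norm (F i x - F j x) \<le> Lam * norm (g i x - g j x)"
    and bdd: "\<And>K. compact K \<Longrightarrow> K \<subseteq> S \<Longrightarrow> bdd_above (range (\<lambda>j. L2_norm K (v j)))"
    and C: "compact C" "C \<subseteq> S"
  obtains r :: "nat \<Rightarrow> nat" where "strict_mono r"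
    "\<And>e. e > 0 \<Longrightarrow> \<exists>N. \<forall>i\<ge>N. \<forall>j\<ge>N. sq_integral (lebesgue_on C) (\<lambda>x. v (r i) x - v (r j) x) \<le> ennreal e
      \<and> sq_integral (lebesgue_on C) (\<lambda>x. norm (g (r i) x - g (r j) x)) \<le> ennreal e"
proof -
  obtain \<theta> where \<theta>: "\<theta> \<in> test_functions S" "\<And>x. x \<in> C \<Longrightarrow> \<theta> x = 1"
    using ex_cutoff[OF C(1) S C(2)] by metis
  obtain K where K: "compact K" "K \<subseteq> S" "\<And>x. x \<notin> K \<Longrightarrow> \<theta> x = 0" "\<And>x. x \<notin> K \<Longrightarrow> grad \<theta> x = 0"
    using test_functions_support[OF \<theta>(1)] by metis
  have CK: "C \<subseteq> K" using \<theta>(2) K(3) by force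
  obtain \<zeta> where \<zeta>: "\<zeta> \<in> test_functions S" "\<And>x. 0 \<le> \<zeta> x" "\<And>x. \<zeta> x \<le> 1" "\<And>x. x \<in> K \<Longrightarrow> \<zeta> x = 1"
    using ex_cutoff[OF K(1) S K(2)] by metis
  obtain L where L: "compact L" "L \<subseteq> S" "\<And>x. x \<notin> L \<Longrightarrow> \<zeta> x = 0" "\<And>x. x \<notin> L \<Longrightarrow> grad \<zeta> x = 0"
    using test_functions_support[OF \<zeta>(1)] by metis
  obtain B where B: "B > 0" "\<And>x. norm (grad \<zeta> x) \<le> B" using test_functions_bounded[OF \<zeta>(1)] by metis
  obtain B' where B': "B' > 0" "\<And>x. norm (grad \<theta> x) \<le> B'" using test_functions_bounded[OF \<theta>(1)] by metis
  note Lm = sets_lebesgue_compact[OF L(1)] and Cm = sets_lebesgue_compact[OF C(1)]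
  obtain m where m: "\<And>j. L2_norm L (v j) \<le> m" using bdd[OF L(1,2)] by (auto simp: bdd_above_def)
  define k where "k = 4 * Lam\<^sup>2 / lam\<^sup>2"
  have k: "k \<ge> 0" by (simp add: k_def)
  have vL: "(LINT x|lebesgue_on L. (v j x)\<^sup>2) \<le> m\<^sup>2" for j
  proof -
    have nn: "0 \<le> (LINT x|lebesgue_on L. (v j x)\<^sup>2)" by (rule Bochner_Integration.integral_nonneg) simp
    then have "(LINT x|lebesgue_on L. (v j x)\<^sup>2) = (L2_norm L (v j))\<^sup>2" by (simp add: L2_norm_def)
    also have "\<dots> \<le> m\<^sup>2" using m[of j] nn by (intro power_mono) (auto simp: L2_norm_def)
    finally show ?thesis .
  qed
  have vi: "integrable (lebesgue_on L) (\<lambda>x. (v j x)\<^sup>2)" for j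
    using v(2)[of j] L by (simp add: L2_loc_def L2_def)
  have b1: "(LINT x|lebesgue. (norm (grad \<zeta> x))\<^sup>2 * (v j x)\<^sup>2) \<le> B\<^sup>2 * m\<^sup>2" for j
  proof -
    have "(LINT x|lebesgue. (norm (grad \<zeta> x))\<^sup>2 * (v j x)\<^sup>2) \<le> B\<^sup>2 * (LINT x|lebesgue_on L. (v j x)\<^sup>2)"
      by (rule weighted_integral_le[OF Lm vi])
        (use norm_grad_power2_integrable[OF \<zeta>(1) v(2)[of j]] B L(4) in \<open>auto intro: power_mono\<close>)
    also have "\<dots> \<le> B\<^sup>2 * m\<^sup>2" by (intro mult_left_mono vL) simp
    finally show ?thesis .
  qed
  define w where "w j x = \<zeta> x * v j x" for j x
  define H where "H j x = \<zeta> x *\<^sub>R g j x + v j x *\<^sub>R grad \<zeta> x" for j x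
  have wg: "has_weak_grad UNIV (w j) (H j)" for j
    unfolding w_def H_def by (rule has_weak_grad_mult(1)[OF v(1) S \<zeta>(1)])
  have w2: "integrable lebesgue (\<lambda>x. (w j x)\<^sup>2)" for j
    unfolding w_def by (rule cutoff_mult_L2(1)[OF v S \<zeta>(1)])
  have H2: "integrable lebesgue (\<lambda>x. (norm (H j x))\<^sup>2)" for j
    unfolding H_def by (rule cutoff_mult_L2(2)[OF v S \<zeta>(1)])
  define M where "M = max (m\<^sup>2) (2 * (k * (B\<^sup>2 * m\<^sup>2)) + 2 * (B\<^sup>2 * m\<^sup>2))"
  have wM: "(LINT x|lebesgue. (w j x)\<^sup>2) \<le> M" for j
  proof -
    have "(LINT x|lebesgue. (\<zeta> x)\<^sup>2 * (v j x)\<^sup>2) \<le> 1 * (LINT x|lebesgue_on L. (v j x)\<^sup>2)"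
      by (rule weighted_integral_le[OF Lm vi])
        (use test_power2_integrable[OF \<zeta>(1) v(2)[of j]] \<zeta>(2,3) L(3) in \<open>auto simp: power_le_one\<close>)
    then show ?thesis using vL[of j] by (simp add: w_def power_mult_distrib M_def)
  qed
  have HM: "(LINT x|lebesgue. (norm (H j x))\<^sup>2) \<le> M" for j
  proof -
    have "(LINT x|lebesgue. (norm (H j x))\<^sup>2)
      \<le> 2 * (LINT x|lebesgue. (\<zeta> x)\<^sup>2 * (norm (g j x))\<^sup>2) + 2 * (LINT x|lebesgue. (norm (grad \<zeta> x))\<^sup>2 * (v j x)\<^sup>2)"
      unfolding H_def by (rule cutoff_mult_L2(3)[OF v S \<zeta>(1)])
    moreover have "(LINT x|lebesgue. (\<zeta> x)\<^sup>2 * (norm (g j x))\<^sup>2) \<le> k * (LINT x|lebesgue. (norm (grad \<zeta> x))\<^sup>2 * (v j x)\<^sup>2)"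
      unfolding k_def by (rule Caccioppoli_inequality[OF S v F lam ell \<zeta>(1)])
    moreover have "k * (LINT x|lebesgue. (norm (grad \<zeta> x))\<^sup>2 * (v j x)\<^sup>2) \<le> k * (B\<^sup>2 * m\<^sup>2)"
      by (intro mult_left_mono b1 k)
    ultimately show ?thesis using b1[of j] unfolding M_def by linarith
  qed
  have w0: "w j x = 0" and H0: "H j x = 0" if "x \<notin> L" for j x
    using L(3,4)[OF that] by (auto simp: w_def H_def)
  obtain r :: "nat \<Rightarrow> nat" where r: "strict_mono r"
    "\<And>e. e > 0 \<Longrightarrow> \<exists>N. \<forall>i\<ge>N. \<forall>j\<ge>N. sq_integral lebesgue (\<lambda>x. w (r i) x - w (r j) x) \<le> ennreal e"
  proof (rule Rellich_compactness[OF wg L(1) w0 H0 w2 H2 wM HM])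
    fix s :: "nat \<Rightarrow> nat" assume "strict_mono s"
      "\<And>e. 0 < e \<Longrightarrow> \<exists>N. \<forall>i\<ge>N. \<forall>j\<ge>N. sq_integral lebesgue (\<lambda>x. w (s i) x - w (s j) x) \<le> ennreal e"
    then show thesis by (rule that)
  qed
  have C_nn: "(\<integral>\<^sup>+x. f x \<partial>lebesgue_on C) = (\<integral>\<^sup>+x. f x * indicator C x \<partial>lebesgue)" for f
    using Cm by (simp add: nn_integral_restrict_space)
  have pt: "sq_integral (lebesgue_on C) (\<lambda>x. v i x - v j x) \<le> sq_integral lebesgue (\<lambda>x. w i x - w j x)" for i j
    unfolding C_nn
  proof (rule nn_integral_mono)
    fix x
    show "ennreal ((v i x - v j x)\<^sup>2) * indicator C x \<le> ennreal ((w i x - w j x)\<^sup>2)"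
      using \<zeta>(4)[of x] CK by (cases "x \<in> C") (auto simp: w_def)
  qed
  have gr: "sq_integral (lebesgue_on C) (\<lambda>x. norm (g i x - g j x))
      \<le> ennreal (k * B'\<^sup>2) * sq_integral lebesgue (\<lambda>x. w i x - w j x)" for i j
  proof -
    let ?v = "\<lambda>x. v i x - v j x" and ?g = "\<lambda>x. g i x - g j x"
    note d = has_weak_grad_diff[OF v(1) v(1) S, of i j] and d2 = L2_loc_diff[OF v(2) v(2), of i j] and d3 = L2_loc_diff[OF v(3) v(3), of i j]
    have i1: "integrable lebesgue (\<lambda>x. (\<theta> x)\<^sup>2 * (norm (?g x))\<^sup>2)" by (rule test_power2_integrable[OF \<theta>(1) d3])
    have i2: "integrable lebesgue (\<lambda>x. (norm (grad \<theta> x))\<^sup>2 * (?v x)\<^sup>2)"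
      using norm_grad_power2_integrable[OF \<theta>(1) d2] by simp
    have i3: "integrable lebesgue (\<lambda>x. B'\<^sup>2 * (w i x - w j x)\<^sup>2)"
      using test_power2_integrable[OF \<zeta>(1) d2] by (simp add: w_def right_diff_distrib[symmetric] power_mult_distrib)
    have "sq_integral (lebesgue_on C) (\<lambda>x. norm (?g x)) \<le> (\<integral>\<^sup>+x. ennreal ((\<theta> x)\<^sup>2 * (norm (?g x))\<^sup>2) \<partial>lebesgue)"
      unfolding C_nn
    proof (rule nn_integral_mono)
      fix x show "ennreal ((norm (?g x))\<^sup>2) * indicator C x \<le> ennreal ((\<theta> x)\<^sup>2 * (norm (?g x))\<^sup>2)"
        using \<theta>(2)[of x] by (cases "x \<in> C") auto
    qed
    also have "\<dots> = ennreal (LINT x|lebesgue. (\<theta> x)\<^sup>2 * (norm (?g x))\<^sup>2)"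
      by (rule nn_integral_eq_integral[OF i1]) simp
    also have "\<dots> \<le> ennreal (k * (LINT x|lebesgue. (norm (grad \<theta> x))\<^sup>2 * (?v x)\<^sup>2))"
      unfolding k_def
      by (intro ennreal_leI Caccioppoli_inequality[OF S d d2 d3 weak_div_zero_diff[OF F(1) F(1) S] L2_loc_diff[OF F(2) F(2)] lam ell_diff \<theta>(1)])
    also have "\<dots> \<le> ennreal (k * (LINT x|lebesgue. B'\<^sup>2 * (w i x - w j x)\<^sup>2))"
    proof (intro ennreal_leI mult_left_mono Bochner_Integration.integral_mono[OF i2 i3] k)
      fix x
      show "(norm (grad \<theta> x))\<^sup>2 * (?v x)\<^sup>2 \<le> B'\<^sup>2 * (w i x - w j x)\<^sup>2"
      proof (cases "x \<in> K")
        case True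
        then have "w i x - w j x = ?v x" using \<zeta>(4) by (simp add: w_def)
        moreover have "(norm (grad \<theta> x))\<^sup>2 \<le> B'\<^sup>2" using B'(2)[of x] by (intro power_mono) auto
        ultimately show ?thesis by (simp add: mult_right_mono)
      next
        case False then show ?thesis using K(4) by simp
      qed
    qed
    also have "\<dots> = ennreal k * (\<integral>\<^sup>+x. ennreal (B'\<^sup>2 * (w i x - w j x)\<^sup>2) \<partial>lebesgue)"
      using k by (subst nn_integral_eq_integral[OF i3]) (auto simp: ennreal_mult)
    also have "\<dots> = ennreal (k * B'\<^sup>2) * sq_integral lebesgue (\<lambda>x. w i x - w j x)"
    proof -
      have [measurable]: "w i \<in> borel_measurable lebesgue" for i
        unfolding w_def using has_weak_grad_mult(2)[OF v(1) S \<zeta>(1)] by simp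
      show ?thesis using k by (simp add: ennreal_mult nn_integral_cmult mult.assoc)
    qed
    finally show ?thesis .
  qed
  show ?thesis
  proof (rule that[OF r(1)])
    fix e :: real assume e: "e > 0"
    define e' where "e' = e / (1 + k * B'\<^sup>2)"
    have kB: "0 \<le> k * B'\<^sup>2" using k by simp
    have e': "e' > 0" "e' \<le> e" "k * B'\<^sup>2 * e' \<le> e"
      using e kB by (auto simp: e'_def field_simps add_pos_nonneg intro: mult_nonneg_nonneg)
    obtain N where N: "\<And>i j. i \<ge> N \<Longrightarrow> j \<ge> N \<Longrightarrow> sq_integral lebesgue (\<lambda>x. w (r i) x - w (r j) x) \<le> ennreal e'"
      using r(2)[OF e'(1)] by blast
    have "sq_integral (lebesgue_on C) (\<lambda>x. v (r i) x - v (r j) x) \<le> ennreal e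
      \<and> sq_integral (lebesgue_on C) (\<lambda>x. norm (g (r i) x - g (r j) x)) \<le> ennreal e" if "i \<ge> N" "j \<ge> N" for i j
    proof
      show "sq_integral (lebesgue_on C) (\<lambda>x. v (r i) x - v (r j) x) \<le> ennreal e"
        using pt[of "r i" "r j"] N[OF that] ennreal_leI[OF e'(2)] by (meson order_trans)
      have "sq_integral (lebesgue_on C) (\<lambda>x. norm (g (r i) x - g (r j) x)) \<le> ennreal (k * B'\<^sup>2) * ennreal e'"
        using gr[of "r i" "r j"] mult_left_mono[OF N[OF that], of "ennreal (k * B'\<^sup>2)"] by (meson order_trans zero_le)
      also have "\<dots> = ennreal (k * B'\<^sup>2 * e')" using kB e'(1) by (simp add: ennreal_mult)
      also have "\<dots> \<le> ennreal e" by (rule ennreal_leI[OF e'(3)])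
      finally show "sq_integral (lebesgue_on C) (\<lambda>x. norm (g (r i) x - g (r j) x)) \<le> ennreal e" .
    qed
    then show "\<exists>N. \<forall>i\<ge>N. \<forall>j\<ge>N. sq_integral (lebesgue_on C) (\<lambda>x. v (r i) x - v (r j) x) \<le> ennreal e
      \<and> sq_integral (lebesgue_on C) (\<lambda>x. norm (g (r i) x - g (r j) x)) \<le> ennreal e" by blast
  qed
qed

section \<open>Passage to the limit\<close>

lemma continuous_compact_support_L2:
  fixes p :: "real^'n \<Rightarrow> 'b::euclidean_space"
  assumes p: "continuous_on UNIV p" and K: "compact K" "\<And>x. x \<notin> K \<Longrightarrow> p x = 0" and S: "S \<in> sets lebesgue"
  shows "L2 S p"
proof -
  have m: "p \<in> borel_measurable lebesgue" by (rule continuous_borel_lebesgue[OF p])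
  have "integrable lborel (\<lambda>x. (norm (p x))\<^sup>2)"
    by (rule continuous_compact_support_integrable[OF _ K(1)]) (use p K(2) in \<open>auto intro: continuous_intros\<close>)
  then have "integrable lebesgue (\<lambda>x. (norm (p x))\<^sup>2)"
    using integrable_completion[of "\<lambda>x. (norm (p x))\<^sup>2" lborel] by (simp add: borel_measurable_integrable)
  then have "L2 UNIV p" using m by (simp add: L2_def lebesgue_on_UNIV_eq)
  then show ?thesis by (rule L2_subset) (use S in auto)
qed

lemma L2_limit:
  assumes f: "L2 S f" and g: "g \<in> borel_measurable (lebesgue_on S)"
    and le: "sq_integral (lebesgue_on S) (\<lambda>x. norm (f x - g x)) \<le> ennreal a" and a: "0 \<le> a"
  shows "L2 S g"
proof (rule L2_I[OF g])
  have fm: "f \<in> borel_measurable (lebesgue_on S)" using f by (simp add: L2_def)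
  have "sq_integral (lebesgue_on S) (\<lambda>x. norm (g x))
    \<le> 2 * sq_integral (lebesgue_on S) (\<lambda>x. norm (g x - f x)) + 2 * sq_integral (lebesgue_on S) (\<lambda>x. norm (f x))"
    by (rule nn_integral_norm_power2_le[OF g fm])
  also have "\<dots> \<le> 2 * ennreal a + 2 * ennreal ((L2_norm S f)\<^sup>2)"
    using le L2_nn_integral[OF f] by (intro add_mono mult_left_mono) (auto simp: norm_minus_commute)
  also have "\<dots> = ennreal (2 * a + 2 * (L2_norm S f)\<^sup>2)"
    using a by (simp add: ennreal_plus ennreal_mult)
  finally show "sq_integral (lebesgue_on S) (\<lambda>x. norm (g x)) \<le> ennreal (2 * a + 2 * (L2_norm S f)\<^sup>2)" .
qed

text \<open>Both sides of the defining identity are mean square inner products with fixed test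
  functions.\<close>
lemma has_weak_grad_limit:
  fixes u :: "nat \<Rightarrow> real^'n \<Rightarrow> real"
  assumes S: "open S" and u: "\<And>k. has_weak_grad S (u k) (g k)" and L2u: "\<And>k. L2 S (u k)" "\<And>k. L2 S (g k)"
    and w: "L2 S w" "L2 S G"
    and lim: "\<And>e::real. e > 0 \<Longrightarrow> \<exists>N. \<forall>i\<ge>N. sq_integral (lebesgue_on S) (\<lambda>x. norm (u i x - w x)) \<le> ennreal e"
      "\<And>e::real. e > 0 \<Longrightarrow> \<exists>N. \<forall>i\<ge>N. sq_integral (lebesgue_on S) (\<lambda>x. norm (g i x - G x)) \<le> ennreal e"
  shows "has_weak_grad S w G"
proof (rule has_weak_gradI[OF _ _ S])
  note Sm = sets_lebesgue_open[OF S]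
  show "L1_loc S w" "L1_loc S G" using L2_imp_L1_loc[OF _ Sm] w by auto
  fix \<phi> i assume \<phi>: "\<phi> \<in> test_functions S"
  obtain K where K: "compact K" "K \<subseteq> S" "\<And>x. x \<notin> K \<Longrightarrow> \<phi> x = 0" "\<And>x. x \<notin> K \<Longrightarrow> grad \<phi> x = 0"
    using test_functions_support[OF \<phi>] by metis
  note s = test_functions_smooth[OF \<phi>]
  have meas: "f \<in> borel_measurable (lebesgue_on S)" if "L2 S f" for f :: "real^'n \<Rightarrow> 'b::euclidean_space"
    using that by (simp add: L2_def)
  have p: "L2 S (\<lambda>x. grad \<phi> x $ i)"
    by (rule continuous_compact_support_L2[OF _ K(1) _ Sm])
      (use K(4) in \<open>auto intro: smooth_on_continuous smooth_on_grad[OF s]\<close>)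
  have q: "L2 S (\<lambda>x. \<phi> x *\<^sub>R axis i (1::real))"
    by (rule continuous_compact_support_L2[OF _ K(1) _ Sm])
      (use K(3) in \<open>auto intro!: continuous_intros smooth_on_continuous[OF s]\<close>)
  have iu: "integrable (lebesgue_on S) (\<lambda>x. u k x \<bullet> grad \<phi> x $ i)" for k
    using L1_loc_test_integrable[OF has_weak_grad_L1(1)[OF u[of k]] test_functions_grad[OF \<phi>], of i]
    by (intro integrable_lebesgue_on[OF Sm]) (simp add: mult.commute)
  have ig: "integrable (lebesgue_on S) (\<lambda>x. g k x \<bullet> (\<phi> x *\<^sub>R axis i (1::real)))" for k
    using L1_loc_test_integrable[OF has_weak_grad_L1(3)[OF u[of k], of i] \<phi>]
    by (intro integrable_lebesgue_on[OF Sm]) (simp add: inner_axis)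
  have "(\<lambda>k. LINT x|lebesgue_on S. u k x \<bullet> grad \<phi> x $ i) \<longlonglongrightarrow> (LINT x|lebesgue_on S. w x \<bullet> grad \<phi> x $ i)"
    by (rule integral_inner_tendsto[OF meas[OF L2u(1)] meas[OF w(1)] meas[OF p] eq_refl[OF L2_nn_integral[OF p]] iu lim(1)])
  moreover have "(\<lambda>k. LINT x|lebesgue_on S. g k x \<bullet> (\<phi> x *\<^sub>R axis i 1)) \<longlonglongrightarrow> (LINT x|lebesgue_on S. G x \<bullet> (\<phi> x *\<^sub>R axis i 1))"
    by (rule integral_inner_tendsto[OF meas[OF L2u(2)] meas[OF w(2)] meas[OF q] eq_refl[OF L2_nn_integral[OF q]] ig lim(2)])
  ultimately have l: "(\<lambda>k. LINT x|lebesgue. grad \<phi> x $ i * u k x) \<longlonglongrightarrow> (LINT x|lebesgue. grad \<phi> x $ i * w x)"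
    "(\<lambda>k. LINT x|lebesgue. \<phi> x * g k x $ i) \<longlonglongrightarrow> (LINT x|lebesgue. \<phi> x * G x $ i)"
    using test_functions_zero[OF \<phi>] by (simp_all add: lebesgue_on_support(2)[OF Sm] inner_axis mult.commute)
  have "(\<lambda>k. - (LINT x|lebesgue. \<phi> x * g k x $ i)) \<longlonglongrightarrow> (LINT x|lebesgue. grad \<phi> x $ i * w x)"
    using l(1) has_weak_gradD[OF u S \<phi>] by simp
  with tendsto_minus[OF l(2)] show "(LINT x|lebesgue. grad \<phi> x $ i * w x) = - (LINT x|lebesgue. \<phi> x * G x $ i)"
    using LIMSEQ_unique by blast
qed

lemma weak_div_zero_limit:
  fixes F :: "nat \<Rightarrow> real^'n \<Rightarrow> real^'n"
  assumes S: "open S" and F: "\<And>k. weak_div_zero S (F k)" "\<And>k. L2 S (F k)" and G: "L2 S G"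
    and lim: "\<And>e::real. e > 0 \<Longrightarrow> \<exists>N. \<forall>i\<ge>N. sq_integral (lebesgue_on S) (\<lambda>x. norm (F i x - G x)) \<le> ennreal e"
  shows "weak_div_zero S G"
proof -
  note Sm = sets_lebesgue_open[OF S]
  have "(LINT x|lebesgue_on S. G x \<bullet> grad \<phi> x) = 0" if \<phi>: "\<phi> \<in> test_functions S" for \<phi>
  proof -
    obtain K where K: "compact K" "K \<subseteq> S" "\<And>x. x \<notin> K \<Longrightarrow> grad \<phi> x = 0"
      using test_functions_support[OF \<phi>] by metis
    have p: "L2 S (grad \<phi>)"
      by (rule continuous_compact_support_L2[OF smooth_on_continuous_grad[OF test_functions_smooth[OF \<phi>]] K(1,3) Sm])
    have meas: "f \<in> borel_measurable (lebesgue_on S)" if "L2 S f" for f :: "real^'n \<Rightarrow> real^'n"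
      using that by (simp add: L2_def)
    have i: "integrable (lebesgue_on S) (\<lambda>x. F k x \<bullet> grad \<phi> x)" for k
      using F(1)[of k] by (intro integrable_lebesgue_on[OF Sm] inner_grad_integrable[OF _ \<phi>]) (simp add: weak_div_zero_def)
    have "(\<lambda>k. LINT x|lebesgue_on S. F k x \<bullet> grad \<phi> x) \<longlonglongrightarrow> (LINT x|lebesgue_on S. G x \<bullet> grad \<phi> x)"
      by (rule integral_inner_tendsto[OF meas[OF F(2)] meas[OF G] meas[OF p] eq_refl[OF L2_nn_integral[OF p]] i lim])
    moreover have "(LINT x|lebesgue_on S. F k x \<bullet> grad \<phi> x) = 0" for k
      using F(1) \<phi> by (simp add: weak_div_zero_def)
    ultimately show ?thesis by (simp add: LIMSEQ_const_iff)
  qed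
  then show ?thesis using L2_imp_L1_loc[OF G Sm] by (simp add: weak_div_zero_def)
qed

lemma has_weak_grad_weak_grad: "has_weak_grad S u g \<Longrightarrow> has_weak_grad S u (weak_grad S u)"
  unfolding weak_grad_def by (rule someI[of "has_weak_grad S u"])

lemma W12_norm_eq:
  assumes S: "open S" and u: "has_weak_grad S u g" and g: "L2 S g"
  shows "W12_norm S u = sqrt ((L2_norm S u)\<^sup>2 + (L2_norm S g)\<^sup>2)"
proof -
  have "has_weak_grad S u (weak_grad S u)" by (rule has_weak_grad_weak_grad[OF u])
  then have "AE x in lebesgue. x \<in> S \<longrightarrow> g x = weak_grad S u x" by (rule weak_grad_unique[OF S u])
  from L2_cong_AE(2)[OF g sets_lebesgue_open[OF S] this] show ?thesis by (simp add: W12_norm_def)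
qed

lemma L2_norm_le:
  assumes "L2 S f" "sq_integral (lebesgue_on S) (\<lambda>x. norm (f x)) \<le> ennreal e" "0 \<le> e"
  shows "(L2_norm S f)\<^sup>2 \<le> e"
  using assms L2_nn_integral[OF assms(1)] by (simp add: ennreal_le_iff)

theorem proposition0p2:
  fixes \<Omega> :: "(real ^ 'n) set"
    and A :: "real ^ 'n \<Rightarrow> ((real ^ 'n) \<Rightarrow>\<^sub>L (real ^ 'n))"
    and lam Lam :: real
    and u :: "nat \<Rightarrow> real ^ 'n \<Rightarrow> real"
    and U :: "(real ^ 'n) set"
  assumes "open \<Omega>" and "connected \<Omega>"
    and "Linfty \<Omega> A"
    and "AE x in lebesgue_on \<Omega>. normal_map (A x)"
    and "0 < lam" and "lam \<le> Lam"
    and "AE x in lebesgue_on \<Omega>. \<forall>v. lam * (norm v)\<^sup>2 \<le> blinfun_apply (A x) v \<bullet> v"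
    and "AE x in lebesgue_on \<Omega>. norm (A x) < Lam"
    and "\<And>j. W12_loc \<Omega> (u j)"
    and "\<And>K. compact K \<Longrightarrow> K \<subseteq> \<Omega> \<Longrightarrow> bdd_above (range (\<lambda>j. L2_norm K (u j)))"
    and "\<And>j. weak_div_zero \<Omega> (\<lambda>x. blinfun_apply (A x) (weak_grad \<Omega> (u j) x))"
    and "open U" and "simply_connected U" and "smooth_boundary U"
    and "compactly_contained U \<Omega>"
  shows "\<exists>(r :: nat \<Rightarrow> nat) w. strict_mono r \<and> W12 U w \<and>
           W12_converges U (\<lambda>k. u (r k)) w \<and>
           weak_div_zero U (\<lambda>x. blinfun_apply (A x) (weak_grad U w x))"
proof -
  note \<Omega> = assms(1) and U = assms(12)
  note \<Omega>m = sets_lebesgue_open[OF \<Omega>] and Um = sets_lebesgue_open[OF U]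
  have C: "compact (closure U)" "closure U \<subseteq> \<Omega>" using assms(15) by (auto simp: compactly_contained_def)
  then have U\<Omega>: "U \<subseteq> \<Omega>" using closure_subset by blast
  define g where "g j = weak_grad \<Omega> (u j)" for j
  define F where "F j x = blinfun_apply (A x) (g j x)" for j x
  \<comment> \<open>The hypothesis provides some square integrable weak gradient; by uniqueness the chosen one
    is square integrable too.\<close>
  have ug: "has_weak_grad \<Omega> (u j) (g j)" and L2g: "L2_loc \<Omega> (g j)" for j
  proof -
    obtain h where h: "has_weak_grad \<Omega> (u j) h" "L2_loc \<Omega> h" using assms(9)[of j] by (auto simp: W12_loc_def)
    show ug: "has_weak_grad \<Omega> (u j) (g j)" unfolding g_def by (rule has_weak_grad_weak_grad[OF h(1)])
    have ae: "AE x in lebesgue. x \<in> \<Omega> \<longrightarrow> h x = g j x" by (rule weak_grad_unique[OF \<Omega> h(1) ug])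
    show "L2_loc \<Omega> (g j)"
      unfolding L2_loc_def
    proof (intro allI impI, elim conjE)
      fix K assume K: "compact K" "K \<subseteq> \<Omega>"
      show "L2 K (g j)"
      proof (rule L2_cong_AE(1)[OF _ sets_lebesgue_compact[OF K(1)]])
        show "L2 K h" using h(2) K by (simp add: L2_loc_def)
        show "AE x in lebesgue. x \<in> K \<longrightarrow> h x = g j x" using ae by eventually_elim (use K(2) in blast)
      qed
    qed
  qed
  have L2u: "L2_loc \<Omega> (u j)" for j using assms(9)[of j] by (simp add: W12_loc_def)
  have ell: "AE x in lebesgue. x \<in> \<Omega> \<longrightarrow> (\<forall>v. lam * (norm v)\<^sup>2 \<le> blinfun_apply (A x) v \<bullet> v \<and> norm (blinfun_apply (A x) v) \<le> Lam * norm v)"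
  proof -
    have "AE x in lebesgue. x \<in> \<Omega> \<longrightarrow> (\<forall>v. lam * (norm v)\<^sup>2 \<le> blinfun_apply (A x) v \<bullet> v)"
      using assms(7) \<Omega>m by (subst (asm) AE_restrict_space_iff) auto
    moreover have "AE x in lebesgue. x \<in> \<Omega> \<longrightarrow> norm (A x) < Lam"
      using assms(8) \<Omega>m by (subst (asm) AE_restrict_space_iff) auto
    ultimately show ?thesis
    proof eventually_elim
      case (elim x)
      have "norm (blinfun_apply (A x) v) \<le> Lam * norm v" if "x \<in> \<Omega>" for v
        using norm_blinfun[of "A x" v] mult_right_mono[of "norm (A x)" Lam "norm v"] elim(2) that by auto
      with elim(1) show ?case by blast
    qed
  qed
  have Lam: "0 \<le> Lam" using assms(5,6) by simp
  have Fdiv: "weak_div_zero \<Omega> (F j)" for j using assms(11)[of j] by (simp add: F_def[abs_def] g_def)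
  \<comment> \<open>The upper bound on the coefficients makes the fluxes locally square integrable.\<close>
  have L2F: "L2_loc \<Omega> (F j)" for j
    unfolding L2_loc_def
  proof (intro allI impI, elim conjE)
    fix K assume K: "compact K" "K \<subseteq> \<Omega>"
    have m: "F j \<in> borel_measurable (lebesgue_on K)"
      using Fdiv[of j] K by (auto simp: weak_div_zero_def L1_loc_def)
    have i: "integrable (lebesgue_on K) (\<lambda>x. Lam\<^sup>2 * (norm (g j x))\<^sup>2)"
      using L2g[of j] K by (simp add: L2_loc_def L2_def)
    have "integrable (lebesgue_on K) (\<lambda>x. (norm (F j x))\<^sup>2)"
    proof (rule Bochner_Integration.integrable_bound[OF i])
      show "(\<lambda>x. (norm (F j x))\<^sup>2) \<in> borel_measurable (lebesgue_on K)" using m by measurable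
      have "AE x in lebesgue. x \<in> K \<longrightarrow> norm ((norm (F j x))\<^sup>2) \<le> norm (Lam\<^sup>2 * (norm (g j x))\<^sup>2)"
        using ell
      proof eventually_elim
        case (elim x)
        show ?case
        proof
          assume "x \<in> K"
          then have "norm (F j x) \<le> Lam * norm (g j x)" using elim K(2) by (auto simp: F_def)
          then have "(norm (F j x))\<^sup>2 \<le> (Lam * norm (g j x))\<^sup>2" by (rule power_mono) simp
          then show "norm ((norm (F j x))\<^sup>2) \<le> norm (Lam\<^sup>2 * (norm (g j x))\<^sup>2)" by (simp add: power_mult_distrib)
        qed
      qed
      then show "AE x in lebesgue_on K. norm ((norm (F j x))\<^sup>2) \<le> norm (Lam\<^sup>2 * (norm (g j x))\<^sup>2)"
        using sets_lebesgue_compact[OF K(1)] by (subst AE_restrict_space_iff) auto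
    qed
    with m show "L2 K (F j)" by (simp add: L2_def)
  qed
  have ell1: "AE x in lebesgue. x \<in> \<Omega> \<longrightarrow> lam * (norm (g j x))\<^sup>2 \<le> F j x \<bullet> g j x \<and> norm (F j x) \<le> Lam * norm (g j x)" for j
    using ell by eventually_elim (simp add: F_def)
  have ell2: "AE x in lebesgue. x \<in> \<Omega> \<longrightarrow>
      lam * (norm (g i x - g j x))\<^sup>2 \<le> (F i x - F j x) \<bullet> (g i x - g j x) \<and> norm (F i x - F j x) \<le> Lam * norm (g i x - g j x)" for i j
    using ell by eventually_elim (simp add: F_def blinfun.diff_right[symmetric])
  obtain r :: "nat \<Rightarrow> nat" where r: "strict_mono r"
    "\<And>e. e > 0 \<Longrightarrow> \<exists>N. \<forall>i\<ge>N. \<forall>j\<ge>N. sq_integral (lebesgue_on (closure U)) (\<lambda>x. u (r i) x - u (r j) x) \<le> ennreal e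
      \<and> sq_integral (lebesgue_on (closure U)) (\<lambda>x. norm (g (r i) x - g (r j) x)) \<le> ennreal e"
  proof (rule solutions_Cauchy_subsequence[OF \<Omega> ug L2u L2g Fdiv L2F assms(5) Lam ell1 ell2 assms(10) C])
    fix s :: "nat \<Rightarrow> nat" assume "strict_mono s"
      "\<And>e. e > 0 \<Longrightarrow> \<exists>N. \<forall>i\<ge>N. \<forall>j\<ge>N. sq_integral (lebesgue_on (closure U)) (\<lambda>x. u (s i) x - u (s j) x) \<le> ennreal e
        \<and> sq_integral (lebesgue_on (closure U)) (\<lambda>x. norm (g (s i) x - g (s j) x)) \<le> ennreal e"
    then show thesis by (rule that)
  qed
  have U_le: "(\<integral>\<^sup>+x. f x \<partial>lebesgue_on U) \<le> (\<integral>\<^sup>+x. f x \<partial>lebesgue_on (closure U))" for f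
  proof -
    have "(\<integral>\<^sup>+x. f x * indicator U x \<partial>lebesgue) \<le> (\<integral>\<^sup>+x. f x * indicator (closure U) x \<partial>lebesgue)"
      using closure_subset[of U] by (intro nn_integral_mono mult_left_mono) (auto split: split_indicator)
    then show ?thesis using Um sets_lebesgue_compact[OF C(1)] by (simp add: nn_integral_restrict_space)
  qed
  have L2U: "L2 U f" if "L2_loc \<Omega> f" for f :: "real^'n \<Rightarrow> 'b::euclidean_space"
    using that C by (intro L2_subset[OF _ sets_lebesgue_compact[OF C(1)] Um closure_subset]) (simp add: L2_loc_def)
  note uU = L2U[OF L2u] and gU = L2U[OF L2g] and FU = L2U[OF L2F]
  have meas: "f \<in> borel_measurable (lebesgue_on U)" if "L2 U f" for f :: "real^'n \<Rightarrow> 'b::euclidean_space"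
    using that by (simp add: L2_def)
  obtain w where w: "w \<in> borel_measurable (lebesgue_on U)"
    "\<And>e::real. e > 0 \<Longrightarrow> \<exists>N. \<forall>i\<ge>N. sq_integral (lebesgue_on U) (\<lambda>x. norm (u (r i) x - w x)) \<le> ennreal e"
  proof (rule L2_complete[of "\<lambda>i. u (r i)" "lebesgue_on U"])
    fix e :: real assume "e > 0"
    then obtain N where "\<forall>i\<ge>N. \<forall>j\<ge>N. sq_integral (lebesgue_on (closure U)) (\<lambda>x. u (r i) x - u (r j) x) \<le> ennreal e"
      using r(2) by blast
    then show "\<exists>N. \<forall>i\<ge>N. \<forall>j\<ge>N. sq_integral (lebesgue_on U) (\<lambda>x. norm (u (r i) x - u (r j) x)) \<le> ennreal e"
      using order_trans[OF U_le] by (intro exI[of _ N]) auto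
  qed (use meas[OF uU] in auto)
  obtain G where G: "G \<in> borel_measurable (lebesgue_on U)"
    "\<And>e::real. e > 0 \<Longrightarrow> \<exists>N. \<forall>i\<ge>N. sq_integral (lebesgue_on U) (\<lambda>x. norm (g (r i) x - G x)) \<le> ennreal e"
  proof (rule L2_complete[of "\<lambda>i. g (r i)" "lebesgue_on U"])
    fix e :: real assume "e > 0"
    then obtain N where "\<forall>i\<ge>N. \<forall>j\<ge>N. sq_integral (lebesgue_on (closure U)) (\<lambda>x. norm (g (r i) x - g (r j) x)) \<le> ennreal e"
      using r(2) by blast
    then show "\<exists>N. \<forall>i\<ge>N. \<forall>j\<ge>N. sq_integral (lebesgue_on U) (\<lambda>x. norm (g (r i) x - g (r j) x)) \<le> ennreal e"
      using order_trans[OF U_le] by (intro exI[of _ N]) auto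
  qed (use meas[OF gU] in auto)
  have wL2: "L2 U w"
  proof -
    obtain N where "sq_integral (lebesgue_on U) (\<lambda>x. norm (u (r N) x - w x)) \<le> ennreal 1" using w(2)[of 1] by auto
    then show ?thesis by (rule L2_limit[OF uU w(1)]) simp
  qed
  have GL2: "L2 U G"
  proof -
    obtain N where "sq_integral (lebesgue_on U) (\<lambda>x. norm (g (r N) x - G x)) \<le> ennreal 1" using G(2)[of 1] by auto
    then show ?thesis by (rule L2_limit[OF gU G(1)]) simp
  qed
  have ugU: "has_weak_grad U (u j) (g j)" for j by (rule has_weak_grad_subset[OF ug \<Omega> U U\<Omega>])
  have wG: "has_weak_grad U w G"
    by (rule has_weak_grad_limit[OF U ugU uU gU wL2 GL2 w(2) G(2)])
  have W12w: "W12 U w" using wL2 wG GL2 by (auto simp: W12_def)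
  have "W12 U (u (r k))" for k using uU[of "r k"] ugU[of "r k"] gU[of "r k"] by (auto simp: W12_def)
  moreover have "(\<lambda>k. W12_norm U (\<lambda>x. u (r k) x - w x)) \<longlonglongrightarrow> 0"
  proof (rule LIMSEQ_I)
    fix e :: real assume e: "e > 0"
    define e' where "e' = e\<^sup>2 / 4"
    have e': "e' > 0" using e by (simp add: e'_def)
    obtain N1 N2 where N: "\<And>i. i \<ge> N1 \<Longrightarrow> sq_integral (lebesgue_on U) (\<lambda>x. norm (u (r i) x - w x)) \<le> ennreal e'"
      "\<And>i. i \<ge> N2 \<Longrightarrow> sq_integral (lebesgue_on U) (\<lambda>x. norm (g (r i) x - G x)) \<le> ennreal e'"
      using w(2)[OF e'] G(2)[OF e'] by blast
    have "norm (W12_norm U (\<lambda>x. u (r k) x - w x) - 0) < e" if "k \<ge> max N1 N2" for k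
    proof -
      have "(L2_norm U (\<lambda>x. u (r k) x - w x))\<^sup>2 \<le> e'" "(L2_norm U (\<lambda>x. g (r k) x - G x))\<^sup>2 \<le> e'"
        using that e' N by (auto intro!: L2_norm_le L2_diff uU gU wL2 GL2)
      then have "(L2_norm U (\<lambda>x. u (r k) x - w x))\<^sup>2 + (L2_norm U (\<lambda>x. g (r k) x - G x))\<^sup>2 \<le> e\<^sup>2 / 2"
        by (simp add: e'_def)
      also have "\<dots> < e\<^sup>2" using e by simp
      finally have "sqrt ((L2_norm U (\<lambda>x. u (r k) x - w x))\<^sup>2 + (L2_norm U (\<lambda>x. g (r k) x - G x))\<^sup>2) < sqrt (e\<^sup>2)"
        by (rule real_sqrt_less_mono)
      moreover have "W12_norm U (\<lambda>x. u (r k) x - w x) = sqrt ((L2_norm U (\<lambda>x. u (r k) x - w x))\<^sup>2 + (L2_norm U (\<lambda>x. g (r k) x - G x))\<^sup>2)"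
        by (rule W12_norm_eq[OF U has_weak_grad_diff[OF ugU wG U] L2_diff[OF gU GL2]])
      ultimately show ?thesis using e by simp
    qed
    then show "\<exists>N. \<forall>k\<ge>N. norm (W12_norm U (\<lambda>x. u (r k) x - w x) - 0) < e" by blast
  qed
  ultimately have conv: "W12_converges U (\<lambda>k. u (r k)) w" using W12w by (simp add: W12_converges_def)
  define G' where "G' = weak_grad U w"
  have wG': "has_weak_grad U w G'" unfolding G'_def by (rule has_weak_grad_weak_grad[OF wG])
  \<comment> \<open>The equation for the limit is about the weak gradient chosen on \<open>U\<close>, which agrees with the
    limit of the gradients almost everywhere.\<close>
  have GG': "AE x in lebesgue. x \<in> U \<longrightarrow> G x = G' x" by (rule weak_grad_unique[OF U wG wG'])
  have G'm: "G' \<in> borel_measurable (lebesgue_on U)" by (rule meas[OF L2_cong_AE(1)[OF GL2 Um GG']])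
  have AG'm: "(\<lambda>x. blinfun_apply (A x) (G' x)) \<in> borel_measurable (lebesgue_on U)"
    using assms(3) by (intro measurable_blinfun_apply G'm measurable_restrict_mono[OF _ U\<Omega>]) (simp add: Linfty_def)
  have lip: "sq_integral (lebesgue_on U) (\<lambda>x. norm (F i x - blinfun_apply (A x) (G' x)))
      \<le> ennreal (Lam\<^sup>2) * sq_integral (lebesgue_on U) (\<lambda>x. norm (g i x - G x))" for i
  proof -
    have "AE x in lebesgue. x \<in> U \<longrightarrow> ennreal ((norm (F i x - blinfun_apply (A x) (G' x)))\<^sup>2) \<le> ennreal (Lam\<^sup>2) * ennreal ((norm (g i x - G x))\<^sup>2)"
      using ell GG'
    proof eventually_elim
      case (elim x)
      show ?case
      proof
        assume x: "x \<in> U"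
        have "norm (F i x - blinfun_apply (A x) (G' x)) \<le> Lam * norm (g i x - G x)"
          using elim x U\<Omega> by (auto simp: F_def blinfun.diff_right[symmetric])
        then have "(norm (F i x - blinfun_apply (A x) (G' x)))\<^sup>2 \<le> (Lam * norm (g i x - G x))\<^sup>2" by (rule power_mono) simp
        then show "ennreal ((norm (F i x - blinfun_apply (A x) (G' x)))\<^sup>2) \<le> ennreal (Lam\<^sup>2) * ennreal ((norm (g i x - G x))\<^sup>2)"
          by (simp add: power_mult_distrib ennreal_mult[symmetric] ennreal_leI)
      qed
    qed
    then have "sq_integral (lebesgue_on U) (\<lambda>x. norm (F i x - blinfun_apply (A x) (G' x)))
      \<le> (\<integral>\<^sup>+x. ennreal (Lam\<^sup>2) * ennreal ((norm (g i x - G x))\<^sup>2) \<partial>lebesgue_on U)"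
      using Um by (intro nn_integral_mono_AE) (simp add: AE_restrict_space_iff)
    also have "\<dots> = ennreal (Lam\<^sup>2) * sq_integral (lebesgue_on U) (\<lambda>x. norm (g i x - G x))"
      using meas[OF gU[of i]] G(1) by (intro nn_integral_cmult) measurable
    finally show ?thesis .
  qed
  have Flim: "\<exists>N. \<forall>i\<ge>N. sq_integral (lebesgue_on U) (\<lambda>x. norm (F (r i) x - blinfun_apply (A x) (G' x))) \<le> ennreal e"
    if e: "e > 0" for e
  proof -
    define e' where "e' = e / Lam\<^sup>2"
    have Lp: "Lam > 0" using assms(5,6) by simp
    have e': "e' > 0" using e Lp by (simp add: e'_def)
    obtain N where N: "\<And>i. i \<ge> N \<Longrightarrow> sq_integral (lebesgue_on U) (\<lambda>x. norm (g (r i) x - G x)) \<le> ennreal e'"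
      using G(2)[OF e'] by blast
    have "sq_integral (lebesgue_on U) (\<lambda>x. norm (F (r i) x - blinfun_apply (A x) (G' x))) \<le> ennreal e" if "i \<ge> N" for i
    proof -
      have "sq_integral (lebesgue_on U) (\<lambda>x. norm (F (r i) x - blinfun_apply (A x) (G' x))) \<le> ennreal (Lam\<^sup>2) * ennreal e'"
        by (rule order_trans[OF lip mult_left_mono[OF N[OF that]]]) simp
      also have "\<dots> = ennreal e" using Lp e by (simp add: e'_def ennreal_mult[symmetric])
      finally show ?thesis .
    qed
    then show ?thesis by blast
  qed
  have AG'L2: "L2 U (\<lambda>x. blinfun_apply (A x) (G' x))"
  proof -
    obtain N where "sq_integral (lebesgue_on U) (\<lambda>x. norm (F (r N) x - blinfun_apply (A x) (G' x))) \<le> ennreal 1"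
      using Flim[of 1] by auto
    then show ?thesis by (rule L2_limit[OF FU AG'm]) simp
  qed
  have FdivU: "weak_div_zero U (F j)" for j
  proof (rule weak_div_zeroI[OF _ U])
    show "L1_loc U (F j)" by (rule L2_imp_L1_loc[OF FU Um])
    show "(LINT x|lebesgue. F j x \<bullet> grad \<phi> x) = 0" if "\<phi> \<in> test_functions U" for \<phi>
      using that test_functions_mono[OF U\<Omega>] by (intro weak_div_zeroD[OF Fdiv \<Omega>]) blast
  qed
  have "weak_div_zero U (\<lambda>x. blinfun_apply (A x) (G' x))"
    by (rule weak_div_zero_limit[OF U FdivU FU AG'L2 Flim])
  then show ?thesis using r(1) W12w conv unfolding G'_def by blast
qed

end
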